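(* In the setting of the context there exists a constant $C>0$, depending only on $\gamma_1,\gamma_2$, the initial triangulation $\mathcal T_0$ and $\varrho$, such that for all $\mathcal T\in\mathbb T$ and all $f\in L^2(\Omega)$ the following holds. Let $F(v):=\int_\Omega fv\,dx$, let $(u,t)\in X=H^1_0(\Omega)\times H^{-1/2}(\partial\mathcal T)$ be the unique solution to $b(u,t;v)=F(v)$ for all $v\in Y=H^1(\mathcal T)$, let $X_h:=S^1_0(\mathcal T)\times P_0(\mathcal E)$, $Y_h:=P_1(\mathcal T)$, let $(u_h,t_h)\in X_h$ be any minimizer of $\|F-b(\xi_h;\cdot)\|_{Y_h^*}$ over $\xi_h\in X_h$, and let $v_h\in Y_h$ be the Riesz representation of its residual, i.e. $a(v_h,\eta_h)=F(\eta_h)-b(u_h,t_h;\eta_h)$ for all $\eta_h\in Y_h$. Then $$\|\nabla(u-u_h)\|_{L^2(\Omega)}+\|v_h\|_Y\le C\Big(\inf_{u_C\in S^1_0(\mathcal T)}\|\nabla(u-u_C)\|_{L^2(\Omega)}+\inf_{t_0\in P_0(\mathcal E)}\|t-t_0\|_{H^{-1/2}(\partial\mathcal T)}\Big).$$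
   Context: $\Omega\subset\mathbb R^n$ is a bounded Lipschitz domain with polyhedral boundary. $\mathcal T_0$ is a fixed initial regular (conforming) triangulation of $\Omega$ into $n$-simplices and, for a fixed $\varrho>0$, $\mathbb T$ is the set of regular triangulations $\mathcal T$ of $\Omega$ that are refinements of $\mathcal T_0$ with $h_T^n\le\varrho|T|$ for all $T\in\mathcal T$, where $h_T=\operatorname{diam}T$. $\mathcal E$ is the set of all sides of $\mathcal T$, $\nu_T$ the outer unit normal of $T$; each side $E$ has a globally fixed unit normal $\nu_E$ (equal to $\nu_T|_E$ for one of the simplices $T$ containing $E$). Nonlinearity: $\phi:[0,\infty)\to\mathbb R$ is continuous, $\phi\in C^2(0,\infty)$, and with constants $0<\gamma_1\le\gamma_2$: $\gamma_1\le\phi(t)\le\gamma_2$ and $\gamma_1\le\phi(t)+t\phi'(t)\le\gamma_2$; $\sigma(A):=\phi(|A|)A$ for $A\in\mathbb R^n$, and $\sigma\in C^1(\mathbb R^n;\mathbb R^n)$. Spaces: $H^{-1/2}(\partial\mathcal T)$ is the set of all $t=(t_T)_{T\in\mathcal T}\in\prod_TH^{-1/2}(\partial T)$ for which there is $q\in H(\operatorname{div},\Omega)$ with $t_T=(q|_T)|_{\partial T}\cdot\nu_T$ for all $T$, normed by $\|t\|_{H^{-1/2}(\partial\mathcal T)}=\min\|q\|_{H(\operatorname{div},\Omega)}$ over all such $q$, where $\|q\|_{H(\operatorname{div},\Omega)}^2=\|q\|_{L^2}^2+\|\operatorname{div}q\|_{L^2}^2$. $\langle t,v\rangle_{\partial\mathcal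 T}=\sum_T\langle t_T,v|_T\rangle_{\partial T}$ for $v\in H^1(\mathcal T)$ (duality of $H^{-1/2}(\partial T)$ and $H^{1/2}(\partial T)$ extending the $L^2(\partial T)$ product). $P_0(\mathcal E)$ = functions constant on each side, embedded into $H^{-1/2}(\partial\mathcal T)$ by $t_T|_E=(\nu_T\cdot\nu_E)t_0|_E$ (equivalently, as normal traces of lowest-order Raviart–Thomas functions). $P_k(\mathcal T)$ = piecewise polynomials of degree $\le k$, $S^1_0(\mathcal T)=P_1(\mathcal T)\cap H^1_0(\Omega)$. $Y=H^1(\mathcal T)$ = piecewise $H^1$ functions with piecewise gradient $\nabla_{NC}$, scalar product $a(v,w)=\int_\Omega(vw+\nabla_{NC}v\cdot\nabla_{NC}w)\,dx$ and induced norm $\|\cdot\|_Y$; $\|G\|_{Y_h^*}=\sup\{G(v):v\in Y_h,\ \|v\|_Y\le1\}$. $b(u,t;v)=\int_\Omega\sigma(\nabla u)\cdot\nabla_{NC}v\,dx-\langle t,v\rangle_{\partial\mathcal T}$. *)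

theory Defs
  imports "HOL-Analysis.Analysis"
begin

section \<open>Bounded polyhedral Lipschitz domains and regular triangulations\<close>

text \<open>Near each boundary point \<open>x\<close>, in suitable rotated coordinates (height along the unit
  vector \<open>e\<close>, base in the orthogonal complement of \<open>e\<close>), the set lies strictly below the graph of
  a Lipschitz function \<open>g\<close>. Only the values of \<open>g\<close> on the orthogonal complement of \<open>e\<close> matter.\<close>

definition lipschitz_boundary :: "'a::euclidean_space set \<Rightarrow> bool" where
  "lipschitz_boundary \<Omega> \<longleftrightarrow>
    (\<forall>x\<in>frontier \<Omega>. \<exists>e r h L (g :: 'a \<Rightarrow> real).
       norm e = 1 \<and> r > 0 \<and> h > 0 \<and> L-lipschitz_on UNIV g \<and>
       (\<forall>z. norm (z - (z \<bullet> e) *\<^sub>R e) < r \<and> \<bar>z \<bullet> e\<bar> < h \<longrightarrow>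
          (x + z \<in> \<Omega> \<longleftrightarrow> z \<bullet> e < g (z - (z \<bullet> e) *\<^sub>R e))))"

definition polyhedral_lipschitz_domain :: "'a::euclidean_space set \<Rightarrow> bool" where
  "polyhedral_lipschitz_domain \<Omega> \<longleftrightarrow>
    \<Omega> \<noteq> {} \<and> open \<Omega> \<and> connected \<Omega> \<and> bounded \<Omega> \<and> lipschitz_boundary \<Omega> \<and>
    (\<exists>P. finite P \<and> (\<forall>p\<in>P. polytope p) \<and> frontier \<Omega> = \<Union>P)"

text \<open>Elements are closed simplices. The library predicate \<^const>\<open>triangulation\<close> demands that two
  elements meet in a common face.\<close>

definition regular_triangulation :: "'a::euclidean_space set \<Rightarrow> 'a set set \<Rightarrow> bool" where
  "regular_triangulation \<Omega> \<T> \<longleftrightarrow>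
    triangulation \<T> \<and> (\<forall>T\<in>\<T>. int DIM('a) simplex T) \<and> \<Union>\<T> = closure \<Omega>"

definition admissible_triangulations ::
    "'a::euclidean_space set \<Rightarrow> 'a set set \<Rightarrow> real \<Rightarrow> 'a set set set" where
  "admissible_triangulations \<Omega> \<T>\<^sub>0 \<rho> =
    {\<T>. regular_triangulation \<Omega> \<T> \<and> (\<forall>T\<in>\<T>. \<exists>K\<in>\<T>\<^sub>0. T \<subseteq> K) \<and>
         (\<forall>T\<in>\<T>. diameter T ^ DIM('a) \<le> \<rho> * measure lebesgue T)}"

definition sides :: "'a::euclidean_space set set \<Rightarrow> 'a set set" where
  "sides \<T> = {E. \<exists>T\<in>\<T>. E facet_of T}"

definition outer_normal :: "'a::euclidean_space set \<Rightarrow> 'a set \<Rightarrow> 'a" where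
  "outer_normal T E = (THE \<nu>. norm \<nu> = 1 \<and> (\<forall>x\<in>E. \<forall>y\<in>E. \<nu> \<bullet> (y - x) = 0) \<and>
                               (\<forall>x\<in>E. \<forall>y\<in>T. \<nu> \<bullet> (y - x) \<le> 0))"

definition side_normals :: "'a::euclidean_space set set \<Rightarrow> ('a set \<Rightarrow> 'a) \<Rightarrow> bool" where
  "side_normals \<T> \<nu> \<longleftrightarrow>
    (\<forall>E\<in>sides \<T>. \<exists>T\<in>\<T>. E facet_of T \<and> \<nu> E = outer_normal T E)"


section \<open>Lebesgue and Sobolev spaces\<close>

text \<open>Elements of all function spaces are represented by functions on the whole space; only their
  values almost everywhere in the domain in question matter. Weak derivatives are therefore
  determined up to a null set, and \<^const>\<open>Eps\<close> selects a representative.\<close>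

definition L2 :: "'a::euclidean_space set \<Rightarrow> ('a \<Rightarrow> 'b::euclidean_space) set" where
  "L2 \<Omega> = {f. set_borel_measurable lebesgue \<Omega> f \<and>
               set_integrable lebesgue \<Omega> (\<lambda>x. (norm (f x))\<^sup>2)}"

definition L2_norm :: "'a::euclidean_space set \<Rightarrow> ('a \<Rightarrow> 'b::euclidean_space) \<Rightarrow> real" where
  "L2_norm \<Omega> f = sqrt (LINT x:\<Omega>|lebesgue. (norm (f x))\<^sup>2)"

primrec C_k :: "nat \<Rightarrow> ('a::euclidean_space \<Rightarrow> real) \<Rightarrow> bool" where
  "C_k 0 f \<longleftrightarrow> continuous_on UNIV f"
| "C_k (Suc k) f \<longleftrightarrow> f differentiable_on UNIV \<and>
     (\<forall>b\<in>Basis. C_k k (\<lambda>x. frechet_derivative f (at x) b))"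

definition test_functions :: "'a::euclidean_space set \<Rightarrow> ('a \<Rightarrow> real) set" where
  "test_functions \<Omega> =
    {\<phi>. (\<forall>k. C_k k \<phi>) \<and> compact (closure {x. \<phi> x \<noteq> 0}) \<and> closure {x. \<phi> x \<noteq> 0} \<subseteq> \<Omega>}"

definition weak_gradient ::
    "'a::euclidean_space set \<Rightarrow> ('a \<Rightarrow> real) \<Rightarrow> ('a \<Rightarrow> 'a) \<Rightarrow> bool" where
  "weak_gradient \<Omega> u g \<longleftrightarrow> g \<in> L2 \<Omega> \<and>
    (\<forall>\<phi>\<in>test_functions \<Omega>. \<forall>b\<in>Basis.
       (LINT x:\<Omega>|lebesgue. u x * frechet_derivative \<phi> (at x) b)
         = - (LINT x:\<Omega>|lebesgue. (g x \<bullet> b) * \<phi> x))"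

definition grad :: "'a::euclidean_space set \<Rightarrow> ('a \<Rightarrow> real) \<Rightarrow> 'a \<Rightarrow> 'a" where
  "grad \<Omega> u = (SOME g. weak_gradient \<Omega> u g)"

definition H1 :: "'a::euclidean_space set \<Rightarrow> ('a \<Rightarrow> real) set" where
  "H1 \<Omega> = {u. u \<in> L2 \<Omega> \<and> (\<exists>g. weak_gradient \<Omega> u g)}"

definition H1_norm :: "'a::euclidean_space set \<Rightarrow> ('a \<Rightarrow> real) \<Rightarrow> real" where
  "H1_norm \<Omega> u = sqrt ((L2_norm \<Omega> u)\<^sup>2 + (L2_norm \<Omega> (grad \<Omega> u))\<^sup>2)"

definition H1_0 :: "'a::euclidean_space set \<Rightarrow> ('a \<Rightarrow> real) set" where
  "H1_0 \<Omega> = {u \<in> H1 \<Omega>. \<forall>\<epsilon>>0. \<exists>\<phi>\<in>test_functions \<Omega>. H1_norm \<Omega> (\<lambda>x. u x - \<phi> x) < \<epsilon>}"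

text \<open>The integrand on the left is the product of \<open>q\<close> with the classical gradient of \<open>\<phi>\<close>.\<close>

definition weak_divergence ::
    "'a::euclidean_space set \<Rightarrow> ('a \<Rightarrow> 'a) \<Rightarrow> ('a \<Rightarrow> real) \<Rightarrow> bool" where
  "weak_divergence \<Omega> q d \<longleftrightarrow> d \<in> L2 \<Omega> \<and>
    (\<forall>\<phi>\<in>test_functions \<Omega>.
       (LINT x:\<Omega>|lebesgue. frechet_derivative \<phi> (at x) (q x))
         = - (LINT x:\<Omega>|lebesgue. d x * \<phi> x))"

definition dvg :: "'a::euclidean_space set \<Rightarrow> ('a \<Rightarrow> 'a) \<Rightarrow> 'a \<Rightarrow> real" where
  "dvg \<Omega> q = (SOME d. weak_divergence \<Omega> q d)"

definition H_div :: "'a::euclidean_space set \<Rightarrow> ('a \<Rightarrow> 'a) set" where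
  "H_div \<Omega> = {q. q \<in> L2 \<Omega> \<and> (\<exists>d. weak_divergence \<Omega> q d)}"

definition H_div_norm :: "'a::euclidean_space set \<Rightarrow> ('a \<Rightarrow> 'a) \<Rightarrow> real" where
  "H_div_norm \<Omega> q = sqrt ((L2_norm \<Omega> q)\<^sup>2 + (L2_norm \<Omega> (dvg \<Omega> q))\<^sup>2)"


section \<open>Normal traces\<close>

text \<open>The space \<open>H\<^sup>1\<^sup>/\<^sup>2(\<partial>T)\<close> is the trace space of \<open>H\<^sup>1(T)\<close>, that is, \<open>H\<^sup>1(T)\<close> modulo the kernel
  \<open>H\<^sup>1\<^sub>0(T)\<close> of the trace, with the quotient norm. An element of its dual is represented by the
  functional on \<open>H\<^sup>1(T)\<close> that it induces by composition with the trace, so that the duality pairing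
  with the trace of \<open>v\<close> is application to \<open>v\<close>. Values outside \<open>H\<^sup>1(T)\<close> are irrelevant.\<close>

definition H_minus_half :: "'a::euclidean_space set \<Rightarrow> (('a \<Rightarrow> real) \<Rightarrow> real) set" where
  "H_minus_half T = {l.
     (\<forall>v\<in>H1 (interior T). \<forall>w\<in>H1 (interior T). l (\<lambda>x. v x + w x) = l v + l w) \<and>
     (\<forall>v\<in>H1 (interior T). \<forall>c. l (\<lambda>x. c * v x) = c * l v) \<and>
     (\<exists>C. \<forall>v\<in>H1 (interior T). \<bar>l v\<bar> \<le> C * H1_norm (interior T) v) \<and>
     (\<forall>v\<in>H1_0 (interior T). l v = 0)}"

text \<open>The normal trace of \<open>q \<in> H(div,T)\<close>, defined as usual by the Gauss formula.\<close>

definition normal_trace ::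
    "('a::euclidean_space \<Rightarrow> 'a) \<Rightarrow> 'a set \<Rightarrow> ('a \<Rightarrow> real) \<Rightarrow> real" where
  "normal_trace q T v =
    (LINT x:interior T|lebesgue. q x \<bullet> grad (interior T) v x + dvg (interior T) q x * v x)"

definition has_normal_traces ::
    "'a::euclidean_space set set \<Rightarrow> ('a \<Rightarrow> 'a) \<Rightarrow> ('a set \<Rightarrow> ('a \<Rightarrow> real) \<Rightarrow> real) \<Rightarrow> bool" where
  "has_normal_traces \<T> q t \<longleftrightarrow>
    (\<forall>T\<in>\<T>. \<forall>v\<in>H1 (interior T). t T v = normal_trace q T v)"

definition H_minus_half_skeleton ::
    "'a::euclidean_space set \<Rightarrow> 'a set set \<Rightarrow> ('a set \<Rightarrow> ('a \<Rightarrow> real) \<Rightarrow> real) set" where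
  "H_minus_half_skeleton \<Omega> \<T> =
    {t. (\<forall>T\<in>\<T>. t T \<in> H_minus_half T) \<and> (\<exists>q\<in>H_div \<Omega>. has_normal_traces \<T> q t)}"

text \<open>The infimum is attained, so it is the minimum.\<close>

definition skeleton_norm ::
    "'a::euclidean_space set \<Rightarrow> 'a set set \<Rightarrow> ('a set \<Rightarrow> ('a \<Rightarrow> real) \<Rightarrow> real) \<Rightarrow> real" where
  "skeleton_norm \<Omega> \<T> t = (INF q\<in>{q \<in> H_div \<Omega>. has_normal_traces \<T> q t}. H_div_norm \<Omega> q)"

definition skeleton_pairing ::
    "'a set set \<Rightarrow> ('a set \<Rightarrow> ('a \<Rightarrow> real) \<Rightarrow> real) \<Rightarrow> ('a \<Rightarrow> real) \<Rightarrow> real" where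
  "skeleton_pairing \<T> t v = (\<Sum>T\<in>\<T>. t T v)"


section \<open>Broken and discrete spaces\<close>

definition broken_H1 :: "'a::euclidean_space set set \<Rightarrow> ('a \<Rightarrow> real) set" where
  "broken_H1 \<T> = {v. \<forall>T\<in>\<T>. v \<in> H1 (interior T)}"

definition grad_NC :: "'a::euclidean_space set set \<Rightarrow> ('a \<Rightarrow> real) \<Rightarrow> 'a \<Rightarrow> 'a" where
  "grad_NC \<T> v x = (\<Sum>T\<in>\<T>. indicator (interior T) x *\<^sub>R grad (interior T) v x)"

definition a_form ::
    "'a::euclidean_space set \<Rightarrow> 'a set set \<Rightarrow> ('a \<Rightarrow> real) \<Rightarrow> ('a \<Rightarrow> real) \<Rightarrow> real" where
  "a_form \<Omega> \<T> v w = (LINT x:\<Omega>|lebesgue. v x * w x + grad_NC \<T> v x \<bullet> grad_NC \<T> w x)"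

definition Y_norm :: "'a::euclidean_space set \<Rightarrow> 'a set set \<Rightarrow> ('a \<Rightarrow> real) \<Rightarrow> real" where
  "Y_norm \<Omega> \<T> v = sqrt (a_form \<Omega> \<T> v v)"

definition P1 :: "'a::euclidean_space set set \<Rightarrow> ('a \<Rightarrow> real) set" where
  "P1 \<T> = {v. \<forall>T\<in>\<T>. \<exists>c d. \<forall>x\<in>interior T. v x = c + d \<bullet> x}"

definition S1_0 :: "'a::euclidean_space set \<Rightarrow> 'a set set \<Rightarrow> ('a \<Rightarrow> real) set" where
  "S1_0 \<Omega> \<T> = P1 \<T> \<inter> H1_0 \<Omega>"

text \<open>A piecewise constant function \<open>t\<^sub>0\<close> on the sides is identified with the family of normal traces
  of the lowest-order Raviart-Thomas function \<open>q\<close> (equal to \<open>A T + B T *\<^sub>R x\<close> on \<open>T\<close>) that satisfies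
  \<open>q|\<^sub>T \<bullet> \<nu>\<^sub>T = (\<nu>\<^sub>T \<bullet> \<nu>\<^sub>E) t\<^sub>0|\<^sub>E\<close> pointwise on each side \<open>E\<close> of \<open>T\<close>. The resulting space does not depend
  on the choice of the side normals.\<close>

definition P0_embedding ::
    "'a::euclidean_space set \<Rightarrow> 'a set set \<Rightarrow> ('a set \<Rightarrow> 'a) \<Rightarrow> ('a set \<Rightarrow> real) \<Rightarrow>
     ('a set \<Rightarrow> ('a \<Rightarrow> real) \<Rightarrow> real) \<Rightarrow> bool" where
  "P0_embedding \<Omega> \<T> \<nu> t\<^sub>0 t \<longleftrightarrow>
    (\<exists>q\<in>H_div \<Omega>. \<exists>A B.
       (\<forall>T\<in>\<T>. \<forall>x\<in>interior T. q x = A T + B T *\<^sub>R x) \<and>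
       (\<forall>T\<in>\<T>. \<forall>E. E facet_of T \<longrightarrow>
          (\<forall>x\<in>E. (A T + B T *\<^sub>R x) \<bullet> outer_normal T E = (outer_normal T E \<bullet> \<nu> E) * t\<^sub>0 E)) \<and>
       has_normal_traces \<T> q t)"

definition P0_sides ::
    "'a::euclidean_space set \<Rightarrow> 'a set set \<Rightarrow> ('a set \<Rightarrow> 'a) \<Rightarrow>
     ('a set \<Rightarrow> ('a \<Rightarrow> real) \<Rightarrow> real) set" where
  "P0_sides \<Omega> \<T> \<nu> = {t \<in> H_minus_half_skeleton \<Omega> \<T>. \<exists>t\<^sub>0. P0_embedding \<Omega> \<T> \<nu> t\<^sub>0 t}"

text \<open>The supremum is finite for bounded functionals, in particular for all residuals below.\<close>

definition Yh_dual_norm ::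
    "'a::euclidean_space set \<Rightarrow> 'a set set \<Rightarrow> (('a \<Rightarrow> real) \<Rightarrow> real) \<Rightarrow> real" where
  "Yh_dual_norm \<Omega> \<T> G = (SUP v\<in>{v \<in> P1 \<T>. Y_norm \<Omega> \<T> v \<le> 1}. G v)"


section \<open>The nonlinear problem\<close>

definition sigma_map :: "(real \<Rightarrow> real) \<Rightarrow> 'a::euclidean_space \<Rightarrow> 'a" where
  "sigma_map \<phi> A = \<phi> (norm A) *\<^sub>R A"

definition C1_map :: "('a::euclidean_space \<Rightarrow> 'a) \<Rightarrow> bool" where
  "C1_map s \<longleftrightarrow> (\<exists>s' :: 'a \<Rightarrow> 'a \<Rightarrow>\<^sub>L 'a.
     (\<forall>A. (s has_derivative blinfun_apply (s' A)) (at A)) \<and> continuous_on UNIV s')"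

text \<open>Only the values of \<open>\<phi>\<close> on \<open>[0,\<infinity>)\<close> matter.\<close>

definition nonlinearity :: "real \<Rightarrow> real \<Rightarrow> (real \<Rightarrow> real) \<Rightarrow> bool" where
  "nonlinearity \<gamma>\<^sub>1 \<gamma>\<^sub>2 \<phi> \<longleftrightarrow>
    continuous_on {0..} \<phi> \<and>
    (\<forall>t>0. \<phi> differentiable (at t) \<and> deriv \<phi> differentiable (at t)) \<and>
    continuous_on {0<..} (deriv (deriv \<phi>)) \<and>
    (\<forall>t\<ge>0. \<gamma>\<^sub>1 \<le> \<phi> t \<and> \<phi> t \<le> \<gamma>\<^sub>2) \<and>
    (\<forall>t>0. \<gamma>\<^sub>1 \<le> \<phi> t + t * deriv \<phi> t \<and> \<phi> t + t * deriv \<phi> t \<le> \<gamma>\<^sub>2)"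

definition b_form ::
    "(real \<Rightarrow> real) \<Rightarrow> 'a::euclidean_space set \<Rightarrow> 'a set set \<Rightarrow> ('a \<Rightarrow> real) \<Rightarrow>
     ('a set \<Rightarrow> ('a \<Rightarrow> real) \<Rightarrow> real) \<Rightarrow> ('a \<Rightarrow> real) \<Rightarrow> real" where
  "b_form \<phi> \<Omega> \<T> u t v =
    (LINT x:\<Omega>|lebesgue. sigma_map \<phi> (grad \<Omega> u x) \<bullet> grad_NC \<T> v x) - skeleton_pairing \<T> t v"

definition load :: "'a::euclidean_space set \<Rightarrow> ('a \<Rightarrow> real) \<Rightarrow> ('a \<Rightarrow> real) \<Rightarrow> real" where
  "load \<Omega> f v = (LINT x:\<Omega>|lebesgue. f x * v x)"

definition residual ::
    "(real \<Rightarrow> real) \<Rightarrow> 'a::euclidean_space set \<Rightarrow> 'a set set \<Rightarrow> ('a \<Rightarrow> real) \<Rightarrow> ('a \<Rightarrow> real) \<Rightarrow>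
     ('a set \<Rightarrow> ('a \<Rightarrow> real) \<Rightarrow> real) \<Rightarrow> ('a \<Rightarrow> real) \<Rightarrow> real" where
  "residual \<phi> \<Omega> \<T> f u t v = load \<Omega> f v - b_form \<phi> \<Omega> \<T> u t v"

end

theory Submission
  imports Defs
begin

text \<open>Neither a discrete inf-sup condition nor mesh-dependent estimates are needed. The minimal
  residual is at most the residual of any competitor \<open>(u\<^sub>C, t\<^sub>0)\<close>, which the Lipschitz continuity of
  \<open>\<sigma>\<close> and the duality of the skeleton norm with the broken \<open>H\<^sup>1\<close> norm bound by the error of the
  competitor; this controls \<open>v\<^sub>h\<close>. Conforming test functions in \<open>H\<^sup>1\<^sub>0(\<Omega>)\<close> annihilate all skeleton
  terms by the Gauss formula. Hence testing with \<open>u\<^sub>h - u\<^sub>C\<close> expresses the difference of the fluxes of \<open>u\<close>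
  and \<open>u\<^sub>h\<close> by \<open>v\<^sub>h\<close>, and the strong monotonicity of \<open>\<sigma>\<close> together with the Friedrichs
  inequality bounds \<open>\<nabla>(u\<^sub>h - u\<^sub>C)\<close>.\<close>

section \<open>Square-integrable functions\<close>

text \<open>The error of \<open>t\<^sub>h\<close> does not occur on the left-hand side, so what is
  wanted is a test function that does not see \<open>t\<^sub>h\<close>. The difference
  \<open>u\<^sub>h - u\<^sub>C\<close> lies in \<open>P1 \<T>\<close>, hence is admissible in the
  Riesz identity for \<open>v\<^sub>h\<close>, and in \<open>H1_0 \<Omega>\<close>, hence pairs to
  zero with \<open>t\<close> and \<open>t\<^sub>h\<close>; \<open>u - u\<^sub>h\<close> in general
  has only the second property. Therefore monotonicity is applied to \<open>u\<^sub>h\<close> and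
  \<open>u\<^sub>C\<close>, and the triangle inequality adds the error of \<open>u\<^sub>C\<close>.
  The obstacle lies in the representatives: \<open>grad\<close> and \<open>dvg\<close> are chosen
  among functions that agree almost everywhere, separately for each argument and each domain. Even
  linearity, or the agreement of the gradient on \<open>\<Omega>\<close> with that on an element,
  holds only almost everywhere and rests on the uniqueness of weak derivatives. Uniqueness rests on
  the fundamental lemma of the calculus of variations, and that lemma on a supply of smooth
  functions with compact support.\<close>

lemma L2_iff:
  "f \<in> L2 S \<longleftrightarrow> (\<lambda>x. indicator S x *\<^sub>R f x) \<in> borel_measurable lebesgue \<and>
     integrable lebesgue (\<lambda>x. (norm (indicator S x *\<^sub>R f x))\<^sup>2)"
proof -
  have "(\<lambda>x. indicator S x *\<^sub>R (norm (f x))\<^sup>2) = (\<lambda>x. (norm (indicator S x *\<^sub>R f x))\<^sup>2)"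
    by (auto simp: indicator_def)
  then show ?thesis
    by (simp add: L2_def set_borel_measurable_def set_integrable_def)
qed

lemma set_integrable_inner_L2:
  assumes f: "f \<in> L2 S" and g: "g \<in> L2 S"
  shows "set_integrable lebesgue S (\<lambda>x. f x \<bullet> g x)"
proof -
  let ?f = "\<lambda>x. indicator S x *\<^sub>R f x" and ?g = "\<lambda>x. indicator S x *\<^sub>R g x"
  have [measurable]: "?f \<in> borel_measurable lebesgue" "?g \<in> borel_measurable lebesgue"
    using f g by (auto simp: L2_iff)
  have "integrable lebesgue (\<lambda>x. (norm (?f x))\<^sup>2 + (norm (?g x))\<^sup>2)"
    using f g by (intro Bochner_Integration.integrable_add) (simp_all add: L2_iff)
  then have "integrable lebesgue (\<lambda>x. ?f x \<bullet> ?g x)"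
  proof (rule Bochner_Integration.integrable_bound)
    show "AE x in lebesgue. norm (?f x \<bullet> ?g x) \<le> norm ((norm (?f x))\<^sup>2 + (norm (?g x))\<^sup>2)"
    proof (rule AE_I2)
      fix x
      have "\<bar>?f x \<bullet> ?g x\<bar> \<le> norm (?f x) * norm (?g x)"
        by (rule Cauchy_Schwarz_ineq2)
      also have "\<dots> \<le> (norm (?f x))\<^sup>2 + (norm (?g x))\<^sup>2"
        using sum_squares_bound[of "norm (?f x)" "norm (?g x)"]
          mult_nonneg_nonneg[OF norm_ge_zero norm_ge_zero, of "?f x" "?g x"] by linarith
      finally show "norm (?f x \<bullet> ?g x) \<le> norm ((norm (?f x))\<^sup>2 + (norm (?g x))\<^sup>2)"
        by simp
    qed
  qed measurable
  moreover have "(\<lambda>x. ?f x \<bullet> ?g x) = (\<lambda>x. indicator S x *\<^sub>R (f x \<bullet> g x))"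
    by (auto simp: indicator_def)
  ultimately show ?thesis
    by (simp add: set_integrable_def)
qed

lemma set_integrable_mult_L2:
  fixes f g :: "'a::euclidean_space \<Rightarrow> real"
  shows "f \<in> L2 S \<Longrightarrow> g \<in> L2 S \<Longrightarrow> set_integrable lebesgue S (\<lambda>x. f x * g x)"
  using set_integrable_inner_L2[of f S g] by simp

lemma L2_lincomb:
  fixes f g :: "'a::euclidean_space \<Rightarrow> 'b::euclidean_space"
  assumes f: "f \<in> L2 S" and g: "g \<in> L2 S"
  shows "(\<lambda>x. f x + c *\<^sub>R g x) \<in> L2 S"
proof -
  let ?f = "\<lambda>x. indicator S x *\<^sub>R f x" and ?g = "\<lambda>x. indicator S x *\<^sub>R g x"
  have eq: "(\<lambda>x. indicator S x *\<^sub>R (f x + c *\<^sub>R g x)) = (\<lambda>x. ?f x + c *\<^sub>R ?g x)"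
    by (auto simp: scaleR_add_right)
  have [measurable]: "?f \<in> borel_measurable lebesgue" "?g \<in> borel_measurable lebesgue"
    using f g by (auto simp: L2_iff)
  have "set_integrable lebesgue S (\<lambda>x. f x \<bullet> f x + (2 * c * (f x \<bullet> g x) + c\<^sup>2 * (g x \<bullet> g x)))"
    by (intro set_integral_add set_integrable_mult_right set_integrable_inner_L2 f g)
  moreover have "f x \<bullet> f x + (2 * c * (f x \<bullet> g x) + c\<^sup>2 * (g x \<bullet> g x)) = (norm (f x + c *\<^sub>R g x))\<^sup>2" for x
    unfolding power2_norm_eq_inner
    by (simp add: inner_add_left inner_add_right inner_commute power2_eq_square algebra_simps)
  ultimately have "set_integrable lebesgue S (\<lambda>x. (norm (f x + c *\<^sub>R g x))\<^sup>2)"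
    by simp
  moreover have "set_borel_measurable lebesgue S (\<lambda>x. f x + c *\<^sub>R g x)"
    unfolding set_borel_measurable_def eq by measurable
  ultimately show ?thesis
    by (simp add: L2_def)
qed

lemma L2_zero: "(\<lambda>x. 0) \<in> L2 S"
  by (simp add: L2_iff)

lemma L2_add: "f \<in> L2 S \<Longrightarrow> g \<in> L2 S \<Longrightarrow> (\<lambda>x. f x + g x) \<in> L2 S"
  using L2_lincomb[of f S g 1] by simp

lemma L2_diff: "f \<in> L2 S \<Longrightarrow> g \<in> L2 S \<Longrightarrow> (\<lambda>x. f x - g x) \<in> L2 S"
  using L2_lincomb[of f S g "-1"] by simp

lemma L2_scaleR: "f \<in> L2 S \<Longrightarrow> (\<lambda>x. c *\<^sub>R f x) \<in> L2 S"
  using L2_lincomb[OF L2_zero, of f S c] by simp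

text \<open>The growth bound forces \<open>h 0 = 0\<close>, so \<open>h\<close> commutes with the
  cutoff by the indicator of \<open>S\<close>. Applied to linear maps and to
  \<open>sigma_map \<phi>\<close>.\<close>

lemma L2_linear_growth:
  fixes h :: "'b::euclidean_space \<Rightarrow> 'c::euclidean_space"
  assumes f: "f \<in> L2 S" and h: "continuous_on UNIV h" "\<And>y. norm (h y) \<le> K * norm y"
  shows "(\<lambda>x. h (f x)) \<in> L2 S"
proof -
  let ?f = "\<lambda>x. indicator S x *\<^sub>R f x"
  have h0: "h 0 = 0"
    using h(2)[of 0] by simp
  have eq: "indicator S x *\<^sub>R h (f x) = h (?f x)" for x
    by (auto simp: indicator_def h0)
  have [measurable]: "?f \<in> borel_measurable lebesgue"
    using f by (auto simp: L2_iff)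
  have [measurable]: "h \<in> borel_measurable borel"
    using h(1) by (rule borel_measurable_continuous_onI)
  have m: "(\<lambda>x. h (?f x)) \<in> borel_measurable lebesgue"
    by measurable
  have "integrable lebesgue (\<lambda>x. K\<^sup>2 * (norm (?f x))\<^sup>2)"
    using f by (simp add: L2_iff)
  then have "integrable lebesgue (\<lambda>x. (norm (h (?f x)))\<^sup>2)"
  proof (rule Bochner_Integration.integrable_bound)
    show "AE x in lebesgue. norm ((norm (h (?f x)))\<^sup>2) \<le> norm (K\<^sup>2 * (norm (?f x))\<^sup>2)"
      using power_mono[OF h(2) norm_ge_zero, of "?f _" 2] by (simp add: power_mult_distrib)
  qed (use m in measurable)
  then show ?thesis
    using m unfolding L2_iff eq by (rule conjI[rotated])
qed

lemma L2_linear: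
  fixes h :: "'b::euclidean_space \<Rightarrow> 'c::euclidean_space"
  assumes "f \<in> L2 S" "bounded_linear h"
  shows "(\<lambda>x. h (f x)) \<in> L2 S"
proof -
  obtain K where "\<And>y. norm (h y) \<le> norm y * K"
    using bounded_linear.bounded[OF assms(2)] by blast
  then show ?thesis
    using L2_linear_growth[OF assms(1) linear_continuous_on[OF assms(2)], of K]
    by (simp add: mult.commute)
qed

text \<open>Pairs turn the norms of H1, of H(div) and of the broken space into L2 norms of
  product-valued functions, so that one Cauchy-Schwarz and one triangle inequality serve them
  all.\<close>

lemma L2_Pair:
  fixes f :: "'a::euclidean_space \<Rightarrow> 'b::euclidean_space" and g :: "'a \<Rightarrow> 'c::euclidean_space"
  assumes "f \<in> L2 S" "g \<in> L2 S"
  shows "(\<lambda>x. (f x, g x)) \<in> L2 S"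
proof -
  have "(\<lambda>x. (f x, 0) + (0, g x)) \<in> L2 S"
    using assms
    by (intro L2_add L2_linear[where h = "\<lambda>y. (y, 0)"] L2_linear[where h = "\<lambda>y. (0, y)"])
      (auto intro: bounded_linear_Pair bounded_linear_zero bounded_linear_ident)
  then show ?thesis
    by simp
qed

lemma set_integrable_norm_L2: "f \<in> L2 S \<Longrightarrow> set_integrable lebesgue S (\<lambda>x. (norm (f x))\<^sup>2)"
  by (simp add: L2_def)

lemma set_integral_nonneg:
  fixes f :: "'a \<Rightarrow> real"
  assumes "\<And>x. x \<in> S \<Longrightarrow> 0 \<le> f x"
  shows "0 \<le> (LINT x:S|M. f x)"
  unfolding set_lebesgue_integral_def
  by (rule Bochner_Integration.integral_nonneg) (use assms in \<open>auto simp: indicator_def\<close>)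

lemma L2_norm_power2: "(L2_norm S f)\<^sup>2 = (LINT x:S|lebesgue. (norm (f x))\<^sup>2)"
  unfolding L2_norm_def by (simp add: set_integral_nonneg)

lemma L2_norm_nonneg: "0 \<le> L2_norm S f"
  unfolding L2_norm_def by (simp add: set_integral_nonneg)

lemma L2_norm_inner: "(LINT x:S|lebesgue. f x \<bullet> f x) = (L2_norm S f)\<^sup>2"
  unfolding L2_norm_power2 power2_norm_eq_inner ..

text \<open>Read as a nonnegative polynomial in \<open>c\<close>, the right-hand side yields the
  Cauchy-Schwarz inequality; \<open>c = 1\<close> yields the triangle inequality.\<close>

lemma L2_norm_lincomb_power2:
  assumes f: "f \<in> L2 S" and g: "g \<in> L2 S"
  shows "(L2_norm S (\<lambda>x. f x + c *\<^sub>R g x))\<^sup>2 =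
    (L2_norm S f)\<^sup>2 + 2 * c * (LINT x:S|lebesgue. f x \<bullet> g x) + c\<^sup>2 * (L2_norm S g)\<^sup>2"
proof -
  have ff: "set_integrable lebesgue S (\<lambda>x. f x \<bullet> f x)" and fg: "set_integrable lebesgue S (\<lambda>x. f x \<bullet> g x)"
    and gg: "set_integrable lebesgue S (\<lambda>x. g x \<bullet> g x)"
    using f g by (auto intro: set_integrable_inner_L2)
  have "(norm (f x + c *\<^sub>R g x))\<^sup>2 = f x \<bullet> f x + (2 * c * (f x \<bullet> g x) + c\<^sup>2 * (g x \<bullet> g x))" for x
    unfolding power2_norm_eq_inner
    by (simp add: inner_add_left inner_add_right inner_commute power2_eq_square algebra_simps)
  then have "(L2_norm S (\<lambda>x. f x + c *\<^sub>R g x))\<^sup>2 =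
      (LINT x:S|lebesgue. f x \<bullet> f x + (2 * c * (f x \<bullet> g x) + c\<^sup>2 * (g x \<bullet> g x)))"
    by (simp add: L2_norm_power2)
  also have "\<dots> = (LINT x:S|lebesgue. f x \<bullet> f x) + (LINT x:S|lebesgue. 2 * c * (f x \<bullet> g x)) +
      (LINT x:S|lebesgue. c\<^sup>2 * (g x \<bullet> g x))"
    using ff fg gg
    by (simp add: set_integral_add set_integrable_mult_right)
  finally show ?thesis
    by (simp add: L2_norm_inner)
qed

lemma L2_Cauchy_Schwarz:
  assumes f: "f \<in> L2 S" and g: "g \<in> L2 S"
  shows "\<bar>LINT x:S|lebesgue. f x \<bullet> g x\<bar> \<le> L2_norm S f * L2_norm S g"
proof -
  define I where "I = (LINT x:S|lebesgue. f x \<bullet> g x)"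
  let ?F = "(L2_norm S f)\<^sup>2" and ?G = "(L2_norm S g)\<^sup>2"
  have q: "0 \<le> ?F + 2 * c * I + c\<^sup>2 * ?G" for c
    unfolding I_def L2_norm_lincomb_power2[OF f g, symmetric] by simp
  have "I\<^sup>2 \<le> ?F * ?G"
  proof (cases "?G = 0")
    case True
    have "I = 0"
    proof (rule ccontr)
      assume "I \<noteq> 0"
      \<comment> \<open>With \<open>?G = 0\<close> the polynomial is affine in \<open>c\<close>, and
        at this \<open>c\<close> it takes the value \<open>-1\<close>.\<close>
      then show False
        using q[of "- (?F + 1) / (2 * I)"] True by (simp add: field_simps)
    qed
    then show ?thesis
      by simp
  next
    case False
    then have G: "?G > 0"
      by (simp add: order_le_neq_trans)
    \<comment> \<open>The value \<open>- I / ?G\<close> minimizes the quadratic polynomial.\<close>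
    have "0 \<le> (?F + 2 * (- I / ?G) * I + (- I / ?G)\<^sup>2 * ?G) * ?G"
      using q[of "- I / ?G"] G by (intro mult_nonneg_nonneg) auto
    also have "\<dots> = ?F * ?G - I\<^sup>2"
      using False by (simp add: field_simps power2_eq_square)
    finally show ?thesis
      by simp
  qed
  then have "I\<^sup>2 \<le> (L2_norm S f * L2_norm S g)\<^sup>2"
    by (simp add: power_mult_distrib)
  then have "\<bar>I\<bar> \<le> \<bar>L2_norm S f * L2_norm S g\<bar>"
    by (simp add: abs_le_square_iff)
  then show ?thesis
    by (simp add: I_def L2_norm_nonneg)
qed

lemma L2_norm_scaleR: "L2_norm S (\<lambda>x. c *\<^sub>R f x) = \<bar>c\<bar> * L2_norm S f"
  by (simp add: L2_norm_def power_mult_distrib real_sqrt_mult)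

lemma L2_norm_triangle:
  assumes f: "f \<in> L2 S" and g: "g \<in> L2 S"
  shows "L2_norm S (\<lambda>x. f x + g x) \<le> L2_norm S f + L2_norm S g"
proof (rule power2_le_imp_le)
  show "(L2_norm S (\<lambda>x. f x + g x))\<^sup>2 \<le> (L2_norm S f + L2_norm S g)\<^sup>2"
    using L2_norm_lincomb_power2[OF f g, of 1] L2_Cauchy_Schwarz[OF f g]
    by (simp add: power2_sum)
qed (simp add: L2_norm_nonneg)

lemma L2_norm_triangle_minus:
  assumes "f \<in> L2 S" "g \<in> L2 S"
  shows "L2_norm S (\<lambda>x. f x - g x) \<le> L2_norm S f + L2_norm S g"
  using L2_norm_triangle[OF assms(1) L2_scaleR[OF assms(2)], of "-1"]
    L2_norm_scaleR[of S "-1" g] by simp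

lemma L2_norm_mono:
  assumes "f \<in> L2 S" "g \<in> L2 S" "\<And>x. x \<in> S \<Longrightarrow> norm (f x) \<le> norm (g x)"
  shows "L2_norm S f \<le> L2_norm S g"
  unfolding L2_norm_def using assms
  by (intro real_sqrt_le_mono set_integral_mono set_integrable_norm_L2) (auto intro: power_mono)

lemma L2_norm_Pair:
  assumes f: "f \<in> L2 S" and g: "g \<in> L2 S"
  shows "(L2_norm S (\<lambda>x. (f x, g x)))\<^sup>2 = (L2_norm S f)\<^sup>2 + (L2_norm S g)\<^sup>2"
  using set_integrable_norm_L2[OF f] set_integrable_norm_L2[OF g]
  by (simp add: L2_norm_power2 norm_Pair set_integral_add)

text \<open>Lebesgue measure is complete, so two functions that agree almost everywhere are both
  measurable or both not; in the second case both integrals have the default value \<open>0\<close>.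
  The absence of a measurability premise is convenient for integrands built from chosen weak
  derivatives.\<close>

lemma set_integral_cong_AE_lebesgue:
  assumes "AE x in lebesgue. x \<in> S \<longrightarrow> f x = g x"
  shows "(LINT x:S|lebesgue. f x) = (LINT x:S|lebesgue. (g x :: 'b::euclidean_space))"
proof -
  have ae: "AE x in lebesgue. indicator S x *\<^sub>R f x = indicator S x *\<^sub>R g x"
    using assms by eventually_elim (auto simp: indicator_def)
  show ?thesis
  proof (cases "(\<lambda>x. indicator S x *\<^sub>R f x) \<in> borel_measurable lebesgue")
    case True
    then show ?thesis
      unfolding set_lebesgue_integral_def
      using ae borel_measurable_AE[OF True ae] by (intro integral_cong_AE)
  next
    case False
    have ae': "AE x in lebesgue. indicator S x *\<^sub>R g x = indicator S x *\<^sub>R f x"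
      using ae by eventually_elim (rule sym)
    have "(\<lambda>x. indicator S x *\<^sub>R g x) \<notin> borel_measurable lebesgue"
      using False borel_measurable_AE[OF _ ae'] by blast
    with False have "\<not> integrable lebesgue (\<lambda>x. indicator S x *\<^sub>R f x)"
      "\<not> integrable lebesgue (\<lambda>x. indicator S x *\<^sub>R g x)"
      by (blast dest: borel_measurable_integrable)+
    then show ?thesis
      unfolding set_lebesgue_integral_def by (metis not_integrable_integral_eq)
  qed
qed

lemma L2_cong_AE:
  assumes f: "f \<in> L2 S" and ae: "AE x in lebesgue. x \<in> S \<longrightarrow> f x = g x"
  shows "g \<in> L2 S"
proof -
  have ae: "AE x in lebesgue. indicator S x *\<^sub>R f x = indicator S x *\<^sub>R g x"
    using ae by eventually_elim (auto simp: indicator_def)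
  have f': "(\<lambda>x. indicator S x *\<^sub>R f x) \<in> borel_measurable lebesgue"
    "integrable lebesgue (\<lambda>x. (norm (indicator S x *\<^sub>R f x))\<^sup>2)"
    using f unfolding L2_iff by auto
  have g': "(\<lambda>x. indicator S x *\<^sub>R g x) \<in> borel_measurable lebesgue"
    by (rule borel_measurable_AE[OF f'(1) ae])
  have "integrable lebesgue (\<lambda>x. (norm (indicator S x *\<^sub>R g x))\<^sup>2)"
    using f'(2) 
  proof (rule integrable_cong_AE_imp)
    show "(\<lambda>x. (norm (indicator S x *\<^sub>R g x))\<^sup>2) \<in> borel_measurable lebesgue"
      using g' by measurable
    show "AE x in lebesgue. (norm (indicator S x *\<^sub>R f x))\<^sup>2 = (norm (indicator S x *\<^sub>R g x))\<^sup>2"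
      using ae by eventually_elim (simp only:)
  qed
  with g' show ?thesis
    unfolding L2_iff by blast
qed

lemma L2_norm_cong_AE:
  assumes "AE x in lebesgue. x \<in> S \<longrightarrow> f x = g x"
  shows "L2_norm S f = L2_norm S g"
proof -
  have "(LINT x:S|lebesgue. (norm (f x))\<^sup>2) = (LINT x:S|lebesgue. (norm (g x))\<^sup>2)"
    by (rule set_integral_cong_AE_lebesgue) (use assms in eventually_elim, auto)
  then show ?thesis
    by (simp add: L2_norm_def)
qed

lemma L2_subset:
  assumes f: "f \<in> L2 S" and S': "S' \<in> sets lebesgue" "S' \<subseteq> S"
  shows "f \<in> L2 S'"
proof -
  have "set_borel_measurable lebesgue S' f"
    using f S' by (auto simp: L2_def intro: set_borel_measurable_subset)
  moreover have "set_integrable lebesgue S' (\<lambda>x. (norm (f x))\<^sup>2)"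
    using f S' by (auto simp: L2_def intro: set_integrable_subset)
  ultimately show ?thesis
    by (simp add: L2_def)
qed

lemma L2_continuous:
  fixes f :: "'a::euclidean_space \<Rightarrow> 'b::euclidean_space"
  assumes f: "continuous_on UNIV f" and S: "S \<in> sets lebesgue" "bounded S"
  shows "f \<in> L2 S"
proof -
  obtain r where r: "\<And>x. x \<in> S \<Longrightarrow> norm x \<le> r"
    using S(2) unfolding bounded_iff by auto
  have "f \<in> borel_measurable lborel"
    using borel_measurable_continuous_onI[OF f] by simp
  then have "(\<lambda>x. indicator (cball 0 r) x *\<^sub>R f x) \<in> borel_measurable lborel"
    by (intro borel_measurable_scaleR borel_measurable_indicator) auto
  then have "(\<lambda>x. indicator (cball 0 r) x *\<^sub>R f x) \<in> borel_measurable lebesgue"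
    by (rule measurable_completion)
  moreover  have "set_integrable lborel (cball 0 r) (\<lambda>x. (norm (f x))\<^sup>2)"
    using f unfolding set_integrable_def
    by (intro borel_integrable_compact) (auto intro!: continuous_intros intro: continuous_on_subset)
  then have "set_integrable lebesgue (cball 0 r) (\<lambda>x. (norm (f x))\<^sup>2)"
    unfolding set_integrable_def by (simp add: integrable_completion borel_measurable_integrable)
  ultimately have "f \<in> L2 (cball 0 r)"
    by (simp add: L2_def set_borel_measurable_def)
  then show ?thesis
    by (rule L2_subset[OF _ S(1)]) (auto simp: r)
qed

lemma set_integrable_L2:
  fixes f :: "'a::euclidean_space \<Rightarrow> real"
  assumes "f \<in> L2 S" "S \<in> sets lebesgue" "bounded S"
  shows "set_integrable lebesgue S f"
  using set_integrable_mult_L2[OF assms(1) L2_continuous[OF continuous_on_const assms(2,3), of 1]]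
  by simp

section \<open>Smooth functions\<close>

lemma C_k_SucI:
  assumes "\<And>x. (f has_derivative f' x) (at x)" "\<And>b. b \<in> Basis \<Longrightarrow> C_k k (\<lambda>x. f' x b)"
  shows "C_k (Suc k) f"
proof -
  have "frechet_derivative f (at x) = f' x" for x
    using frechet_derivative_at[OF assms(1)] by simp
  then show ?thesis
    using assms by (auto simp: differentiable_on_def differentiable_def intro: has_derivative_at_withinI)
qed

lemma C_k_has_derivative:
  "C_k (Suc k) f \<Longrightarrow> (f has_derivative frechet_derivative f (at x)) (at x)"
  by (simp add: differentiable_on_def frechet_derivative_works)

lemma C_k_partial: "C_k (Suc k) f \<Longrightarrow> b \<in> Basis \<Longrightarrow> C_k k (\<lambda>x. frechet_derivative f (at x) b)"
  by simp

lemma C_k_Suc_imp: "C_k (Suc k) f \<Longrightarrow> C_k k f"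
proof (induction k arbitrary: f)
  case 0
  then show ?case
    by (simp add: differentiable_imp_continuous_on)
next
  case (Suc k)
  then show ?case
    by (metis C_k.simps(2))
qed

lemma C_k_continuous: "C_k k f \<Longrightarrow> continuous_on UNIV f"
  by (cases k) (auto intro: differentiable_imp_continuous_on)

lemma C_k_const: "C_k k (\<lambda>x. c)"
proof (induction k arbitrary: c)
  case (Suc k)
  then show ?case
    by (intro C_k_SucI[where f' = "\<lambda>x y. 0"]) auto
qed simp

lemma C_k_affine: "C_k k (\<lambda>x. c + d \<bullet> x)"
proof (cases k)
  case (Suc k)
  then show ?thesis
    by (auto intro!: C_k_SucI[where f' = "\<lambda>x y. d \<bullet> y"] derivative_eq_intros C_k_const
        simp del: C_k.simps)
qed (auto intro!: continuous_intros)

lemma C_k_add: "C_k k f \<Longrightarrow> C_k k g \<Longrightarrow> C_k k (\<lambda>x. f x + g x)"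
proof (induction k arbitrary: f g)
  case (Suc k)
  show ?case
  proof (rule C_k_SucI)
    show "((\<lambda>x. f x + g x) has_derivative
        (\<lambda>y. frechet_derivative f (at x) y + frechet_derivative g (at x) y)) (at x)" for x
      using Suc.prems by (intro has_derivative_add C_k_has_derivative)
  next
    show "C_k k (\<lambda>x. frechet_derivative f (at x) b + frechet_derivative g (at x) b)" if "b \<in> Basis" for b
      using that Suc.prems by (intro Suc.IH C_k_partial)
  qed
qed (auto intro: continuous_on_add)

lemma C_k_mult: "C_k k f \<Longrightarrow> C_k k g \<Longrightarrow> C_k k (\<lambda>x. f x * g x)"
proof (induction k arbitrary: f g)
  case (Suc k)
  show ?case
  proof (rule C_k_SucI)
    show "((\<lambda>x. f x * g x) has_derivative
        (\<lambda>y. f x * frechet_derivative g (at x) y + frechet_derivative f (at x) y * g x)) (at x)" for x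
      using Suc.prems by (intro has_derivative_mult C_k_has_derivative)
  next
    show "C_k k (\<lambda>x. f x * frechet_derivative g (at x) b + frechet_derivative f (at x) b * g x)"
      if "b \<in> Basis" for b
      using Suc.prems[THEN C_k_Suc_imp] Suc.prems[THEN C_k_partial, OF that]
      by (intro C_k_add Suc.IH)
  qed
qed (auto intro: continuous_on_mult)

lemma C_k_prod: "finite A \<Longrightarrow> (\<And>i. i \<in> A \<Longrightarrow> C_k k (f i)) \<Longrightarrow> C_k k (\<lambda>x. \<Prod>i\<in>A. f i x)"
  by (induction A rule: finite_induct) (simp_all add: C_k_const C_k_mult)

lemma C_k_exp: "C_k k f \<Longrightarrow> C_k k (\<lambda>x. exp (f x))"
proof (induction k arbitrary: f)
  case (Suc k)
  show ?case
  proof (rule C_k_SucI)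
    show "((\<lambda>x. exp (f x)) has_derivative (\<lambda>y. exp (f x) * frechet_derivative f (at x) y)) (at x)" for x
      using Suc.prems
      by (auto intro!: derivative_eq_intros C_k_has_derivative simp del: C_k.simps)
  next
    show "C_k k (\<lambda>x. exp (f x) * frechet_derivative f (at x) b)" if "b \<in> Basis" for b
      using Suc.prems[THEN C_k_Suc_imp] Suc.prems[THEN C_k_partial, OF that]
      by (intro C_k_mult Suc.IH)
  qed
qed (auto intro: continuous_on_exp)

text \<open>The factor \<open>t\<^sup>-\<^sup>m\<close> makes the family closed under differentiation.\<close>

definition flat :: "nat \<Rightarrow> real \<Rightarrow> real" where
  "flat m t = (if t > 0 then inverse t ^ m * exp (- inverse t) else 0)"

text \<open>From the right the substitution \<open>x = inverse t\<close> turns this into the decay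
  of \<open>x ^ m / exp x\<close> at infinity; to the left of zero the function vanishes.\<close>

lemma flat_tendsto_0: "(flat m \<longlongrightarrow> 0) (at 0)"
proof -
  have "((\<lambda>x::real. x ^ m / exp x) \<longlongrightarrow> 0) at_top"
    by (rule tendsto_power_div_exp_0)
  then have "((\<lambda>t::real. inverse t ^ m / exp (inverse t)) \<longlongrightarrow> 0) (at_right 0)"
    by (rule filterlim_compose) (rule filterlim_inverse_at_top_right)
  then have right: "(flat m \<longlongrightarrow> 0) (at_right 0)"
  proof (rule Lim_transform_eventually)
    show "\<forall>\<^sub>F t in at_right 0. inverse t ^ m / exp (inverse t) = flat m t"
      by (auto simp: eventually_at_filter flat_def exp_minus divide_inverse)
  qed
  have "((\<lambda>t::real. 0::real) \<longlongrightarrow> 0) (at_left 0)"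
    by simp
  then have left: "(flat m \<longlongrightarrow> 0) (at_left 0)"
  proof (rule Lim_transform_eventually)
    show "\<forall>\<^sub>F t in at_left 0. 0 = flat m t"
      by (auto simp: eventually_at_filter flat_def)
  qed
  show ?thesis
    using left right by (simp add: filterlim_at_split)
qed

lemma flat_has_derivative:
  "(flat m has_field_derivative (- real m * flat (Suc m) t + flat (Suc (Suc m)) t)) (at t)"
proof -
  consider "t > 0" | "t < 0" | "t = 0"
    by linarith
  then show ?thesis
  proof cases
    case 1
    let ?g = "\<lambda>t. inverse t ^ m * exp (- inverse t)"
    have "(?g has_field_derivative real m * inverse t ^ (m - 1) * (- (inverse t * inverse t)) * exp (- inverse t) +
        inverse t ^ m * (exp (- inverse t) * (inverse t * inverse t))) (at t)"
      using 1 by (auto intro!: derivative_eq_intros simp: algebra_simps)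
    also have "real m * inverse t ^ (m - 1) * (- (inverse t * inverse t)) * exp (- inverse t) +
        inverse t ^ m * (exp (- inverse t) * (inverse t * inverse t)) =
        - real m * flat (Suc m) t + flat (Suc (Suc m)) t"
      \<comment> \<open>For \<open>m = 0\<close> the exponent \<open>m - 1\<close> is truncated to
        zero, but the factor \<open>real m\<close> removes that term.\<close>
      using 1 by (cases m) (auto simp: flat_def algebra_simps)
    finally show ?thesis
      by (rule has_field_derivative_transform_within_open[where S = "{0<..}"]) (use 1 in \<open>auto simp: flat_def\<close>)
  next
    case 2
    have "((\<lambda>_. 0) has_field_derivative (- real m * flat (Suc m) t + flat (Suc (Suc m)) t)) (at t)"
      using 2 by (auto simp: flat_def)
    then show ?thesis
      by (rule has_field_derivative_transform_within_open[where S = "{..<0}"]) (use 2 in \<open>auto simp: flat_def\<close>)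
  next
    case 3
    \<comment> \<open>Dividing by \<open>h\<close> raises the index by one, so the difference
      quotient at zero is again a flat function and tends to zero.\<close>
    have "(flat m (0 + h) - flat m 0) / h = flat (Suc m) h" for h
      by (auto simp: flat_def divide_inverse)
    then have "(flat m has_field_derivative 0) (at 0)"
      using flat_tendsto_0[of "Suc m"] unfolding DERIV_def by simp
    then show ?thesis
      using 3 by (simp add: flat_def)
  qed
qed

text \<open>The induction on \<open>k\<close> runs for all \<open>m\<close> at once, because
  differentiation raises \<open>m\<close>.\<close>

lemma C_k_flat: "C_k k (\<lambda>x. flat m (c + d \<bullet> x))"
proof (induction k arbitrary: m)
  case 0
  have "continuous_on UNIV (flat m)"
    using DERIV_isCont[OF flat_has_derivative] by (simp add: continuous_at_imp_continuous_on)
  then have "continuous_on UNIV (\<lambda>x. flat m (c + d \<bullet> x))"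
    by (rule continuous_on_compose2) (auto intro!: continuous_intros)
  then show ?case
    by simp
next
  case (Suc k)
  let ?f' = "\<lambda>x. - real m * flat (Suc m) (c + d \<bullet> x) + flat (Suc (Suc m)) (c + d \<bullet> x)"
  show ?case
  proof (rule C_k_SucI)
    show "((\<lambda>x. flat m (c + d \<bullet> x)) has_derivative (\<lambda>y. ?f' x * (d \<bullet> y))) (at x)" for x
    proof -
      have "((\<lambda>x. c + d \<bullet> x) has_derivative (\<lambda>y. d \<bullet> y)) (at x)"
        by (auto intro!: derivative_eq_intros)
      moreover have "(flat m has_derivative (\<lambda>y. ?f' x * y)) (at (c + d \<bullet> x))"
        using flat_has_derivative by (simp add: has_field_derivative_def)
      ultimately show ?thesis
        by (rule has_derivative_compose)
    qed
  next
    show "C_k k (\<lambda>x. ?f' x * (d \<bullet> b))" for b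
      by (intro C_k_mult C_k_add C_k_const Suc.IH)
  qed
qed

section \<open>Integration by parts against test functions\<close>

lemma frechet_derivative_zero:
  assumes "open U" "x \<in> U" "\<And>y. y \<in> U \<Longrightarrow> f y = 0"
  shows "frechet_derivative f (at x) = (\<lambda>y. 0)"
proof -
  have "((\<lambda>y. 0) has_derivative (\<lambda>y. 0)) (at x)"
    by simp
  then have "(f has_derivative (\<lambda>y. 0)) (at x)"
    by (rule has_derivative_transform_within_open[OF _ assms(1,2)]) (simp add: assms(3))
  then show ?thesis
    using frechet_derivative_at by force
qed

lemma integrable_compact_support:
  fixes f :: "'a::euclidean_space \<Rightarrow> real"
  assumes "continuous_on UNIV f" "\<And>x. norm x > r \<Longrightarrow> f x = 0"
  shows "integrable lborel f" "integrable lebesgue f"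
proof -
  have "integrable lborel (\<lambda>x. indicator (cball 0 r) x *\<^sub>R f x)"
    using assms(1) by (intro borel_integrable_compact) (auto intro: continuous_on_subset)
  also have "(\<lambda>x. indicator (cball 0 r) x *\<^sub>R f x) = f"
    by (rule ext) (use assms(2) in \<open>auto simp: indicator_def not_le\<close>)
  finally show "integrable lborel f" .
  then show "integrable lebesgue f"
    by (simp add: integrable_completion borel_measurable_integrable)
qed

lemma lborel_integral_translate:
  fixes f :: "'a::euclidean_space \<Rightarrow> real"
  assumes "integrable lborel f"
  shows "integrable lborel (\<lambda>x. f (x + c))" "(LINT x|lborel. f (x + c)) = (LINT x|lborel. f x)"
proof -
  have f: "integrable (distr lborel borel ((+) c)) f"
    using assms by (simp add: lborel_distr_plus)
  then have m: "f \<in> borel_measurable borel"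
    using borel_measurable_integrable by fastforce
  show "integrable lborel (\<lambda>x. f (x + c))"
    using integrable_distr[OF _ f] by (simp add: add.commute)
  show "(LINT x|lborel. f (x + c)) = (LINT x|lborel. f x)"
    using integral_distr[of "(+) c" lborel borel f] m by (simp add: lborel_distr_plus add.commute)
qed

text \<open>The integrals of the difference quotients vanish by translation invariance, and the
  difference quotients converge dominatedly.\<close>

lemma integral_partial_derivative:
  fixes f :: "'a::euclidean_space \<Rightarrow> real"
  assumes f: "C_k (Suc 0) f" and supp: "\<And>x. norm x > r \<Longrightarrow> f x = 0" and b: "b \<in> Basis"
  shows "(LINT x|lebesgue. frechet_derivative f (at x) b) = 0"
proof -
  define D where "D x = frechet_derivative f (at x) b" for x
  have contf: "continuous_on UNIV f" and contD: "continuous_on UNIV D"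
    using C_k_continuous[OF f] C_k_partial[OF f b] unfolding D_def by auto
  have D0: "D x = 0" if "norm x > r" for x
  proof -
    have "open {x::'a. norm x > r}"
      by (intro open_Collect_less continuous_intros)
    then show ?thesis
      using frechet_derivative_zero[of "{x. norm x > r}" x f] that supp by (simp add: D_def)
  qed
  have intD: "integrable lborel D" and intf: "integrable lborel f"
    using contD contf D0 supp by (auto intro: integrable_compact_support)
  have line: "((\<lambda>t. f (x + t *\<^sub>R b)) has_field_derivative D (x + t *\<^sub>R b)) (at t)" for x t
  proof -
    have "((\<lambda>t. f (x + t *\<^sub>R b)) has_derivative
        (\<lambda>s. frechet_derivative f (at (x + t *\<^sub>R b)) (s *\<^sub>R b))) (at t)"
      by (rule has_derivative_compose[OF _ C_k_has_derivative[OF f]]) (auto intro!: derivative_eq_intros)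
    moreover have "frechet_derivative f (at y) (s *\<^sub>R b) = D y * s" for y s
      using linear_cmul[OF has_derivative_linear[OF C_k_has_derivative[OF f]]]
      by (simp add: D_def mult.commute)
    ultimately show ?thesis
      by (simp add: has_field_derivative_def)
  qed
  obtain M where M: "\<And>x. \<bar>D x\<bar> \<le> M"
  proof -
    have "bounded (D ` cball 0 r)"
      using contD by (intro compact_imp_bounded compact_continuous_image) (auto intro: continuous_on_subset)
    then obtain M where M: "\<forall>x\<in>cball 0 r. \<bar>D x\<bar> \<le> M"
      by (auto simp: bounded_iff)
    have "\<bar>D x\<bar> \<le> max M 0" for x
      using M D0[of x] by (cases "norm x \<le> r") (auto simp: le_max_iff_disj)
    then show ?thesis
      by (rule that)
  qed
  define h where "h n = inverse (real (Suc n))" for n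
  have h: "0 < h n" "h n \<le> 1" for n
    by (auto simp: h_def inverse_le_1_iff)
  have hlim: "filterlim h (at 0) sequentially"
    unfolding filterlim_at using LIMSEQ_inverse_real_of_nat h by (auto simp: h_def[abs_def])
  define q where "q n x = (f (x + h n *\<^sub>R b) - f x) / h n" for n x
  have shift: "integrable lborel (\<lambda>x. f (x + h n *\<^sub>R b))" 
    "(LINT x|lborel. f (x + h n *\<^sub>R b)) = (LINT x|lborel. f x)" for n
    using lborel_integral_translate[OF intf] by auto
  have q0: "(LINT x|lborel. q n x) = 0" for n
    unfolding q_def using shift[of n] intf by simp
  have "(\<lambda>n. LINT x|lborel. q n x) \<longlonglongrightarrow> (LINT x|lborel. D x)"
  \<comment> \<open>The bound \<open>M\<close> on the derivative bounds the quotients by the mean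
    value theorem along the direction \<open>b\<close>. The radius grows by one because
    \<open>h n *\<^sub>R b\<close> has norm at most one, so the translate of the support stays in
    the larger ball.\<close>
  proof (rule integral_dominated_convergence[where w = "\<lambda>x. M * indicator (cball 0 (r + 1)) x"])
    show "D \<in> borel_measurable lborel" "q n \<in> borel_measurable lborel" for n
      unfolding q_def using intD intf shift by (auto intro!: borel_measurable_diff borel_measurable_divide)
    show "integrable lborel (\<lambda>x. M * indicator (cball 0 (r + 1)) x)"
      by (intro integrable_mult_right integrable_real_indicator) (auto simp: emeasure_bounded_finite simp del: infinity_ennreal_def)
    show "AE x in lborel. (\<lambda>n. q n x) \<longlonglongrightarrow> D x"
    proof (rule AE_I2)
      fix x
      have "((\<lambda>t. (f (x + t *\<^sub>R b) - f x) / t) \<longlongrightarrow> D x) (at 0)"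
        using line[of x 0] by (simp add: DERIV_def)
      then show "(\<lambda>n. q n x) \<longlonglongrightarrow> D x"
        unfolding q_def by (rule filterlim_compose[OF _ hlim])
    qed
    show "AE x in lborel. norm (q n x) \<le> M * indicator (cball 0 (r + 1)) x" for n
    proof (rule AE_I2)
      fix x
      show "norm (q n x) \<le> M * indicator (cball 0 (r + 1)) x"
      proof (cases "norm x \<le> r + 1")
        case True
        obtain z where "f (x + h n *\<^sub>R b) - f (x + 0 *\<^sub>R b) = (h n - 0) * D (x + z *\<^sub>R b)"
          using MVT2[OF h(1)[of n] line[of x]] by blast
        then have "q n x = D (x + z *\<^sub>R b)"
          using h(1)[of n] by (simp add: q_def)
        then show ?thesis
          using M True by simp
      next
        case False
        have "norm x \<le> norm (x + h n *\<^sub>R b) + norm (h n *\<^sub>R b)"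
          using norm_triangle_ineq4[of "x + h n *\<^sub>R b" "h n *\<^sub>R b"] by simp
        moreover have "norm (h n *\<^sub>R b) \<le> 1"
          using h[of n] b by simp
        ultimately have "norm (x + h n *\<^sub>R b) > r" "norm x > r"
          using False by linarith+
        then show ?thesis
          using supp False by (simp add: q_def)
      qed
    qed
  qed
  then have "(LINT x|lborel. D x) = 0"
    unfolding q0 by (simp add: LIMSEQ_const_iff)
  moreover have "(LINT x|lebesgue. D x) = (LINT x|lborel. D x)"
    using intD by (intro integral_completion borel_measurable_integrable)
  ultimately show ?thesis
    by (simp add: D_def)
qed

lemma test_function_C_k: "\<phi> \<in> test_functions \<Omega> \<Longrightarrow> C_k k \<phi>"
  by (simp add: test_functions_def)

lemma test_functions_mono: "\<phi> \<in> test_functions S \<Longrightarrow> S \<subseteq> T \<Longrightarrow> \<phi> \<in> test_functions T"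
  by (auto simp: test_functions_def)

text \<open>Points outside \<open>\<Omega>\<close> lie in the open complement of the closed support,
  so \<open>\<phi>\<close> vanishes in a whole neighbourhood of each of them. Integrals over a set
  can then be exchanged with integrals over a superset or the whole space.\<close>

lemma test_function_outside:
  assumes "\<phi> \<in> test_functions \<Omega>" "x \<notin> \<Omega>"
  shows "\<phi> x = 0" "frechet_derivative \<phi> (at x) = (\<lambda>y. 0)"
proof -
  let ?K = "closure {x. \<phi> x \<noteq> 0}"
  have x: "x \<in> - ?K"
    using assms by (auto simp: test_functions_def)
  have z: "y \<in> - ?K \<Longrightarrow> \<phi> y = 0" for y
    using closure_subset[of "{x. \<phi> x \<noteq> 0}"] by auto
  show "\<phi> x = 0"
    using x z by blast
  show "frechet_derivative \<phi> (at x) = (\<lambda>y. 0)"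
    by (rule frechet_derivative_zero[OF _ x z]) auto
qed

lemma test_function_bounded_support:
  assumes "\<phi> \<in> test_functions \<Omega>"
  obtains r where "\<And>x. norm x > r \<Longrightarrow> \<phi> x = 0" "\<And>x. norm x > r \<Longrightarrow> frechet_derivative \<phi> (at x) = (\<lambda>y. 0)"
proof -
  have "bounded (closure {x. \<phi> x \<noteq> 0})"
    using assms by (auto simp: test_functions_def compact_imp_bounded)
  then obtain r where r: "\<And>x. x \<in> closure {x. \<phi> x \<noteq> 0} \<Longrightarrow> norm x \<le> r"
    unfolding bounded_iff by blast
  \<comment> \<open>Reading \<open>\<phi>\<close> as a test function of a ball reduces both claims
    to \<open>test_function_outside\<close>.\<close>
  have "\<phi> \<in> test_functions (cball 0 r)"
    using assms r by (auto simp: test_functions_def)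
  then show ?thesis
    using that[of r] test_function_outside[of \<phi> "cball 0 r"] by (auto simp: not_le)
qed

text \<open>The product \<open>f * \<phi>\<close> is continuously differentiable with bounded
  support, so its partial derivative has integral zero; the product rule splits this
  integral.\<close>

lemma integral_by_parts_test_function:
  assumes f: "C_k (Suc 0) f" and \<phi>: "\<phi> \<in> test_functions \<Omega>" and b: "b \<in> Basis"
  shows "(LINT x:\<Omega>|lebesgue. f x * frechet_derivative \<phi> (at x) b) =
    - (LINT x:\<Omega>|lebesgue. frechet_derivative f (at x) b * \<phi> x)"
proof -
  have C: "C_k (Suc 0) \<phi>"
    by (rule test_function_C_k[OF \<phi>])
  obtain r where r: "\<And>x. norm x > r \<Longrightarrow> \<phi> x = 0" "\<And>x. norm x > r \<Longrightarrow> frechet_derivative \<phi> (at x) = (\<lambda>y. 0)"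
    using test_function_bounded_support[OF \<phi>] by blast
  have deriv: "((\<lambda>x. f x * \<phi> x) has_derivative
        (\<lambda>y. f x * frechet_derivative \<phi> (at x) y + frechet_derivative f (at x) y * \<phi> x)) (at x)" for x
    by (intro has_derivative_mult C_k_has_derivative[OF f] C_k_has_derivative[OF C])
  then have eq: "frechet_derivative (\<lambda>x. f x * \<phi> x) (at x) b =
      f x * frechet_derivative \<phi> (at x) b + frechet_derivative f (at x) b * \<phi> x" for x
    by (simp add: frechet_derivative_at[OF deriv, symmetric])
  have "(LINT x|lebesgue. frechet_derivative (\<lambda>x. f x * \<phi> x) (at x) b) = 0"
    by (rule integral_partial_derivative[of _ r]) (use f C b r in \<open>auto intro: C_k_mult simp del: C_k.simps\<close>)
  moreover have "integrable lebesgue (\<lambda>x. f x * frechet_derivative \<phi> (at x) b)"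
    "integrable lebesgue (\<lambda>x. frechet_derivative f (at x) b * \<phi> x)"
    using C_k_continuous[OF f] C_k_continuous[OF C] C_k_continuous[OF C_k_partial[OF f b]]
      C_k_continuous[OF C_k_partial[OF C b]] r
    by (auto intro!: integrable_compact_support[of _ r] continuous_on_mult)
  ultimately have "(LINT x|lebesgue. f x * frechet_derivative \<phi> (at x) b) =
    - (LINT x|lebesgue. frechet_derivative f (at x) b * \<phi> x)"
    unfolding eq by simp
  moreover have "(\<lambda>x. indicator \<Omega> x *\<^sub>R (f x * frechet_derivative \<phi> (at x) b)) = 
      (\<lambda>x. f x * frechet_derivative \<phi> (at x) b)"
    "(\<lambda>x. indicator \<Omega> x *\<^sub>R (frechet_derivative f (at x) b * \<phi> x)) =
      (\<lambda>x. frechet_derivative f (at x) b * \<phi> x)"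
    using test_function_outside[OF \<phi>] by (auto simp: fun_eq_iff indicator_def)
  ultimately show ?thesis
    by (simp add: set_lebesgue_integral_def)
qed

text \<open>Positive exactly in \<open>box a b\<close>, and tends to the indicator function of that box as \<open>k\<close> grows.\<close>

definition bump :: "'a::euclidean_space \<Rightarrow> 'a \<Rightarrow> nat \<Rightarrow> 'a \<Rightarrow> real" where
  "bump a b k x = 1 - exp (- real k * (\<Prod>i\<in>Basis. flat 0 (- (a \<bullet> i) + i \<bullet> x) * flat 0 (b \<bullet> i + (- i) \<bullet> x)))"

lemma flat_nonneg: "0 \<le> flat m t" and flat_pos_iff: "0 < flat m t \<longleftrightarrow> 0 < t"
  by (auto simp: flat_def)

lemma bump_bounds: "0 \<le> bump a b k x" "bump a b k x \<le> 1"
  by (auto simp: bump_def intro!: mult_nonneg_nonneg prod_nonneg flat_nonneg)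

lemma bump_outside: "x \<notin> box a b \<Longrightarrow> bump a b k x = 0"
  by (force simp: bump_def mem_box flat_def inner_commute)

lemma bump_tendsto: "(\<lambda>k. bump a b k x) \<longlonglongrightarrow> indicator (box a b) x"
proof (cases "x \<in> box a b")
  case True
  define p where "p = (\<Prod>i\<in>Basis. flat 0 (- (a \<bullet> i) + i \<bullet> x) * flat 0 (b \<bullet> i + (- i) \<bullet> x))"
  have "p > 0"
    unfolding p_def using True by (intro prod_pos) (auto simp: mem_box flat_pos_iff inner_commute)
  then have "filterlim (\<lambda>k. real k * p) at_top sequentially"
    using filterlim_at_top_mult_tendsto_pos[OF tendsto_const _ filterlim_real_sequentially, of p] by simp
  then have "(\<lambda>k. exp (- (real k * p))) \<longlonglongrightarrow> 0"
    by (intro filterlim_compose[OF exp_at_bot] filterlim_compose[OF filterlim_uminus_at_bot_at_top])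
  then have "(\<lambda>k. 1 - exp (- (real k * p))) \<longlonglongrightarrow> 1 - 0"
    by (intro tendsto_diff tendsto_const)
  then show ?thesis
    using True by (simp add: bump_def p_def)
qed (simp add: bump_outside)

lemma bump_test_function:
  assumes "cbox a b \<subseteq> \<Omega>"
  shows "bump a b k \<in> test_functions \<Omega>"
proof -
  have "C_k n (bump a b k)" for n
  proof -
    have "bump a b k = (\<lambda>x. 1 + (- 1) * exp (- real k *
        (\<Prod>i\<in>Basis. flat 0 (- (a \<bullet> i) + i \<bullet> x) * flat 0 (b \<bullet> i + (- i) \<bullet> x))))"
      by (simp add: bump_def fun_eq_iff)
    moreover have "C_k n \<dots>"
      by (intro C_k_add C_k_mult C_k_const C_k_exp C_k_prod C_k_flat finite_Basis)
    ultimately show ?thesis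
      by (simp only:)
  qed
  moreover have "{x. bump a b k x \<noteq> 0} \<subseteq> cbox a b"
    using bump_outside box_subset_cbox by blast
  then have "closure {x. bump a b k x \<noteq> 0} \<subseteq> cbox a b"
    by (rule closure_minimal) (rule closed_cbox)
  ultimately show ?thesis
    using assms bounded_subset[OF bounded_cbox[of a b], of "{x. bump a b k x \<noteq> 0}"] closure_subset[of "{x. bump a b k x \<noteq> 0}"]
    by (auto simp: test_functions_def)
qed

text \<open>Dominated convergence along \<open>bump\<close> replaces test functions by indicators of
  boxes, so the integral of \<open>g\<close> over every closed box inside \<open>\<Omega>\<close>
  vanishes. By Lebesgue differentiation the averages over shrinking cubes recover \<open>g\<close>
  almost everywhere.\<close>

lemma fundamental_lemma:
  fixes g :: "'a::euclidean_space \<Rightarrow> real"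
  assumes "open \<Omega>" and g: "set_integrable lebesgue \<Omega> g"
    and test: "\<And>\<phi>. \<phi> \<in> test_functions \<Omega> \<Longrightarrow> (LINT x:\<Omega>|lebesgue. g x * \<phi> x) = 0"
  shows "AE x in lebesgue. x \<in> \<Omega> \<longrightarrow> g x = 0"
proof -
  define F where "F x = indicator \<Omega> x *\<^sub>R g x" for x
  have F: "integrable lebesgue F"
    using g by (simp add: F_def[abs_def] set_integrable_def)
  then have Fset: "set_integrable lebesgue (cbox a b) F" for a b
    unfolding set_integrable_def by (intro integrable_mult_indicator) auto
  have box0: "integral (cbox a b) F = 0" if ab: "cbox a b \<subseteq> \<Omega>" for a b
  proof -
    have k0: "(LINT x|lebesgue. F x * bump a b k x) = 0" for k
      using test[OF bump_test_function[OF ab], of k] by (simp add: set_lebesgue_integral_def F_def mult.assoc)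
    have m: "bump a b k \<in> borel_measurable lebesgue" for k
      using C_k_continuous[OF test_function_C_k[OF bump_test_function[OF ab]], of k]
      by (intro measurable_completion) (simp add: borel_measurable_continuous_onI)
    have "(\<lambda>k. LINT x|lebesgue. F x * bump a b k x) \<longlonglongrightarrow> (LINT x|lebesgue. F x * indicator (box a b) x)"
    proof (rule integral_dominated_convergence[where w = "\<lambda>x. \<bar>F x\<bar>"])
      show "(\<lambda>x. F x * indicator (box a b) x) \<in> borel_measurable lebesgue"
        using F by (intro borel_measurable_times borel_measurable_indicator) auto
      show "(\<lambda>x. F x * bump a b k x) \<in> borel_measurable lebesgue" for k
        using F m by (intro borel_measurable_times) auto
      show "integrable lebesgue (\<lambda>x. \<bar>F x\<bar>)"
        using F by simp
      show "AE x in lebesgue. (\<lambda>k. F x * bump a b k x) \<longlonglongrightarrow> F x * indicator (box a b) x"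
        by (intro AE_I2 tendsto_mult tendsto_const bump_tendsto)
      show "AE x in lebesgue. norm (F x * bump a b k x) \<le> \<bar>F x\<bar>" for k
        using bump_bounds[of a b k] by (intro AE_I2) (simp add: abs_mult mult_left_le)
    qed
    then have "(LINT x|lebesgue. F x * indicator (box a b) x) = 0"
      unfolding k0 by (simp add: LIMSEQ_const_iff)
    then have "(LINT x:box a b|lebesgue. F x) = 0"
      by (simp add: set_lebesgue_integral_def mult.commute)
    moreover have "set_integrable lebesgue (box a b) F"
      by (rule set_integrable_subset[OF Fset[of a b]]) (auto simp: box_subset_cbox)
    ultimately have "integral (box a b) F = 0"
      using set_lebesgue_integral_eq_integral(2) by metis
    then show ?thesis
      by (simp add: integral_open_interval)
  qed
  have "F integrable_on cbox a b" for a b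
    using set_lebesgue_integral_eq_integral(1)[OF Fset] .
  then obtain N where N: "negligible N" "\<And>x e. x \<notin> N \<Longrightarrow> 0 < e \<Longrightarrow>
      \<exists>d>0. \<forall>h. 0 < h \<and> h < d \<longrightarrow> norm (integral (cbox x (x + h *\<^sub>R One)) F /\<^sub>R h ^ DIM('a) - F x) < e"
    using integrable_ccontinuous_explicit[of F] by metis
  have "g x = 0" if x: "x \<in> \<Omega>" "x \<notin> N" for x
  proof (rule ccontr)
    assume "g x \<noteq> 0"
    then have "\<bar>F x\<bar> > 0"
      using x by (simp add: F_def)
    then obtain d where d: "d > 0" "\<And>h. 0 < h \<Longrightarrow> h < d \<Longrightarrow>
        norm (integral (cbox x (x + h *\<^sub>R One)) F /\<^sub>R h ^ DIM('a) - F x) < \<bar>F x\<bar>"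
      using N(2)[OF x(2)] by blast
    obtain e where e: "e > 0" "cball x e \<subseteq> \<Omega>"
      using open_contains_cball_eq[OF assms(1)] x(1) by auto
    \<comment> \<open>The norm is at most the sum of the moduli of the coordinates, so a cube of
      side \<open>e / DIM('a)\<close> with corner \<open>x\<close> fits into
      \<open>cball x e\<close>. Halving \<open>d\<close> keeps \<open>h\<close> strictly below
      it.\<close>
    define h where "h = min (d / 2) (e / DIM('a))"
    have h: "0 < h" "h < d" "DIM('a) * h \<le> e"
      using d(1) e(1) by (auto simp: h_def min_def field_simps)
    have "cbox x (x + h *\<^sub>R One) \<subseteq> cball x e"
    proof
      fix y
      assume y: "y \<in> cbox x (x + h *\<^sub>R One)"
      have "norm (y - x) \<le> (\<Sum>i\<in>Basis. \<bar>(y - x) \<bullet> i\<bar>)"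
        by (rule norm_le_l1)
      also have "\<dots> \<le> (\<Sum>i\<in>(Basis::'a set). h)"
        using y by (intro sum_mono) (auto simp: mem_box inner_diff_left inner_add_left)
      also have "\<dots> \<le> e"
        using h(3) by simp
      finally show "y \<in> cball x e"
        by (simp add: dist_norm norm_minus_commute)
    qed
    then have "integral (cbox x (x + h *\<^sub>R One)) F = 0"
      using e(2) by (intro box0) blast
    then show False
      using d(2)[OF h(1,2)] by simp
  qed
  moreover have "AE x in lebesgue. x \<notin> N"
    using N(1) by (simp add: negligible_iff_null_sets AE_not_in)
  ultimately show ?thesis
    by (auto elim: eventually_mono)
qed

section \<open>Weak derivatives\<close>

text \<open>The classical gradient, defined pointwise; it replaces the arbitrary representative
  \<open>grad\<close> wherever test functions are handled.\<close>

definition gradient :: "('a::euclidean_space \<Rightarrow> real) \<Rightarrow> 'a \<Rightarrow> 'a" where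
  "gradient f x = (\<Sum>b\<in>Basis. frechet_derivative f (at x) b *\<^sub>R b)"

lemma gradient_inner_Basis: "b \<in> Basis \<Longrightarrow> gradient f x \<bullet> b = frechet_derivative f (at x) b"
  by (simp add: gradient_def)

lemma frechet_derivative_eq_gradient:
  assumes "C_k (Suc 0) f"
  shows "frechet_derivative f (at x) y = gradient f x \<bullet> y"
proof -
  have lin: "linear (frechet_derivative f (at x))"
    by (rule has_derivative_linear[OF C_k_has_derivative[OF assms]])
  have "frechet_derivative f (at x) y = frechet_derivative f (at x) (\<Sum>b\<in>Basis. (y \<bullet> b) *\<^sub>R b)"
    by (simp add: euclidean_representation)
  also have "\<dots> = (\<Sum>b\<in>Basis. (y \<bullet> b) * frechet_derivative f (at x) b)"
    using lin by (simp add: linear_sum linear_cmul)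
  finally show ?thesis
    by (simp add: gradient_def inner_sum_left inner_commute[of y] mult.commute)
qed

lemma continuous_gradient: "C_k (Suc 0) f \<Longrightarrow> continuous_on UNIV (gradient f)"
  unfolding gradient_def[abs_def]
  by (intro continuous_on_sum continuous_on_scaleR continuous_on_const C_k_continuous[of 0] C_k_partial)

lemma gradient_eqI:
  assumes "\<And>x. (f has_derivative (\<lambda>y. g x \<bullet> y)) (at x)"
  shows "gradient f = g"
  using frechet_derivative_at[OF assms, symmetric]
  by (simp add: fun_eq_iff gradient_def euclidean_representation)

lemma gradient_lincomb:
  assumes "C_k (Suc 0) f" "C_k (Suc 0) g"
  shows "gradient (\<lambda>x. f x + c * g x) = (\<lambda>x. gradient f x + c *\<^sub>R gradient g x)"
proof (rule gradient_eqI)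
  fix x
  have "((\<lambda>x. f x + c * g x) has_derivative
      (\<lambda>y. frechet_derivative f (at x) y + c * frechet_derivative g (at x) y)) (at x)"
    by (intro has_derivative_add has_derivative_mult_right C_k_has_derivative[OF assms(1)]
        C_k_has_derivative[OF assms(2)])
  then show "((\<lambda>x. f x + c * g x) has_derivative (\<lambda>y. (gradient f x + c *\<^sub>R gradient g x) \<bullet> y)) (at x)"
    by (simp only: frechet_derivative_eq_gradient[OF assms(1)] frechet_derivative_eq_gradient[OF assms(2)]
        inner_add_left inner_scaleR_left)
qed

lemma test_function_C1: "\<phi> \<in> test_functions \<Omega> \<Longrightarrow> C_k (Suc 0) \<phi>"
  by (rule test_function_C_k)

lemma test_functions_lincomb:
  assumes "\<phi> \<in> test_functions \<Omega>" "\<psi> \<in> test_functions \<Omega>"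
  shows "(\<lambda>x. \<phi> x + c * \<psi> x) \<in> test_functions \<Omega>"
proof -
  let ?S = "\<lambda>f :: 'a \<Rightarrow> real. {x. f x \<noteq> 0}"
  let ?h = "\<lambda>x. \<phi> x + c * \<psi> x"
  have "closure (?S ?h) \<subseteq> closure (?S \<phi> \<union> ?S \<psi>)"
    by (intro closure_mono) auto
  then have sub: "closure (?S ?h) \<subseteq> closure (?S \<phi>) \<union> closure (?S \<psi>)"
    by simp
  moreover have "compact (closure (?S \<phi>) \<union> closure (?S \<psi>))"
    using assms by (intro compact_Un) (auto simp: test_functions_def)
  ultimately have "compact (closure (?S ?h))"
    by (meson bounded_subset closed_closure compact_eq_bounded_closed)
  moreover have "C_k k ?h" for k
    using assms by (intro C_k_add C_k_mult C_k_const test_function_C_k)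
  ultimately show ?thesis
    using assms sub by (auto simp: test_functions_def)
qed

lemma set_integral_eq_subset:
  assumes "S' \<subseteq> S" "\<And>x. x \<notin> S' \<Longrightarrow> F x = 0"
  shows "(LINT x:S'|M. F x) = (LINT x:S|M. (F x :: real))"
  unfolding set_lebesgue_integral_def
  by (rule Bochner_Integration.integral_cong) (use assms in \<open>auto simp: indicator_def\<close>)

lemma weak_gradient_L2: "weak_gradient \<Omega> u g \<Longrightarrow> g \<in> L2 \<Omega>"
  by (simp add: weak_gradient_def)

lemma weak_divergence_L2: "weak_divergence \<Omega> q d \<Longrightarrow> d \<in> L2 \<Omega>"
  by (simp add: weak_divergence_def)

lemma weak_gradient_test:
  "weak_gradient \<Omega> u g \<Longrightarrow> \<phi> \<in> test_functions \<Omega> \<Longrightarrow> b \<in> Basis \<Longrightarrow>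
    (LINT x:\<Omega>|lebesgue. u x * frechet_derivative \<phi> (at x) b) = - (LINT x:\<Omega>|lebesgue. (g x \<bullet> b) * \<phi> x)"
  by (simp add: weak_gradient_def)

lemma weak_divergence_test:
  "weak_divergence \<Omega> q d \<Longrightarrow> \<phi> \<in> test_functions \<Omega> \<Longrightarrow>
    (LINT x:\<Omega>|lebesgue. frechet_derivative \<phi> (at x) (q x)) = - (LINT x:\<Omega>|lebesgue. d x * \<phi> x)"
  by (simp add: weak_divergence_def)

text \<open>A test function of the smaller set is one of the larger set, and the integrands vanish
  in between. Restriction from \<open>\<Omega>\<close> to the interior of an element is the intended
  use.\<close>

lemma weak_gradient_subset:
  assumes "weak_gradient S u g" "S' \<in> sets lebesgue" "S' \<subseteq> S"
  shows "weak_gradient S' u g"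
  unfolding weak_gradient_def
proof (intro conjI ballI)
  show "g \<in> L2 S'"
    by (rule L2_subset[OF weak_gradient_L2[OF assms(1)] assms(2,3)])
next
  fix \<phi> :: "'a \<Rightarrow> real" and b :: 'a
  assume \<phi>: "\<phi> \<in> test_functions S'" and b: "b \<in> Basis"
  have e: "(LINT x:S'|lebesgue. u x * frechet_derivative \<phi> (at x) b) =
      (LINT x:S|lebesgue. u x * frechet_derivative \<phi> (at x) b)"
    "(LINT x:S'|lebesgue. (g x \<bullet> b) * \<phi> x) = (LINT x:S|lebesgue. (g x \<bullet> b) * \<phi> x)"
    by (rule set_integral_eq_subset[OF assms(3)]; simp add: test_function_outside[OF \<phi>])+
  show "(LINT x:S'|lebesgue. u x * frechet_derivative \<phi> (at x) b) = - (LINT x:S'|lebesgue. (g x \<bullet> b) * \<phi> x)"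
    unfolding e
    by (rule weak_gradient_test[OF assms(1) test_functions_mono[OF \<phi> assms(3)] b])
qed

lemma weak_divergence_subset:
  assumes "weak_divergence S q d" "S' \<in> sets lebesgue" "S' \<subseteq> S"
  shows "weak_divergence S' q d"
  unfolding weak_divergence_def
proof (intro conjI ballI)
  show "d \<in> L2 S'"
    by (rule L2_subset[OF weak_divergence_L2[OF assms(1)] assms(2,3)])
next
  fix \<phi> :: "'a \<Rightarrow> real"
  assume \<phi>: "\<phi> \<in> test_functions S'"
  have e: "(LINT x:S'|lebesgue. frechet_derivative \<phi> (at x) (q x)) =
      (LINT x:S|lebesgue. frechet_derivative \<phi> (at x) (q x))"
    "(LINT x:S'|lebesgue. d x * \<phi> x) = (LINT x:S|lebesgue. d x * \<phi> x)"
    by (rule set_integral_eq_subset[OF assms(3)]; simp add: test_function_outside[OF \<phi>])+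
  show "(LINT x:S'|lebesgue. frechet_derivative \<phi> (at x) (q x)) = - (LINT x:S'|lebesgue. d x * \<phi> x)"
    unfolding e
    by (rule weak_divergence_test[OF assms(1) test_functions_mono[OF \<phi> assms(3)]])
qed

lemma weak_gradient_cong:
  assumes "S \<in> sets lebesgue" "\<And>x. x \<in> S \<Longrightarrow> u x = v x"
  shows "weak_gradient S u g \<longleftrightarrow> weak_gradient S v g"
proof -
  have "(LINT x:S|lebesgue. u x * frechet_derivative \<phi> (at x) b) =
      (LINT x:S|lebesgue. v x * frechet_derivative \<phi> (at x) b)" for \<phi> :: "'a \<Rightarrow> real" and b
    using assms by (intro set_lebesgue_integral_cong) auto
  then show ?thesis
    by (simp add: weak_gradient_def)
qed

lemma grad_weak_gradient: "u \<in> H1 \<Omega> \<Longrightarrow> weak_gradient \<Omega> u (grad \<Omega> u)"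
  using someI_ex[of "weak_gradient \<Omega> u"] by (simp add: H1_def grad_def)

lemma grad_L2: "u \<in> H1 \<Omega> \<Longrightarrow> grad \<Omega> u \<in> L2 \<Omega>"
  by (rule weak_gradient_L2[OF grad_weak_gradient])

lemma H1_L2: "u \<in> H1 \<Omega> \<Longrightarrow> u \<in> L2 \<Omega>"
  by (simp add: H1_def)

lemma dvg_weak_divergence: "q \<in> H_div \<Omega> \<Longrightarrow> weak_divergence \<Omega> q (dvg \<Omega> q)"
  using someI_ex[of "weak_divergence \<Omega> q"] by (simp add: H_div_def dvg_def)

lemma dvg_L2: "q \<in> H_div \<Omega> \<Longrightarrow> dvg \<Omega> q \<in> L2 \<Omega>"
  by (rule weak_divergence_L2[OF dvg_weak_divergence])

lemma H_div_L2: "q \<in> H_div \<Omega> \<Longrightarrow> q \<in> L2 \<Omega>"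
  by (simp add: H_div_def)

lemma H1_norm_eq: "u \<in> H1 \<Omega> \<Longrightarrow> H1_norm \<Omega> u = L2_norm \<Omega> (\<lambda>x. (u x, grad \<Omega> u x))"
  using L2_norm_Pair[OF H1_L2 grad_L2, of u \<Omega>]
  by (simp add: H1_norm_def L2_norm_nonneg real_sqrt_unique)

lemma H_div_norm_eq: "q \<in> H_div \<Omega> \<Longrightarrow> H_div_norm \<Omega> q = L2_norm \<Omega> (\<lambda>x. (q x, dvg \<Omega> q x))"
  using L2_norm_Pair[OF H_div_L2 dvg_L2, of q \<Omega>]
  by (simp add: H_div_norm_def L2_norm_nonneg real_sqrt_unique)

lemma set_integral_lincomb:
  fixes f g :: "'a::euclidean_space \<Rightarrow> real"
  assumes "set_integrable M S f" "set_integrable M S g"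
  shows "(LINT x:S|M. f x + c * g x) = (LINT x:S|M. f x) + c * (LINT x:S|M. g x)"
  using assms by (simp add: set_integral_add set_integrable_mult_right)

lemma L2_inner_const: "g \<in> L2 S \<Longrightarrow> (\<lambda>x. g x \<bullet> b) \<in> L2 S"
  by (rule L2_linear[where h = "\<lambda>y. y \<bullet> b"]) (auto intro: bounded_linear_inner_left)

text \<open>Interpreted for \<open>\<Omega>\<close> and for the interior of each element. Openness
  gives uniqueness of weak derivatives; boundedness makes continuous functions
  square-integrable.\<close>

locale bounded_open_set =
  fixes \<Omega> :: "'a::euclidean_space set"
  assumes open_\<Omega>: "open \<Omega>" and bounded_\<Omega>: "bounded \<Omega>"
begin

lemma sets_\<Omega>: "\<Omega> \<in> sets lebesgue"
  using open_\<Omega> by auto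

lemma continuous_L2: "continuous_on UNIV f \<Longrightarrow> (f :: 'a \<Rightarrow> 'b::euclidean_space) \<in> L2 \<Omega>"
  by (rule L2_continuous[OF _ sets_\<Omega> bounded_\<Omega>])

lemma C_k_L2: "C_k k f \<Longrightarrow> f \<in> L2 \<Omega>"
  by (intro continuous_L2 C_k_continuous)

lemma gradient_L2: "C_k (Suc 0) f \<Longrightarrow> gradient f \<in> L2 \<Omega>"
  by (intro continuous_L2 continuous_gradient)

lemma weak_gradient_C1:
  assumes "C_k (Suc 0) f"
  shows "weak_gradient \<Omega> f (gradient f)"
  unfolding weak_gradient_def
proof (intro conjI ballI)
  show "(LINT x:\<Omega>|lebesgue. f x * frechet_derivative \<phi> (at x) b) =
      - (LINT x:\<Omega>|lebesgue. (gradient f x \<bullet> b) * \<phi> x)" 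
    if "\<phi> \<in> test_functions \<Omega>" "b \<in> Basis" for \<phi> b
    using integral_by_parts_test_function[OF assms that] that by (simp add: gradient_inner_Basis)
qed (rule gradient_L2[OF assms])

lemma C1_H1: "C_k (Suc 0) f \<Longrightarrow> f \<in> H1 \<Omega>"
  using weak_gradient_C1 C_k_L2 by (auto simp: H1_def simp del: C_k.simps)

lemma weak_gradient_lincomb:
  assumes u: "u \<in> L2 \<Omega>" "v \<in> L2 \<Omega>" and g: "weak_gradient \<Omega> u g" "weak_gradient \<Omega> v h"
  shows "weak_gradient \<Omega> (\<lambda>x. u x + c * v x) (\<lambda>x. g x + c *\<^sub>R h x)"
  unfolding weak_gradient_def
proof (intro conjI ballI)
  show "(\<lambda>x. g x + c *\<^sub>R h x) \<in> L2 \<Omega>"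
    by (rule L2_lincomb[OF g[THEN weak_gradient_L2]])
  fix \<phi> :: "'a \<Rightarrow> real" and b :: 'a
  assume \<phi>: "\<phi> \<in> test_functions \<Omega>" and b: "b \<in> Basis"
  have C: "C_k (Suc 0) \<phi>"
    by (rule test_function_C1[OF \<phi>])
  have D: "(\<lambda>x. frechet_derivative \<phi> (at x) b) \<in> L2 \<Omega>"
    by (rule C_k_L2[OF C_k_partial[OF C b]])
  have "(LINT x:\<Omega>|lebesgue. (u x + c * v x) * frechet_derivative \<phi> (at x) b) =
      (LINT x:\<Omega>|lebesgue. u x * frechet_derivative \<phi> (at x) b) +
      c * (LINT x:\<Omega>|lebesgue. v x * frechet_derivative \<phi> (at x) b)"
    using set_integral_lincomb[OF set_integrable_mult_L2[OF u(1) D] set_integrable_mult_L2[OF u(2) D], of c]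
    by (simp add: distrib_right mult.assoc)
  also have "\<dots> = - ((LINT x:\<Omega>|lebesgue. (g x \<bullet> b) * \<phi> x) + c * (LINT x:\<Omega>|lebesgue. (h x \<bullet> b) * \<phi> x))"
    using weak_gradient_test[OF g(1) \<phi> b] weak_gradient_test[OF g(2) \<phi> b] by simp
  also have "\<dots> = - (LINT x:\<Omega>|lebesgue. ((g x + c *\<^sub>R h x) \<bullet> b) * \<phi> x)"
    using set_integral_lincomb[OF
        set_integrable_mult_L2[OF L2_inner_const[OF weak_gradient_L2[OF g(1)], of b] C_k_L2[OF C]]
        set_integrable_mult_L2[OF L2_inner_const[OF weak_gradient_L2[OF g(2)], of b] C_k_L2[OF C]], of c]
    by (simp add: inner_add_left distrib_right mult.assoc)
  finally show "(LINT x:\<Omega>|lebesgue. (u x + c * v x) * frechet_derivative \<phi> (at x) b) =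
      - (LINT x:\<Omega>|lebesgue. ((g x + c *\<^sub>R h x) \<bullet> b) * \<phi> x)" .
qed

lemma weak_divergence_lincomb:
  assumes q: "q \<in> L2 \<Omega>" "r \<in> L2 \<Omega>" and d: "weak_divergence \<Omega> q d" "weak_divergence \<Omega> r e"
  shows "weak_divergence \<Omega> (\<lambda>x. q x + c *\<^sub>R r x) (\<lambda>x. d x + c * e x)"
  unfolding weak_divergence_def
proof (intro conjI ballI)
  show "(\<lambda>x. d x + c * e x) \<in> L2 \<Omega>"
    using L2_lincomb[OF d[THEN weak_divergence_L2]] by simp
  fix \<phi> :: "'a \<Rightarrow> real"
  assume \<phi>: "\<phi> \<in> test_functions \<Omega>"
  have C: "C_k (Suc 0) \<phi>"
    by (rule test_function_C1[OF \<phi>])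
  have "(LINT x:\<Omega>|lebesgue. frechet_derivative \<phi> (at x) (q x + c *\<^sub>R r x)) =
      (LINT x:\<Omega>|lebesgue. frechet_derivative \<phi> (at x) (q x)) +
      c * (LINT x:\<Omega>|lebesgue. frechet_derivative \<phi> (at x) (r x))"
    unfolding frechet_derivative_eq_gradient[OF C]
    using set_integral_lincomb[OF set_integrable_inner_L2[OF gradient_L2[OF C] q(1)]
        set_integrable_inner_L2[OF gradient_L2[OF C] q(2)], of c]
    by (simp add: inner_add_right)
  also have "\<dots> = - ((LINT x:\<Omega>|lebesgue. d x * \<phi> x) + c * (LINT x:\<Omega>|lebesgue. e x * \<phi> x))"
    using d \<phi> by (simp add: weak_divergence_def)
  also have "\<dots> = - (LINT x:\<Omega>|lebesgue. (d x + c * e x) * \<phi> x)"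
    using set_integral_lincomb[OF set_integrable_mult_L2[OF weak_divergence_L2[OF d(1)] C_k_L2[OF C]]
        set_integrable_mult_L2[OF weak_divergence_L2[OF d(2)] C_k_L2[OF C]], of c]
    by (simp add: distrib_right mult.assoc)
  finally show "(LINT x:\<Omega>|lebesgue. frechet_derivative \<phi> (at x) (q x + c *\<^sub>R r x)) =
      - (LINT x:\<Omega>|lebesgue. (d x + c * e x) * \<phi> x)" .
qed

lemma L2_eq_AE:
  fixes f g :: "'a \<Rightarrow> real"
  assumes f: "f \<in> L2 \<Omega>" and g: "g \<in> L2 \<Omega>"
    and test: "\<And>\<phi>. \<phi> \<in> test_functions \<Omega> \<Longrightarrow> (LINT x:\<Omega>|lebesgue. f x * \<phi> x) = (LINT x:\<Omega>|lebesgue. g x * \<phi> x)"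
  shows "AE x in lebesgue. x \<in> \<Omega> \<longrightarrow> f x = g x"
proof -
  have "AE x in lebesgue. x \<in> \<Omega> \<longrightarrow> f x - g x = 0"
  proof (rule fundamental_lemma[OF open_\<Omega>])
    show "set_integrable lebesgue \<Omega> (\<lambda>x. f x - g x)"
      by (rule set_integrable_L2[OF L2_diff[OF f g] sets_\<Omega> bounded_\<Omega>])
  next
    fix \<phi> :: "'a \<Rightarrow> real"
    assume \<phi>: "\<phi> \<in> test_functions \<Omega>"
    have "\<phi> \<in> L2 \<Omega>"
      by (rule C_k_L2[OF test_function_C1[OF \<phi>]])
    then show "(LINT x:\<Omega>|lebesgue. (f x - g x) * \<phi> x) = 0"
      using set_integral_lincomb[OF set_integrable_mult_L2[OF f] set_integrable_mult_L2[OF g], of \<phi> \<phi> "-1"]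
        test[OF \<phi>] by (simp add: left_diff_distrib)
  qed
  then show ?thesis
    by simp
qed

text \<open>The fundamental lemma applies to each component, and the basis is finite, so the
  exceptional sets unite to a null set.\<close>

lemma weak_gradient_unique:
  assumes g: "weak_gradient \<Omega> u g" and h: "weak_gradient \<Omega> u h"
  shows "AE x in lebesgue. x \<in> \<Omega> \<longrightarrow> g x = h x"
proof -
  have "AE x in lebesgue. x \<in> \<Omega> \<longrightarrow> g x \<bullet> b = h x \<bullet> b" if b: "b \<in> Basis" for b
  proof (rule L2_eq_AE)
    show "(LINT x:\<Omega>|lebesgue. g x \<bullet> b * \<phi> x) = (LINT x:\<Omega>|lebesgue. h x \<bullet> b * \<phi> x)"
      if "\<phi> \<in> test_functions \<Omega>" for \<phi>
      using weak_gradient_test[OF g that b] weak_gradient_test[OF h that b] by simp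
  qed (intro L2_inner_const weak_gradient_L2[OF g] weak_gradient_L2[OF h])+
  then have "AE x in lebesgue. \<forall>b\<in>Basis. x \<in> \<Omega> \<longrightarrow> g x \<bullet> b = h x \<bullet> b"
    by (intro AE_ball_countable[THEN iffD2] countable_finite finite_Basis) blast
  then show ?thesis
    by eventually_elim (auto intro: euclidean_eqI)
qed

lemma weak_divergence_unique:
  assumes d: "weak_divergence \<Omega> q d" and e: "weak_divergence \<Omega> q e"
  shows "AE x in lebesgue. x \<in> \<Omega> \<longrightarrow> d x = e x"
  by (rule L2_eq_AE) (use d e in \<open>auto simp: weak_divergence_def\<close>)

lemma grad_AE: "weak_gradient \<Omega> u g \<Longrightarrow> u \<in> L2 \<Omega> \<Longrightarrow> AE x in lebesgue. x \<in> \<Omega> \<longrightarrow> grad \<Omega> u x = g x"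
  by (rule weak_gradient_unique[OF grad_weak_gradient]) (auto simp: H1_def)

lemma dvg_AE: "weak_divergence \<Omega> q d \<Longrightarrow> q \<in> L2 \<Omega> \<Longrightarrow> AE x in lebesgue. x \<in> \<Omega> \<longrightarrow> dvg \<Omega> q x = d x"
  by (rule weak_divergence_unique[OF dvg_weak_divergence]) (auto simp: H_div_def)

lemma grad_C1_AE: "C_k (Suc 0) f \<Longrightarrow> AE x in lebesgue. x \<in> \<Omega> \<longrightarrow> grad \<Omega> f x = gradient f x"
  by (intro grad_AE weak_gradient_C1 C_k_L2)

lemma
  assumes u: "u \<in> H1 \<Omega>" and v: "v \<in> H1 \<Omega>"
  shows H1_lincomb: "(\<lambda>x. u x + c * v x) \<in> H1 \<Omega>"
    and grad_lincomb_AE: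
      "AE x in lebesgue. x \<in> \<Omega> \<longrightarrow> grad \<Omega> (\<lambda>x. u x + c * v x) x = grad \<Omega> u x + c *\<^sub>R grad \<Omega> v x"
proof -
  have w: "weak_gradient \<Omega> (\<lambda>x. u x + c * v x) (\<lambda>x. grad \<Omega> u x + c *\<^sub>R grad \<Omega> v x)"
    by (intro weak_gradient_lincomb H1_L2 grad_weak_gradient u v)
  have L: "(\<lambda>x. u x + c * v x) \<in> L2 \<Omega>"
    using L2_lincomb[OF H1_L2[OF u] H1_L2[OF v], of c] by simp
  show "(\<lambda>x. u x + c * v x) \<in> H1 \<Omega>"
    using w L by (auto simp: H1_def)
  show "AE x in lebesgue. x \<in> \<Omega> \<longrightarrow> grad \<Omega> (\<lambda>x. u x + c * v x) x = grad \<Omega> u x + c *\<^sub>R grad \<Omega> v x"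
    by (rule grad_AE[OF w L])
qed

lemma H1_diff: "u \<in> H1 \<Omega> \<Longrightarrow> v \<in> H1 \<Omega> \<Longrightarrow> (\<lambda>x. u x - v x) \<in> H1 \<Omega>"
  using H1_lincomb[of u v "-1"] by simp

lemma grad_diff_AE:
  "u \<in> H1 \<Omega> \<Longrightarrow> v \<in> H1 \<Omega> \<Longrightarrow>
    AE x in lebesgue. x \<in> \<Omega> \<longrightarrow> grad \<Omega> (\<lambda>x. u x - v x) x = grad \<Omega> u x - grad \<Omega> v x"
  using grad_lincomb_AE[of u v "-1"] by simp

lemma L2_norm_grad_diff:
  "u \<in> H1 \<Omega> \<Longrightarrow> v \<in> H1 \<Omega> \<Longrightarrow>
    L2_norm \<Omega> (grad \<Omega> (\<lambda>x. u x - v x)) = L2_norm \<Omega> (\<lambda>x. grad \<Omega> u x - grad \<Omega> v x)"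
  by (rule L2_norm_cong_AE[OF grad_diff_AE])

lemma
  assumes q: "q \<in> H_div \<Omega>" and r: "r \<in> H_div \<Omega>"
  shows H_div_diff: "(\<lambda>x. q x - r x) \<in> H_div \<Omega>"
    and dvg_diff_AE: "AE x in lebesgue. x \<in> \<Omega> \<longrightarrow> dvg \<Omega> (\<lambda>x. q x - r x) x = dvg \<Omega> q x - dvg \<Omega> r x"
proof -
  have w: "weak_divergence \<Omega> (\<lambda>x. q x - r x) (\<lambda>x. dvg \<Omega> q x - dvg \<Omega> r x)"
    using weak_divergence_lincomb[OF q[THEN H_div_L2] r[THEN H_div_L2] q[THEN dvg_weak_divergence]
        r[THEN dvg_weak_divergence], of "-1"] by simp
  have L: "(\<lambda>x. q x - r x) \<in> L2 \<Omega>"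
    by (intro L2_diff H_div_L2 q r)
  show "(\<lambda>x. q x - r x) \<in> H_div \<Omega>"
    using w L by (auto simp: H_div_def)
  show "AE x in lebesgue. x \<in> \<Omega> \<longrightarrow> dvg \<Omega> (\<lambda>x. q x - r x) x = dvg \<Omega> q x - dvg \<Omega> r x"
    by (rule dvg_AE[OF w L])
qed

section \<open>Zero boundary values: density, Gauss formula, Friedrichs inequality\<close>

lemma H1_0_H1: "u \<in> H1_0 \<Omega> \<Longrightarrow> u \<in> H1 \<Omega>"
  by (simp add: H1_0_def)

text \<open>The gradient chosen for \<open>u - \<phi>\<close> is traded for
  \<open>grad \<Omega> u - gradient \<phi>\<close>, in which the approximating part is classical.
  All density arguments below start from this form.\<close>

lemma H1_0_approx:
  assumes "u \<in> H1_0 \<Omega>" "\<epsilon> > 0"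
  obtains \<phi> where "\<phi> \<in> test_functions \<Omega>"
    "L2_norm \<Omega> (\<lambda>x. (u x - \<phi> x, grad \<Omega> u x - gradient \<phi> x)) < \<epsilon>"
proof -
  obtain \<phi> where \<phi>: "\<phi> \<in> test_functions \<Omega>" "H1_norm \<Omega> (\<lambda>x. u x - \<phi> x) < \<epsilon>"
    using assms by (auto simp: H1_0_def)
  have C: "C_k (Suc 0) \<phi>"
    by (rule test_function_C1[OF \<phi>(1)])
  have "AE x in lebesgue. x \<in> \<Omega> \<longrightarrow> grad \<Omega> (\<lambda>x. u x - \<phi> x) x = grad \<Omega> u x - gradient \<phi> x"
    using grad_diff_AE[OF H1_0_H1[OF assms(1)] C1_H1[OF C]] grad_C1_AE[OF C] by eventually_elim auto
  then have "L2_norm \<Omega> (\<lambda>x. (u x - \<phi> x, grad \<Omega> (\<lambda>x. u x - \<phi> x) x)) =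
      L2_norm \<Omega> (\<lambda>x. (u x - \<phi> x, grad \<Omega> u x - gradient \<phi> x))"
    by (intro L2_norm_cong_AE) (auto elim: eventually_mono)
  then show ?thesis
    using that[OF \<phi>(1)] \<phi>(2) H1_norm_eq[OF H1_diff[OF H1_0_H1[OF assms(1)] C1_H1[OF C]]] by simp
qed

lemma H1_0_diff:
  assumes u: "u \<in> H1_0 \<Omega>" and v: "v \<in> H1_0 \<Omega>"
  shows "(\<lambda>x. u x - v x) \<in> H1_0 \<Omega>"
proof -
  let ?w = "\<lambda>x. u x - v x"
  have w: "?w \<in> H1 \<Omega>"
    by (intro H1_diff H1_0_H1 u v)
  have "\<exists>\<phi>\<in>test_functions \<Omega>. H1_norm \<Omega> (\<lambda>x. ?w x - \<phi> x) < \<epsilon>" if "\<epsilon> > 0" for \<epsilon>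
  proof -
    have half: "\<epsilon> / 2 > 0"
      using that by simp
    obtain \<phi> where \<phi>: "\<phi> \<in> test_functions \<Omega>"
      "L2_norm \<Omega> (\<lambda>x. (u x - \<phi> x, grad \<Omega> u x - gradient \<phi> x)) < \<epsilon> / 2"
      using H1_0_approx[OF u half] by blast
    obtain \<psi> where \<psi>: "\<psi> \<in> test_functions \<Omega>"
      "L2_norm \<Omega> (\<lambda>x. (v x - \<psi> x, grad \<Omega> v x - gradient \<psi> x)) < \<epsilon> / 2"
      using H1_0_approx[OF v half] by blast
    have C: "C_k (Suc 0) \<phi>" "C_k (Suc 0) \<psi>"
      by (intro test_function_C1[OF \<phi>(1)] test_function_C1[OF \<psi>(1)])+
    define \<eta> where "\<eta> x = \<phi> x - \<psi> x" for x
    have \<eta>: "\<eta> \<in> test_functions \<Omega>" "gradient \<eta> = (\<lambda>x. gradient \<phi> x - gradient \<psi> x)"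
      using test_functions_lincomb[OF \<phi>(1) \<psi>(1), of "-1"] gradient_lincomb[OF C, of "-1"]
      by (simp_all add: \<eta>_def[abs_def])
    have C\<eta>: "C_k (Suc 0) \<eta>"
      by (rule test_function_C1[OF \<eta>(1)])
    have "AE x in lebesgue. x \<in> \<Omega> \<longrightarrow> grad \<Omega> (\<lambda>x. ?w x - \<eta> x) x =
        (grad \<Omega> u x - gradient \<phi> x) - (grad \<Omega> v x - gradient \<psi> x)"
      using grad_diff_AE[OF w C1_H1[OF C\<eta>]] grad_diff_AE[OF H1_0_H1[OF u] H1_0_H1[OF v]] grad_C1_AE[OF C\<eta>]
      by eventually_elim (auto simp: \<eta>(2))
    then have "AE x in lebesgue. x \<in> \<Omega> \<longrightarrow> (?w x - \<eta> x, grad \<Omega> (\<lambda>x. ?w x - \<eta> x) x) =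
        (u x - \<phi> x, grad \<Omega> u x - gradient \<phi> x) - (v x - \<psi> x, grad \<Omega> v x - gradient \<psi> x)"
      by eventually_elim (auto simp: \<eta>_def)
    then have "H1_norm \<Omega> (\<lambda>x. ?w x - \<eta> x) = L2_norm \<Omega> (\<lambda>x.
        (u x - \<phi> x, grad \<Omega> u x - gradient \<phi> x) - (v x - \<psi> x, grad \<Omega> v x - gradient \<psi> x))"
      unfolding H1_norm_eq[OF H1_diff[OF w C1_H1[OF C\<eta>]]] by (rule L2_norm_cong_AE)
    also have "\<dots> \<le> L2_norm \<Omega> (\<lambda>x. (u x - \<phi> x, grad \<Omega> u x - gradient \<phi> x)) +
        L2_norm \<Omega> (\<lambda>x. (v x - \<psi> x, grad \<Omega> v x - gradient \<psi> x))"
      by (intro L2_norm_triangle_minus L2_Pair L2_diff H1_L2 grad_L2 H1_0_H1 u v C_k_L2[OF C(1)]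
          C_k_L2[OF C(2)] gradient_L2 C)
    finally have "H1_norm \<Omega> (\<lambda>x. ?w x - \<eta> x) < \<epsilon>"
      using \<phi>(2) \<psi>(2) by simp
    then show ?thesis
      using \<eta>(1) by blast
  qed
  then show ?thesis
    using w by (simp add: H1_0_def)
qed

text \<open>For a test function this is the definition of the weak divergence. By Cauchy-Schwarz
  with the pair \<open>(dvg \<Omega> q, q)\<close> the integral depends continuously on
  \<open>v\<close> in the H1 norm, so the identity passes to the closure.\<close>

lemma Gauss_H1_0:
  assumes q: "q \<in> H_div \<Omega>" and v: "v \<in> H1_0 \<Omega>"
  shows "(LINT x:\<Omega>|lebesgue. q x \<bullet> grad \<Omega> v x + dvg \<Omega> q x * v x) = 0"
proof -
  define I where "I = (LINT x:\<Omega>|lebesgue. q x \<bullet> grad \<Omega> v x + dvg \<Omega> q x * v x)"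
  define N where "N = L2_norm \<Omega> (\<lambda>x. (dvg \<Omega> q x, q x))"
  have N: "N \<ge> 0"
    by (simp add: N_def L2_norm_nonneg)
  have "\<bar>I\<bar> \<le> 0 + \<epsilon>" if "\<epsilon> > 0" for \<epsilon>
  proof -
    \<comment> \<open>Adding one to \<open>N\<close> covers the case \<open>N = 0\<close>.\<close>
    have "\<epsilon> / (N + 1) > 0"
      using that N by simp
    then obtain \<phi> where \<phi>: "\<phi> \<in> test_functions \<Omega>"
      "L2_norm \<Omega> (\<lambda>x. (v x - \<phi> x, grad \<Omega> v x - gradient \<phi> x)) < \<epsilon> / (N + 1)"
      using H1_0_approx[OF v] by blast
    have C: "C_k (Suc 0) \<phi>"
      by (rule test_function_C1[OF \<phi>(1)])
    have L: "q \<in> L2 \<Omega>" "dvg \<Omega> q \<in> L2 \<Omega>" "v \<in> L2 \<Omega>" "grad \<Omega> v \<in> L2 \<Omega>" "\<phi> \<in> L2 \<Omega>" "gradient \<phi> \<in> L2 \<Omega>"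
      by (intro H_div_L2 dvg_L2 q H1_L2 grad_L2 H1_0_H1 v C_k_L2[OF C] gradient_L2 C)+
    have "(LINT x:\<Omega>|lebesgue. q x \<bullet> gradient \<phi> x) + (LINT x:\<Omega>|lebesgue. dvg \<Omega> q x * \<phi> x) = 0"
      using weak_divergence_test[OF dvg_weak_divergence[OF q] \<phi>(1)]
      by (simp add: frechet_derivative_eq_gradient[OF C] inner_commute[of "gradient \<phi> _"])
    then have "I = I - (LINT x:\<Omega>|lebesgue. q x \<bullet> gradient \<phi> x + dvg \<Omega> q x * \<phi> x)"
      using L by (simp add: set_integral_add set_integrable_inner_L2 set_integrable_mult_L2)
    also have "\<dots> = (LINT x:\<Omega>|lebesgue. (q x \<bullet> grad \<Omega> v x + dvg \<Omega> q x * v x) -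
        (q x \<bullet> gradient \<phi> x + dvg \<Omega> q x * \<phi> x))"
      unfolding I_def using L
      by (intro set_integral_diff(2)[symmetric] set_integral_add set_integrable_inner_L2 set_integrable_mult_L2)
    also have "\<dots> = (LINT x:\<Omega>|lebesgue. (dvg \<Omega> q x, q x) \<bullet> (v x - \<phi> x, grad \<Omega> v x - gradient \<phi> x))"
      by (simp add: algebra_simps inner_diff_right)
    finally have I: "I = \<dots>" .
    have "\<bar>I\<bar> \<le> N * L2_norm \<Omega> (\<lambda>x. (v x - \<phi> x, grad \<Omega> v x - gradient \<phi> x))"
      unfolding N_def I by (intro L2_Cauchy_Schwarz L2_Pair L2_diff L)
    also have "\<dots> \<le> N * (\<epsilon> / (N + 1))"
      using \<phi>(2) N by (intro mult_left_mono) auto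
    also have "\<dots> \<le> \<epsilon>"
      using N that by (simp add: field_simps)
    finally show ?thesis
      by simp
  qed
  then have "\<bar>I\<bar> \<le> 0"
    by (rule field_le_epsilon)
  then show ?thesis
    by (simp add: I_def)
qed

text \<open>For test functions integrate \<open>\<partial>\<^sub>b((x \<bullet> b) \<phi>\<^sup>2)\<close>, which has mean value zero.\<close>

lemma Friedrichs:
  obtains K where "K > 0" "\<And>v. v \<in> H1_0 \<Omega> \<Longrightarrow> L2_norm \<Omega> v \<le> K * L2_norm \<Omega> (grad \<Omega> v)"
proof -
  obtain R where R: "R > 0" "\<And>x. x \<in> \<Omega> \<Longrightarrow> norm x \<le> R"
    using bounded_\<Omega> bounded_pos by blast
  obtain b :: 'a where b: "b \<in> Basis"
    using nonempty_Basis by blast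
  have nb: "norm b = 1"
    using b by simp
  have test: "L2_norm \<Omega> \<phi> \<le> 2 * R * L2_norm \<Omega> (gradient \<phi>)" if \<phi>: "\<phi> \<in> test_functions \<Omega>" for \<phi>
  proof -
    have C: "C_k (Suc 0) \<phi>"
      by (rule test_function_C1[OF \<phi>])
    \<comment> \<open>The weight \<open>b \<bullet> x\<close> has derivative one in the direction
      \<open>b\<close> and is bounded by \<open>R\<close> on \<open>\<Omega>\<close>. The summand
      \<open>0\<close> puts it into the form of \<open>C_k_affine\<close>.\<close>
    have Cb: "C_k (Suc 0) (\<lambda>x. (0 + b \<bullet> x) * \<phi> x)"
      by (intro C_k_mult C_k_affine C)
    let ?D = "\<lambda>x. frechet_derivative \<phi> (at x) b"
    have "((\<lambda>x. (0 + b \<bullet> x) * \<phi> x) has_derivative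
        (\<lambda>y. (0 + b \<bullet> x) * frechet_derivative \<phi> (at x) y + (b \<bullet> y) * \<phi> x)) (at x)" for x
      by (rule has_derivative_mult[OF _ C_k_has_derivative[OF C]]) (auto intro!: derivative_eq_intros)
    from frechet_derivative_at[OF this, symmetric]
    have Db: "frechet_derivative (\<lambda>x. (0 + b \<bullet> x) * \<phi> x) (at x) b = (b \<bullet> x) * ?D x + \<phi> x" for x
      using b by (simp add: inner_same_Basis)
    have L: "\<phi> \<in> L2 \<Omega>" "?D \<in> L2 \<Omega>" "(\<lambda>x. (b \<bullet> x) * \<phi> x) \<in> L2 \<Omega>" "gradient \<phi> \<in> L2 \<Omega>"
      using C_k_L2[OF C] C_k_L2[OF C_k_partial[OF C b]] C_k_L2[OF Cb] gradient_L2[OF C] by auto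
    define J where "J = (LINT x:\<Omega>|lebesgue. (b \<bullet> x) * \<phi> x * ?D x)"
    \<comment> \<open>Integrating by parts reproduces \<open>J\<close>: it becomes
      \<open>- J\<close> minus the square of the norm of \<open>\<phi>\<close>. Hence that square
      equals \<open>- 2 * J\<close>, the source of the factor 2 in the constant.\<close>
    have "J = - (LINT x:\<Omega>|lebesgue. ((b \<bullet> x) * ?D x + \<phi> x) * \<phi> x)"
      using integral_by_parts_test_function[OF Cb \<phi> b] unfolding Db by (simp add: J_def)
    also have "(\<lambda>x. ((b \<bullet> x) * ?D x + \<phi> x) * \<phi> x) = (\<lambda>x. (b \<bullet> x) * \<phi> x * ?D x + \<phi> x * \<phi> x)"
      by (simp add: fun_eq_iff algebra_simps)
    also have "(LINT x:\<Omega>|lebesgue. (b \<bullet> x) * \<phi> x * ?D x + \<phi> x * \<phi> x) = J + (L2_norm \<Omega> \<phi>)\<^sup>2"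
      unfolding J_def using L L2_norm_inner[of \<Omega> \<phi>]
      by (subst set_integral_add(2)) (auto intro: set_integrable_mult_L2)
    finally have "(L2_norm \<Omega> \<phi>)\<^sup>2 \<le> 2 * \<bar>J\<bar>"
      by simp
    also have "\<bar>J\<bar> \<le> L2_norm \<Omega> (\<lambda>x. (b \<bullet> x) * \<phi> x) * L2_norm \<Omega> ?D"
      using L2_Cauchy_Schwarz[OF L(3,2)] by (simp add: J_def)
    also have "\<dots> \<le> (R * L2_norm \<Omega> \<phi>) * L2_norm \<Omega> (gradient \<phi>)"
    proof (intro mult_mono)
      have "L2_norm \<Omega> (\<lambda>x. (b \<bullet> x) * \<phi> x) \<le> L2_norm \<Omega> (\<lambda>x. R *\<^sub>R \<phi> x)"
      proof (rule L2_norm_mono[OF L(3) L2_scaleR[OF L(1)]])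
        fix x
        assume "x \<in> \<Omega>"
        then have "\<bar>b \<bullet> x\<bar> \<le> R"
          using Cauchy_Schwarz_ineq2[of b x] nb R(2)[of x] by simp
        then show "norm (b \<bullet> x * \<phi> x) \<le> norm (R *\<^sub>R \<phi> x)"
          using R(1) by (simp add: abs_mult mult_right_mono)
      qed
      then show "L2_norm \<Omega> (\<lambda>x. (b \<bullet> x) * \<phi> x) \<le> R * L2_norm \<Omega> \<phi>"
        using R(1) L2_norm_scaleR[of \<Omega> R \<phi>] by simp
      show "L2_norm \<Omega> ?D \<le> L2_norm \<Omega> (gradient \<phi>)"
      proof (rule L2_norm_mono[OF L(2,4)])
        show "norm (?D x) \<le> norm (gradient \<phi> x)" for x
          using Cauchy_Schwarz_ineq2[of "gradient \<phi> x" b] nb gradient_inner_Basis[OF b, of \<phi> x] by simp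
      qed
    qed (use R in \<open>auto simp: L2_norm_nonneg\<close>)
    finally have "L2_norm \<Omega> \<phi> * L2_norm \<Omega> \<phi> \<le> L2_norm \<Omega> \<phi> * (2 * R * L2_norm \<Omega> (gradient \<phi>))"
      by (simp add: power2_eq_square algebra_simps)
    then show ?thesis
      using R L2_norm_nonneg[of \<Omega> \<phi>] L2_norm_nonneg[of \<Omega> "gradient \<phi>"]
      by (cases "L2_norm \<Omega> \<phi> = 0") (auto simp: mult_le_cancel_left)
  qed
  show ?thesis
  proof (rule that)
    show "2 * R > 0"
      using R by simp
    fix v
    assume v: "v \<in> H1_0 \<Omega>"
    have "L2_norm \<Omega> v \<le> 2 * R * L2_norm \<Omega> (grad \<Omega> v) + \<epsilon>" if "\<epsilon> > 0" for \<epsilon>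
    proof -
      \<comment> \<open>An H1 error below \<open>\<delta>\<close> costs \<open>\<delta>\<close> for
        the function and \<open>2 * R * \<delta>\<close> for its gradient; together this is
        \<open>\<epsilon>\<close>.\<close>
      define \<delta> where "\<delta> = \<epsilon> / (1 + 2 * R)"
      have "\<delta> > 0"
        using that R by (simp add: \<delta>_def)
      then obtain \<phi> where \<phi>: "\<phi> \<in> test_functions \<Omega>"
        "L2_norm \<Omega> (\<lambda>x. (v x - \<phi> x, grad \<Omega> v x - gradient \<phi> x)) < \<delta>"
        using H1_0_approx[OF v] by blast
      have C: "C_k (Suc 0) \<phi>"
        by (rule test_function_C1[OF \<phi>(1)])
      have L: "v \<in> L2 \<Omega>" "grad \<Omega> v \<in> L2 \<Omega>" "\<phi> \<in> L2 \<Omega>" "gradient \<phi> \<in> L2 \<Omega>"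
        "(\<lambda>x. v x - \<phi> x) \<in> L2 \<Omega>" "(\<lambda>x. grad \<Omega> v x - gradient \<phi> x) \<in> L2 \<Omega>"
        by (intro H1_L2 grad_L2 H1_0_H1 v C_k_L2[OF C] gradient_L2 C L2_diff)+
      have "L2_norm \<Omega> (\<lambda>x. v x - \<phi> x) \<le> L2_norm \<Omega> (\<lambda>x. (v x - \<phi> x, grad \<Omega> v x - gradient \<phi> x))"
        by (rule L2_norm_mono[OF L(5) L2_Pair[OF L(5,6)]]) (simp add: norm_Pair)
      then have 1: "L2_norm \<Omega> (\<lambda>x. v x - \<phi> x) < \<delta>"
        using \<phi>(2) by simp
      have "L2_norm \<Omega> (\<lambda>x. grad \<Omega> v x - gradient \<phi> x) \<le>
          L2_norm \<Omega> (\<lambda>x. (v x - \<phi> x, grad \<Omega> v x - gradient \<phi> x))"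
        by (rule L2_norm_mono[OF L(6) L2_Pair[OF L(5,6)]]) (simp add: norm_Pair)
      then have 2: "L2_norm \<Omega> (\<lambda>x. grad \<Omega> v x - gradient \<phi> x) < \<delta>"
        using \<phi>(2) by simp
      have "L2_norm \<Omega> v \<le> L2_norm \<Omega> (\<lambda>x. v x - \<phi> x) + L2_norm \<Omega> \<phi>"
        using L2_norm_triangle[OF L(5,3)] by simp
      also have "\<dots> \<le> \<delta> + 2 * R * L2_norm \<Omega> (gradient \<phi>)"
        using 1 test[OF \<phi>(1)] by simp
      also have "\<dots> \<le> \<delta> + 2 * R * (L2_norm \<Omega> (grad \<Omega> v) + \<delta>)"
        using L2_norm_triangle_minus[OF L(2,6)] 2 R(1) by simp
      also have "\<dots> = 2 * R * L2_norm \<Omega> (grad \<Omega> v) + \<delta> * (1 + 2 * R)"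
        by (simp add: algebra_simps)
      also have "\<delta> * (1 + 2 * R) = \<epsilon>"
        using R(1) by (simp add: \<delta>_def)
      finally show ?thesis .
    qed
    then show "L2_norm \<Omega> v \<le> 2 * R * L2_norm \<Omega> (grad \<Omega> v)"
      by (rule field_le_epsilon)
  qed
qed

end

section \<open>The nonlinearity\<close>

text \<open>The derivative of \<open>\<phi> t * t\<close> is
  \<open>\<phi> t + t * deriv \<phi> t\<close>, which lies between the two constants, so the mean
  value theorem applies. It asks only for continuity at the endpoints, hence \<open>s = 0\<close> is
  covered.\<close>

lemma nonlinearity_growth:
  assumes nl: "nonlinearity \<gamma>\<^sub>1 \<gamma>\<^sub>2 \<phi>" and st: "0 \<le> s" "s < t"
  shows "\<gamma>\<^sub>1 * (t - s) \<le> \<phi> t * t - \<phi> s * s" "\<phi> t * t - \<phi> s * s \<le> \<gamma>\<^sub>2 * (t - s)"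
proof -
  have deriv: "((\<lambda>t. \<phi> t * t) has_field_derivative \<phi> z + z * deriv \<phi> z) (at z)" if "z > 0" for z
  proof -
    have "\<phi> differentiable (at z)"
      using nl that unfolding nonlinearity_def by blast
    then have "(\<phi> has_field_derivative deriv \<phi> z) (at z)"
      by (rule DERIV_deriv_iff_real_differentiable[THEN iffD2])
    from DERIV_mult[OF this DERIV_ident] show ?thesis
      by (rule DERIV_cong) (simp add: algebra_simps)
  qed
  have "continuous_on {0..} \<phi>"
    using nl unfolding nonlinearity_def by blast
  then have "continuous_on {s..t} \<phi>"
    by (rule continuous_on_subset) (use st in auto)
  then have "continuous_on {s..t} (\<lambda>t. \<phi> t * t)"
    by (rule continuous_on_mult) (rule continuous_on_id)
  moreover have "(\<lambda>t. \<phi> t * t) differentiable (at z)" if "s < z" for z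
    using deriv[of z] st that real_differentiable_def by auto
  ultimately obtain l z where z: "s < z" "((\<lambda>t. \<phi> t * t) has_field_derivative l) (at z)"
    "\<phi> t * t - \<phi> s * s = (t - s) * l"
    using MVT[OF st(2), of "\<lambda>t. \<phi> t * t"] by blast
  have "l = \<phi> z + z * deriv \<phi> z"
    using DERIV_unique[OF z(2) deriv] z(1) st by simp
  then have "\<gamma>\<^sub>1 \<le> l" "l \<le> \<gamma>\<^sub>2"
    using nl z(1) st by (auto simp: nonlinearity_def)
  then show "\<gamma>\<^sub>1 * (t - s) \<le> \<phi> t * t - \<phi> s * s" "\<phi> t * t - \<phi> s * s \<le> \<gamma>\<^sub>2 * (t - s)"
    using st z(3) by (simp_all add: mult.commute[of "t - s"] mult_right_mono)
qed

text \<open>Each quantity splits into a radial part, governed by the scalar map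
  \<open>\<phi> t * t\<close>, and a multiple of \<open>a * b - A \<bullet> B\<close>, the
  nonnegative gap in the Cauchy-Schwarz inequality. Estimates between them reduce to a comparison of
  coefficients.\<close>

lemma sigma_map_products:
  fixes A B :: "'a::euclidean_space"
  defines "a \<equiv> norm A" and "b \<equiv> norm B"
  shows "(sigma_map \<phi> A - sigma_map \<phi> B) \<bullet> (A - B) =
      (\<phi> a * a - \<phi> b * b) * (a - b) + (\<phi> a + \<phi> b) * (a * b - A \<bullet> B)"
    "(norm (sigma_map \<phi> A - sigma_map \<phi> B))\<^sup>2 =
      (\<phi> a * a - \<phi> b * b)\<^sup>2 + 2 * (\<phi> a * \<phi> b) * (a * b - A \<bullet> B)"
    "(norm (A - B))\<^sup>2 = (a - b)\<^sup>2 + 2 * (a * b - A \<bullet> B)"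
proof -
  have sq: "A \<bullet> A = a * a" "B \<bullet> B = b * b"
    by (simp_all add: a_def b_def flip: power2_eq_square power2_norm_eq_inner)
  show "(sigma_map \<phi> A - sigma_map \<phi> B) \<bullet> (A - B) =
      (\<phi> a * a - \<phi> b * b) * (a - b) + (\<phi> a + \<phi> b) * (a * b - A \<bullet> B)"
    unfolding sigma_map_def a_def[symmetric] b_def[symmetric]
    by (simp add: inner_diff_left inner_diff_right inner_commute[of B A] sq algebra_simps)
  show "(norm (sigma_map \<phi> A - sigma_map \<phi> B))\<^sup>2 =
      (\<phi> a * a - \<phi> b * b)\<^sup>2 + 2 * (\<phi> a * \<phi> b) * (a * b - A \<bullet> B)"
    unfolding sigma_map_def a_def[symmetric] b_def[symmetric] power2_norm_eq_inner
    by (simp add: power2_eq_square inner_diff_left inner_diff_right inner_commute[of B A] sq algebra_simps)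
  show "(norm (A - B))\<^sup>2 = (a - b)\<^sup>2 + 2 * (a * b - A \<bullet> B)"
    unfolding power2_norm_eq_inner
    by (simp add: power2_eq_square inner_diff_left inner_diff_right inner_commute[of B A] sq algebra_simps)
qed

text \<open>The radial parts compare by \<open>nonlinearity_growth\<close>. For the gap
  \<open>c\<close> the coefficients are \<open>\<phi> a + \<phi> b\<close>, at least
  \<open>2 * \<gamma>\<^sub>1\<close>, and \<open>2 * (\<phi> a * \<phi> b)\<close>, at most
  \<open>2 * \<gamma>\<^sub>2\<^sup>2\<close>; so the scalar constants carry over unchanged to
  vectors.\<close>

lemma
  fixes A B :: "'a::euclidean_space"
  assumes nl: "nonlinearity \<gamma>\<^sub>1 \<gamma>\<^sub>2 \<phi>" and \<gamma>: "0 < \<gamma>\<^sub>1"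
  shows sigma_map_monotone:
      "\<gamma>\<^sub>1 * (norm (A - B))\<^sup>2 \<le> (sigma_map \<phi> A - sigma_map \<phi> B) \<bullet> (A - B)"
    and sigma_map_lipschitz: "norm (sigma_map \<phi> A - sigma_map \<phi> B) \<le> \<gamma>\<^sub>2 * norm (A - B)"
proof -
  define a b c where "a = norm A" and "b = norm B" and "c = a * b - A \<bullet> B"
  note prods = sigma_map_products[where A = A and B = B, folded a_def b_def, folded c_def]
  define d where "d = \<phi> a * a - \<phi> b * b"
  have ab: "a \<ge> 0" "b \<ge> 0"
    by (simp_all add: a_def b_def)
  have c: "c \<ge> 0"
    using norm_cauchy_schwarz[of A B] by (simp add: a_def b_def c_def)
  have \<phi>: "\<gamma>\<^sub>1 \<le> \<phi> a" "\<phi> a \<le> \<gamma>\<^sub>2" "\<gamma>\<^sub>1 \<le> \<phi> b" "\<phi> b \<le> \<gamma>\<^sub>2"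
    using nl ab by (auto simp: nonlinearity_def)
  have d: "\<gamma>\<^sub>1 * (a - b)\<^sup>2 \<le> d * (a - b) \<and> \<bar>d\<bar> \<le> \<gamma>\<^sub>2 * \<bar>a - b\<bar>"
  proof (rule linorder_cases[of a b])
    assume "a = b"
    then show ?thesis
      by (simp add: d_def)
  next
    assume l: "a < b"
    have 1: "\<gamma>\<^sub>1 * (b - a) \<le> - d" "- d \<le> \<gamma>\<^sub>2 * (b - a)"
      using nonlinearity_growth[OF nl ab(1) l] by (simp_all add: d_def)
    have "\<gamma>\<^sub>1 * (b - a) * (b - a) \<le> - d * (b - a)"
      using l 1(1) by (intro mult_right_mono) auto
    moreover have "0 \<le> \<gamma>\<^sub>1 * (b - a)"
      using \<gamma> l by simp
    ultimately show ?thesis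
      using l 1 by (simp add: power2_eq_square algebra_simps)
  next
    assume l: "b < a"
    have 1: "\<gamma>\<^sub>1 * (a - b) \<le> d" "d \<le> \<gamma>\<^sub>2 * (a - b)"
      using nonlinearity_growth[OF nl ab(2) l] by (simp_all add: d_def)
    have "\<gamma>\<^sub>1 * (a - b) * (a - b) \<le> d * (a - b)"
      using l 1(1) by (intro mult_right_mono) auto
    moreover have "0 \<le> \<gamma>\<^sub>1 * (a - b)"
      using \<gamma> l by simp
    ultimately show ?thesis
      using l 1 by (simp add: power2_eq_square algebra_simps)
  qed
  have "2 * \<gamma>\<^sub>1 * c \<le> (\<phi> a + \<phi> b) * c"
    using \<phi> c by (intro mult_right_mono) auto
  then show "\<gamma>\<^sub>1 * (norm (A - B))\<^sup>2 \<le> (sigma_map \<phi> A - sigma_map \<phi> B) \<bullet> (A - B)"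
    unfolding prods d_def[symmetric] using d by (simp add: algebra_simps)
  have \<gamma>2: "\<gamma>\<^sub>2 \<ge> 0"
    using \<phi> \<gamma> by linarith
  have "\<phi> a * \<phi> b \<le> \<gamma>\<^sub>2\<^sup>2"
    unfolding power2_eq_square using \<phi> \<gamma> \<gamma>2 by (intro mult_mono) auto
  then have "2 * (\<phi> a * \<phi> b) * c \<le> 2 * \<gamma>\<^sub>2\<^sup>2 * c"
    using c by (intro mult_right_mono) auto
  moreover have "d\<^sup>2 \<le> \<gamma>\<^sub>2\<^sup>2 * (a - b)\<^sup>2"
    using d power_mono[of "\<bar>d\<bar>" "\<gamma>\<^sub>2 * \<bar>a - b\<bar>" 2] by (simp add: power_mult_distrib)
  ultimately have "(norm (sigma_map \<phi> A - sigma_map \<phi> B))\<^sup>2 \<le> (\<gamma>\<^sub>2 * norm (A - B))\<^sup>2"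
    unfolding power_mult_distrib prods d_def[symmetric] by (simp add: algebra_simps)
  then show "norm (sigma_map \<phi> A - sigma_map \<phi> B) \<le> \<gamma>\<^sub>2 * norm (A - B)"
    by (rule power2_le_imp_le) (simp add: \<gamma>2)
qed

text \<open>Lipschitz continuity together with the value zero at the origin gives linear
  growth.\<close>

lemma L2_sigma_map:
  assumes nl: "nonlinearity \<gamma>\<^sub>1 \<gamma>\<^sub>2 \<phi>" and \<gamma>: "0 < \<gamma>\<^sub>1" and g: "g \<in> L2 S"
  shows "(\<lambda>x. sigma_map \<phi> (g x)) \<in> L2 S"
proof (rule L2_linear_growth[OF g])
  have "\<gamma>\<^sub>1 \<le> \<phi> 0" "\<phi> 0 \<le> \<gamma>\<^sub>2"
    using nl by (auto simp: nonlinearity_def)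
  then have "\<gamma>\<^sub>2 \<ge> 0"
    using \<gamma> by linarith
  then have "\<gamma>\<^sub>2-lipschitz_on UNIV (sigma_map \<phi> :: 'b \<Rightarrow> 'b)"
    using sigma_map_lipschitz[OF nl \<gamma>] by (auto simp: lipschitz_on_def dist_norm)
  then show "continuous_on UNIV (sigma_map \<phi> :: 'b \<Rightarrow> 'b)"
    by (rule lipschitz_on_continuous_on)
  show "norm (sigma_map \<phi> y) \<le> \<gamma>\<^sub>2 * norm y" for y :: 'b
    using sigma_map_lipschitz[OF nl \<gamma>, of y 0] by (simp add: sigma_map_def)
qed

section \<open>Broken spaces on a mesh\<close>

text \<open>The geometry of a triangulation enters the estimates through these four properties,
  which \<open>mesh_regular_triangulation\<close> establishes. They are phrased with interiors,
  where weak derivatives live; the rest of \<open>\<Omega>\<close> is a null set.\<close>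

locale mesh = bounded_open_set \<Omega> for \<Omega> :: "'a::euclidean_space set" +
  fixes \<T> :: "'a set set"
  assumes finite_\<T>: "finite \<T>"
    and disjoint: "T \<in> \<T> \<Longrightarrow> T' \<in> \<T> \<Longrightarrow> x \<in> interior T \<Longrightarrow> x \<in> interior T' \<Longrightarrow> T = T'"
    and interior_subset_\<Omega>: "T \<in> \<T> \<Longrightarrow> interior T \<subseteq> \<Omega>"
    and negligible_skeleton: "negligible (\<Omega> - (\<Union>T\<in>\<T>. interior T))"
begin

lemma bounded_open_interior: "T \<in> \<T> \<Longrightarrow> bounded_open_set (interior T)"
  using bounded_subset[OF bounded_\<Omega> interior_subset_\<Omega>] by unfold_locales auto

lemma sets_interior: "interior (T :: 'a set) \<in> sets lebesgue"
  using open_interior[of T] by auto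

text \<open>The skeleton and the finitely many exceptional sets of the elements form one null set.
  Elementwise facts about representatives reach \<open>\<Omega>\<close> this way.\<close>

lemma AE_elements:
  assumes "\<And>T. T \<in> \<T> \<Longrightarrow> AE x in lebesgue. x \<in> interior T \<longrightarrow> P x"
  shows "AE x in lebesgue. x \<in> \<Omega> \<longrightarrow> P x"
proof -
  have "AE x in lebesgue. x \<notin> \<Omega> - (\<Union>T\<in>\<T>. interior T)"
    using negligible_skeleton by (intro AE_not_in) (simp add: negligible_iff_null_sets)
  moreover have "AE x in lebesgue. \<forall>T\<in>\<T>. x \<in> interior T \<longrightarrow> P x"
    by (intro AE_ball_countable[THEN iffD2] countable_finite finite_\<T> ballI assms)
  ultimately show ?thesis
    by eventually_elim auto
qed

lemma sum_indicator_interior: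
  assumes "T \<in> \<T>" "x \<in> interior T"
  shows "(\<Sum>S\<in>\<T>. indicator (interior S) x *\<^sub>R F S) = (F T :: 'b::real_vector)"
proof -
  have "(\<Sum>S\<in>\<T>. indicator (interior S) x *\<^sub>R F S) = (\<Sum>S\<in>\<T>. if S = T then F S else 0)"
    using assms disjoint by (intro sum.cong) (auto simp: indicator_def)
  then show ?thesis
    using assms(1) finite_\<T> by simp
qed

lemma grad_NC_interior: "T \<in> \<T> \<Longrightarrow> x \<in> interior T \<Longrightarrow> grad_NC \<T> v x = grad (interior T) v x"
  unfolding grad_NC_def by (rule sum_indicator_interior)

text \<open>Glues elementwise data: the finite sum inherits measurability and integrability from the
  elements and passes them on to the cutoff by \<open>\<Omega>\<close>. Outside
  \<open>\<Omega>\<close> both sides vanish because all interiors lie in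
  \<open>\<Omega>\<close>.\<close>

lemma indicator_elements_AE:
  "AE x in lebesgue. (\<Sum>T\<in>\<T>. indicator (interior T) x *\<^sub>R f x) = indicator \<Omega> x *\<^sub>R (f x :: 'b::real_vector)"
proof -
  have "AE x in lebesgue. x \<in> \<Omega> \<longrightarrow> (\<Sum>T\<in>\<T>. indicator (interior T) x *\<^sub>R f x) = f x"
    by (intro AE_elements AE_I2) (simp add: sum_indicator_interior)
  then show ?thesis
  proof eventually_elim
    case (elim x)
    show ?case
    proof (cases "x \<in> \<Omega>")
      case False
      then have "(\<Sum>T\<in>\<T>. indicator (interior T) x *\<^sub>R f x) = 0"
        using interior_subset_\<Omega> by (intro sum.neutral) (auto simp: indicator_def)
      with False show ?thesis
        by simp
    qed (use elim in simp)
  qed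
qed

lemma
  fixes f :: "'a \<Rightarrow> real"
  assumes f: "\<And>T. T \<in> \<T> \<Longrightarrow> set_integrable lebesgue (interior T) f"
  shows set_integrable_elements: "set_integrable lebesgue \<Omega> f"
    and set_integral_elements: "(LINT x:\<Omega>|lebesgue. f x) = (\<Sum>T\<in>\<T>. LINT x:interior T|lebesgue. f x)"
proof -
  let ?s = "\<lambda>x. \<Sum>T\<in>\<T>. indicator (interior T) x *\<^sub>R f x"
  have s: "integrable lebesgue ?s"
    using f by (intro Bochner_Integration.integrable_sum) (auto simp: set_integrable_def)
  have m: "(\<lambda>x. indicator \<Omega> x *\<^sub>R f x) \<in> borel_measurable lebesgue"
    by (rule borel_measurable_AE[OF borel_measurable_integrable[OF s] indicator_elements_AE])
  show "set_integrable lebesgue \<Omega> f"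
    unfolding set_integrable_def by (rule integrable_cong_AE_imp[OF s m indicator_elements_AE])
  have "(LINT x:\<Omega>|lebesgue. f x) = integral\<^sup>L lebesgue ?s"
    unfolding set_lebesgue_integral_def
    by (rule integral_cong_AE[OF borel_measurable_integrable[OF s] m indicator_elements_AE, symmetric])
  also have "\<dots> = (\<Sum>T\<in>\<T>. LINT x:interior T|lebesgue. f x)"
    using f unfolding set_lebesgue_integral_def
    by (intro Bochner_Integration.integral_sum) (auto simp: set_integrable_def)
  finally show "(LINT x:\<Omega>|lebesgue. f x) = (\<Sum>T\<in>\<T>. LINT x:interior T|lebesgue. f x)" .
qed

lemma L2_elements:
  fixes f :: "'a \<Rightarrow> 'b::euclidean_space"
  assumes f: "\<And>T. T \<in> \<T> \<Longrightarrow> f \<in> L2 (interior T)"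
  shows "f \<in> L2 \<Omega>"
proof -
  have "(\<lambda>x. \<Sum>T\<in>\<T>. indicator (interior T) x *\<^sub>R f x) \<in> borel_measurable lebesgue"
    using f by (intro borel_measurable_sum) (auto simp: L2_iff)
  then have "set_borel_measurable lebesgue \<Omega> f"
    unfolding set_borel_measurable_def by (rule borel_measurable_AE[OF _ indicator_elements_AE])
  moreover have "set_integrable lebesgue \<Omega> (\<lambda>x. (norm (f x))\<^sup>2)"
    using f by (intro set_integrable_elements set_integrable_norm_L2)
  ultimately show ?thesis
    by (simp add: L2_def)
qed

lemma broken_H1_interior: "v \<in> broken_H1 \<T> \<Longrightarrow> T \<in> \<T> \<Longrightarrow> v \<in> H1 (interior T)"
  by (simp add: broken_H1_def)

lemma broken_H1_L2: "v \<in> broken_H1 \<T> \<Longrightarrow> v \<in> L2 \<Omega>"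
  by (intro L2_elements H1_L2 broken_H1_interior)

lemma grad_NC_L2: "v \<in> broken_H1 \<T> \<Longrightarrow> grad_NC \<T> v \<in> L2 \<Omega>"
  by (rule L2_elements, rule L2_cong_AE[OF grad_L2[OF broken_H1_interior]]) (auto simp: grad_NC_interior)

lemma H1_broken_H1:
  assumes v: "v \<in> H1 \<Omega>"
  shows "v \<in> broken_H1 \<T>"
  unfolding broken_H1_def
proof safe
  fix T
  assume "T \<in> \<T>"
  then show "v \<in> H1 (interior T)"
    using weak_gradient_subset[OF grad_weak_gradient[OF v] sets_interior interior_subset_\<Omega>, of T]
      L2_subset[OF H1_L2[OF v] sets_interior interior_subset_\<Omega>, of T] by (auto simp: H1_def)
qed

text \<open>The restriction of \<open>grad \<Omega> v\<close> is a weak gradient on each element,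
  and weak gradients there are unique.\<close>

lemma grad_NC_H1_AE:
  assumes v: "v \<in> H1 \<Omega>"
  shows "AE x in lebesgue. x \<in> \<Omega> \<longrightarrow> grad_NC \<T> v x = grad \<Omega> v x"
proof (rule AE_elements)
  fix T
  assume T: "T \<in> \<T>"
  interpret T: bounded_open_set "interior T"
    by (rule bounded_open_interior[OF T])
  have "AE x in lebesgue. x \<in> interior T \<longrightarrow> grad (interior T) v x = grad \<Omega> v x"
    by (intro T.grad_AE weak_gradient_subset[OF grad_weak_gradient[OF v]] L2_subset[OF H1_L2[OF v]]
        sets_interior interior_subset_\<Omega> T)
  then show "AE x in lebesgue. x \<in> interior T \<longrightarrow> grad_NC \<T> v x = grad \<Omega> v x"
    by eventually_elim (simp add: grad_NC_interior[OF T])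
qed

lemma P1_broken_H1:
  assumes "v \<in> P1 \<T>"
  shows "v \<in> broken_H1 \<T>"
  unfolding broken_H1_def
proof safe
  fix T
  assume T: "T \<in> \<T>"
  interpret T: bounded_open_set "interior T"
    by (rule bounded_open_interior[OF T])
  obtain c d where v: "\<And>x. x \<in> interior T \<Longrightarrow> v x = c + d \<bullet> x"
    using assms T by (auto simp: P1_def)
  have "weak_gradient (interior T) (\<lambda>x. c + d \<bullet> x) (gradient (\<lambda>x. c + d \<bullet> x))"
    by (rule T.weak_gradient_C1[OF C_k_affine])
  then have "weak_gradient (interior T) v (gradient (\<lambda>x. c + d \<bullet> x))"
    using weak_gradient_cong[OF T.sets_\<Omega>, of v "\<lambda>x. c + d \<bullet> x"] v by blast
  moreover have "v \<in> L2 (interior T)"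
    using T.C_k_L2[OF C_k_affine, of c d] by (rule L2_cong_AE) (auto simp: v)
  ultimately show "v \<in> H1 (interior T)"
    by (auto simp: H1_def)
qed

lemma P1_lincomb:
  assumes "v \<in> P1 \<T>" "w \<in> P1 \<T>"
  shows "(\<lambda>x. v x + c * w x) \<in> P1 \<T>"
  unfolding P1_def
proof safe
  fix T
  assume T: "T \<in> \<T>"
  obtain a d where v: "\<And>x. x \<in> interior T \<Longrightarrow> v x = a + d \<bullet> x"
    using assms(1) T by (auto simp: P1_def)
  obtain b e where w: "\<And>x. x \<in> interior T \<Longrightarrow> w x = b + e \<bullet> x"
    using assms(2) T by (auto simp: P1_def)
  have "\<forall>x\<in>interior T. v x + c * w x = (a + c * b) + (d + c *\<^sub>R e) \<bullet> x"
    by (simp add: v w inner_add_left algebra_simps)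
  then show "\<exists>a d. \<forall>x\<in>interior T. v x + c * w x = a + d \<bullet> x"
    by blast
qed

lemma P1_scale: "v \<in> P1 \<T> \<Longrightarrow> (\<lambda>x. c * v x) \<in> P1 \<T>"
  using P1_lincomb[of v v "c - 1"] by (simp add: left_diff_distrib)

section \<open>The broken scalar product and its norm\<close>

lemma a_form_inner:
  "a_form \<Omega> \<T> v w = (LINT x:\<Omega>|lebesgue. (v x, grad_NC \<T> v x) \<bullet> (w x, grad_NC \<T> w x))"
  by (simp add: a_form_def)

lemma Y_norm_L2_norm: "Y_norm \<Omega> \<T> v = L2_norm \<Omega> (\<lambda>x. (v x, grad_NC \<T> v x))"
  unfolding Y_norm_def a_form_inner L2_norm_inner by (simp add: L2_norm_nonneg)

lemma Y_norm_nonneg: "0 \<le> Y_norm \<Omega> \<T> v"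
  by (simp add: Y_norm_L2_norm L2_norm_nonneg)

lemma a_form_self: "a_form \<Omega> \<T> v v = (Y_norm \<Omega> \<T> v)\<^sup>2"
  unfolding Y_norm_L2_norm a_form_inner L2_norm_inner ..

lemma a_form_Cauchy_Schwarz:
  assumes "v \<in> broken_H1 \<T>" "w \<in> broken_H1 \<T>"
  shows "\<bar>a_form \<Omega> \<T> v w\<bar> \<le> Y_norm \<Omega> \<T> v * Y_norm \<Omega> \<T> w"
  unfolding Y_norm_L2_norm a_form_inner
  using assms by (intro L2_Cauchy_Schwarz L2_Pair broken_H1_L2 grad_NC_L2)

lemma L2_norm_grad_NC_le:
  assumes v: "v \<in> broken_H1 \<T>"
  shows "L2_norm \<Omega> (grad_NC \<T> v) \<le> Y_norm \<Omega> \<T> v"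
  unfolding Y_norm_L2_norm
  by (rule L2_norm_mono[OF grad_NC_L2[OF v] L2_Pair[OF broken_H1_L2[OF v] grad_NC_L2[OF v]]]) (simp add: norm_Pair)

lemma grad_NC_scale_AE:
  assumes v: "v \<in> broken_H1 \<T>"
  shows "AE x in lebesgue. x \<in> \<Omega> \<longrightarrow> grad_NC \<T> (\<lambda>x. c * v x) x = c *\<^sub>R grad_NC \<T> v x"
proof (rule AE_elements)
  fix T
  assume T: "T \<in> \<T>"
  interpret T: bounded_open_set "interior T"
    by (rule bounded_open_interior[OF T])
  have v: "v \<in> H1 (interior T)"
    by (rule broken_H1_interior[OF v T])
  \<comment> \<open>The multiple \<open>c * v\<close> is read as \<open>v + (c - 1) * v\<close>, the
    shape of the rule for linear combinations.\<close>
  have "AE x in lebesgue. x \<in> interior T \<longrightarrow>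
      grad (interior T) (\<lambda>x. c * v x) x = grad (interior T) v x + (c - 1) *\<^sub>R grad (interior T) v x"
    using T.grad_lincomb_AE[OF v v, of "c - 1"] by (simp add: left_diff_distrib)
  then show "AE x in lebesgue. x \<in> interior T \<longrightarrow> grad_NC \<T> (\<lambda>x. c * v x) x = c *\<^sub>R grad_NC \<T> v x"
    by eventually_elim (auto simp: grad_NC_interior[OF T] scaleR_diff_left)
qed

lemma a_form_scale_right:
  assumes v: "v \<in> broken_H1 \<T>" and w: "w \<in> broken_H1 \<T>"
  shows "a_form \<Omega> \<T> v (\<lambda>x. c * w x) = c * a_form \<Omega> \<T> v w"
proof -
  have "a_form \<Omega> \<T> v (\<lambda>x. c * w x) =
      (LINT x:\<Omega>|lebesgue. c * ((v x, grad_NC \<T> v x) \<bullet> (w x, grad_NC \<T> w x)))"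
    unfolding a_form_inner
  proof (rule set_integral_cong_AE_lebesgue)
    show "AE x in lebesgue. x \<in> \<Omega> \<longrightarrow> (v x, grad_NC \<T> v x) \<bullet> (c * w x, grad_NC \<T> (\<lambda>x. c * w x) x) =
        c * ((v x, grad_NC \<T> v x) \<bullet> (w x, grad_NC \<T> w x))"
      using grad_NC_scale_AE[OF w, of c] by eventually_elim (auto simp: algebra_simps)
  qed
  then show ?thesis
    by (simp add: a_form_inner)
qed

lemma Y_norm_scale:
  assumes v: "v \<in> broken_H1 \<T>"
  shows "Y_norm \<Omega> \<T> (\<lambda>x. c * v x) = \<bar>c\<bar> * Y_norm \<Omega> \<T> v"
proof -
  have "AE x in lebesgue. x \<in> \<Omega> \<longrightarrow>
      (c * v x, grad_NC \<T> (\<lambda>x. c * v x) x) = c *\<^sub>R (v x, grad_NC \<T> v x)"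
    using grad_NC_scale_AE[OF v, of c] by eventually_elim auto
  then have "Y_norm \<Omega> \<T> (\<lambda>x. c * v x) = L2_norm \<Omega> (\<lambda>x. c *\<^sub>R (v x, grad_NC \<T> v x))"
    unfolding Y_norm_L2_norm by (rule L2_norm_cong_AE)
  then show ?thesis
    unfolding L2_norm_scaleR Y_norm_L2_norm .
qed

lemma L2_norm_grad_NC_H1: "v \<in> H1 \<Omega> \<Longrightarrow> L2_norm \<Omega> (grad_NC \<T> v) = L2_norm \<Omega> (grad \<Omega> v)"
  by (intro L2_norm_cong_AE grad_NC_H1_AE)

lemma Y_norm_H1_le:
  assumes v: "v \<in> H1 \<Omega>"
  shows "Y_norm \<Omega> \<T> v \<le> L2_norm \<Omega> v + L2_norm \<Omega> (grad \<Omega> v)"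
proof (rule power2_le_imp_le)
  have "(Y_norm \<Omega> \<T> v)\<^sup>2 = (L2_norm \<Omega> v)\<^sup>2 + (L2_norm \<Omega> (grad \<Omega> v))\<^sup>2"
    unfolding Y_norm_L2_norm L2_norm_grad_NC_H1[OF v, symmetric]
    by (intro L2_norm_Pair broken_H1_L2 grad_NC_L2 H1_broken_H1 v)
  then show "(Y_norm \<Omega> \<T> v)\<^sup>2 \<le> (L2_norm \<Omega> v + L2_norm \<Omega> (grad \<Omega> v))\<^sup>2"
    by (simp add: power2_sum L2_norm_nonneg)
qed (simp add: L2_norm_nonneg)

section \<open>Normal traces and the skeleton pairing\<close>

lemma H_div_interior:
  assumes q: "q \<in> H_div \<Omega>" and T: "T \<in> \<T>"
  shows "q \<in> H_div (interior T)"
    and "AE x in lebesgue. x \<in> interior T \<longrightarrow> dvg (interior T) q x = dvg \<Omega> q x"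
proof -
  interpret T: bounded_open_set "interior T"
    by (rule bounded_open_interior[OF T])
  have w: "weak_divergence (interior T) q (dvg \<Omega> q)" "q \<in> L2 (interior T)"
    by (intro weak_divergence_subset[OF dvg_weak_divergence[OF q]] L2_subset[OF H_div_L2[OF q]]
        sets_interior interior_subset_\<Omega> T)+
  then show "q \<in> H_div (interior T)"
    by (auto simp: H_div_def)
  show "AE x in lebesgue. x \<in> interior T \<longrightarrow> dvg (interior T) q x = dvg \<Omega> q x"
    by (rule T.dvg_AE[OF w])
qed

text \<open>Each normal trace is a volume integral over its element. The divergence of
  \<open>q\<close> restricts to the elements up to null sets, so the sum becomes one integral over
  \<open>\<Omega>\<close>, even for discontinuous \<open>v\<close>.\<close>

lemma skeleton_pairing_eq:
  assumes q: "q \<in> H_div \<Omega>" "has_normal_traces \<T> q t" and v: "v \<in> broken_H1 \<T>"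
  shows "skeleton_pairing \<T> t v = (LINT x:\<Omega>|lebesgue. q x \<bullet> grad_NC \<T> v x + dvg \<Omega> q x * v x)"
proof -
  have L: "set_integrable lebesgue \<Omega> (\<lambda>x. q x \<bullet> grad_NC \<T> v x + dvg \<Omega> q x * v x)"
    by (intro set_integral_add set_integrable_inner_L2 set_integrable_mult_L2 H_div_L2 dvg_L2 q(1)
        broken_H1_L2 grad_NC_L2 v)
  have "t T v = (LINT x:interior T|lebesgue. q x \<bullet> grad_NC \<T> v x + dvg \<Omega> q x * v x)" if T: "T \<in> \<T>" for T
  proof -
    have "t T v = normal_trace q T v"
      using q(2) broken_H1_interior[OF v T] T by (simp add: has_normal_traces_def)
    also have "\<dots> = (LINT x:interior T|lebesgue. q x \<bullet> grad_NC \<T> v x + dvg \<Omega> q x * v x)"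
      unfolding normal_trace_def
    proof (rule set_integral_cong_AE_lebesgue)
      show "AE x in lebesgue. x \<in> interior T \<longrightarrow>
          q x \<bullet> grad (interior T) v x + dvg (interior T) q x * v x = q x \<bullet> grad_NC \<T> v x + dvg \<Omega> q x * v x"
        using H_div_interior(2)[OF q(1) T] by eventually_elim (auto simp: grad_NC_interior[OF T])
    qed
    finally show ?thesis .
  qed
  then have "skeleton_pairing \<T> t v =
      (\<Sum>T\<in>\<T>. LINT x:interior T|lebesgue. q x \<bullet> grad_NC \<T> v x + dvg \<Omega> q x * v x)"
    by (simp add: skeleton_pairing_def)
  also have "\<dots> = (LINT x:\<Omega>|lebesgue. q x \<bullet> grad_NC \<T> v x + dvg \<Omega> q x * v x)"
    by (intro set_integral_elements[symmetric] set_integrable_subset[OF L] sets_interior interior_subset_\<Omega>)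
  finally show ?thesis .
qed

lemma skeleton_pairing_H1_0:
  assumes t: "t \<in> H_minus_half_skeleton \<Omega> \<T>" and v: "v \<in> H1_0 \<Omega>"
  shows "skeleton_pairing \<T> t v = 0"
proof -
  obtain q where q: "q \<in> H_div \<Omega>" "has_normal_traces \<T> q t"
    using t by (auto simp: H_minus_half_skeleton_def)
  have "skeleton_pairing \<T> t v = (LINT x:\<Omega>|lebesgue. q x \<bullet> grad_NC \<T> v x + dvg \<Omega> q x * v x)"
    by (rule skeleton_pairing_eq[OF q H1_broken_H1[OF H1_0_H1[OF v]]])
  also have "\<dots> = (LINT x:\<Omega>|lebesgue. q x \<bullet> grad \<Omega> v x + dvg \<Omega> q x * v x)"
  proof (rule set_integral_cong_AE_lebesgue)
    show "AE x in lebesgue. x \<in> \<Omega> \<longrightarrow>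
        q x \<bullet> grad_NC \<T> v x + dvg \<Omega> q x * v x = q x \<bullet> grad \<Omega> v x + dvg \<Omega> q x * v x"
      using grad_NC_H1_AE[OF H1_0_H1[OF v]] by eventually_elim auto
  qed
  also have "\<dots> = 0"
    by (rule Gauss_H1_0[OF q(1) v])
  finally show ?thesis .
qed

text \<open>Guarantees that the infimum in \<open>skeleton_norm\<close> of a difference of two
  traces runs over a nonempty set.\<close>

lemma has_normal_traces_diff:
  assumes q: "q \<in> H_div \<Omega>" "has_normal_traces \<T> q t" and r: "r \<in> H_div \<Omega>" "has_normal_traces \<T> r s"
  shows "has_normal_traces \<T> (\<lambda>x. q x - r x) (\<lambda>T v. t T v - s T v)"
  unfolding has_normal_traces_def
proof (intro ballI)
  fix T v
  assume T: "T \<in> \<T>" and v: "v \<in> H1 (interior T)"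
  interpret T: bounded_open_set "interior T"
    by (rule bounded_open_interior[OF T])
  let ?i = "\<lambda>q x. q x \<bullet> grad (interior T) v x + dvg (interior T) q x * v x"
  have qT: "q \<in> H_div (interior T)" and rT: "r \<in> H_div (interior T)"
    by (intro H_div_interior q r T)+
  have "normal_trace (\<lambda>x. q x - r x) T v = (LINT x:interior T|lebesgue. ?i q x - ?i r x)"
    unfolding normal_trace_def
  proof (rule set_integral_cong_AE_lebesgue)
    show "AE x in lebesgue. x \<in> interior T \<longrightarrow> (q x - r x) \<bullet> grad (interior T) v x +
        dvg (interior T) (\<lambda>x. q x - r x) x * v x = ?i q x - ?i r x"
      using T.dvg_diff_AE[OF qT rT] by eventually_elim (auto simp: inner_diff_left left_diff_distrib)
  qed
  also have "\<dots> = normal_trace q T v - normal_trace r T v"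
    unfolding normal_trace_def
    by (intro set_integral_diff(2) set_integral_add set_integrable_inner_L2 set_integrable_mult_L2
        H_div_L2 dvg_L2 qT rT H1_L2 grad_L2 v)
  finally show "t T v - s T v = normal_trace (\<lambda>x. q x - r x) T v"
    using q(2) r(2) T v by (simp add: has_normal_traces_def)
qed

text \<open>The left-hand side depends on \<open>t\<close> alone, so Cauchy-Schwarz holds for every
  extension \<open>r\<close> of \<open>t\<close>, and the infimum over \<open>r\<close> may be
  taken. The given \<open>q\<close> shows that there is an extension.\<close>

lemma skeleton_pairing_le:
  assumes q: "q \<in> H_div \<Omega>" "has_normal_traces \<T> q t" and v: "v \<in> broken_H1 \<T>"
  shows "\<bar>skeleton_pairing \<T> t v\<bar> \<le> skeleton_norm \<Omega> \<T> t * Y_norm \<Omega> \<T> v"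
proof (cases "Y_norm \<Omega> \<T> v = 0")
  case False
  then have Y: "Y_norm \<Omega> \<T> v > 0"
    using Y_norm_nonneg[of v] by simp
  have *: "\<bar>skeleton_pairing \<T> t v\<bar> \<le> H_div_norm \<Omega> r * Y_norm \<Omega> \<T> v"
    if r: "r \<in> H_div \<Omega>" "has_normal_traces \<T> r t" for r
  proof -
    have L: "r \<in> L2 \<Omega>" "dvg \<Omega> r \<in> L2 \<Omega>" "v \<in> L2 \<Omega>" "grad_NC \<T> v \<in> L2 \<Omega>"
      by (intro H_div_L2 dvg_L2 r(1) broken_H1_L2 grad_NC_L2 v)+
    have "L2_norm \<Omega> (\<lambda>x. (grad_NC \<T> v x, v x)) = Y_norm \<Omega> \<T> v"
      unfolding Y_norm_L2_norm L2_norm_def by (simp add: norm_Pair add.commute)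
    moreover have "skeleton_pairing \<T> t v =
        (LINT x:\<Omega>|lebesgue. (r x, dvg \<Omega> r x) \<bullet> (grad_NC \<T> v x, v x))"
      using skeleton_pairing_eq[OF r v] by simp
    ultimately show ?thesis
      using L2_Cauchy_Schwarz[OF L2_Pair[OF L(1,2)] L2_Pair[OF L(4,3)]] by (simp add: H_div_norm_eq[OF r(1)])
  qed
  \<comment> \<open>After division by the positive norm of \<open>v\<close> the left-hand side is a
    plain lower bound for the set of extension norms.\<close>
  have "\<bar>skeleton_pairing \<T> t v\<bar> / Y_norm \<Omega> \<T> v \<le> skeleton_norm \<Omega> \<T> t"
    unfolding skeleton_norm_def
    by (rule cINF_greatest) (use q * Y in \<open>auto simp: divide_le_eq\<close>)
  with Y show ?thesis
    by (simp add: divide_le_eq)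
next
  \<comment> \<open>Division is impossible here, but Cauchy-Schwarz for the single extension
    \<open>q\<close> already makes the pairing vanish.\<close>
  case True
  have L: "q \<in> L2 \<Omega>" "dvg \<Omega> q \<in> L2 \<Omega>" "v \<in> L2 \<Omega>" "grad_NC \<T> v \<in> L2 \<Omega>"
    by (intro H_div_L2 dvg_L2 q(1) broken_H1_L2 grad_NC_L2 v)+
  have "L2_norm \<Omega> (\<lambda>x. (grad_NC \<T> v x, v x)) = Y_norm \<Omega> \<T> v"
    unfolding Y_norm_L2_norm L2_norm_def by (simp add: norm_Pair add.commute)
  then show ?thesis
    using L2_Cauchy_Schwarz[OF L2_Pair[OF L(1,2)] L2_Pair[OF L(4,3)]] True skeleton_pairing_eq[OF q v] by simp
qed

lemma skeleton_norm_nonneg: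
  assumes "q \<in> H_div \<Omega>" "has_normal_traces \<T> q t"
  shows "0 \<le> skeleton_norm \<Omega> \<T> t"
  unfolding skeleton_norm_def
  by (rule cINF_greatest) (use assms in \<open>auto simp: H_div_norm_def\<close>)

section \<open>Quasi-best approximation\<close>

lemma sigma_map_integral_diff_le:
  assumes nl: "nonlinearity \<gamma>\<^sub>1 \<gamma>\<^sub>2 \<phi>" and \<gamma>: "0 < \<gamma>\<^sub>1"
    and u: "u \<in> H1 \<Omega>" and w: "w \<in> H1 \<Omega>" and \<eta>: "\<eta> \<in> broken_H1 \<T>"
  shows "(LINT x:\<Omega>|lebesgue. sigma_map \<phi> (grad \<Omega> u x) \<bullet> grad_NC \<T> \<eta> x) -
      (LINT x:\<Omega>|lebesgue. sigma_map \<phi> (grad \<Omega> w x) \<bullet> grad_NC \<T> \<eta> x)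
    \<le> \<gamma>\<^sub>2 * L2_norm \<Omega> (grad \<Omega> (\<lambda>x. u x - w x)) * L2_norm \<Omega> (grad_NC \<T> \<eta>)"
proof -
  let ?s = "\<lambda>u x. sigma_map \<phi> (grad \<Omega> u x)"
  have \<gamma>2: "\<gamma>\<^sub>2 \<ge> 0"
    using nl \<gamma> unfolding nonlinearity_def by (meson less_imp_le order_refl order_trans)
  have L: "?s u \<in> L2 \<Omega>" "?s w \<in> L2 \<Omega>" "grad_NC \<T> \<eta> \<in> L2 \<Omega>"
    by (intro L2_sigma_map[OF nl \<gamma>] grad_L2 u w grad_NC_L2 \<eta>)+
  have "(LINT x:\<Omega>|lebesgue. ?s u x \<bullet> grad_NC \<T> \<eta> x) - (LINT x:\<Omega>|lebesgue. ?s w x \<bullet> grad_NC \<T> \<eta> x) =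
      (LINT x:\<Omega>|lebesgue. (?s u x - ?s w x) \<bullet> grad_NC \<T> \<eta> x)"
    using L by (simp add: inner_diff_left set_integral_diff set_integrable_inner_L2)
  also have "\<dots> \<le> L2_norm \<Omega> (\<lambda>x. ?s u x - ?s w x) * L2_norm \<Omega> (grad_NC \<T> \<eta>)"
    using L2_Cauchy_Schwarz[OF L2_diff[OF L(1,2)] L(3)] by simp
  also have "\<dots> \<le> \<gamma>\<^sub>2 * L2_norm \<Omega> (grad \<Omega> (\<lambda>x. u x - w x)) * L2_norm \<Omega> (grad_NC \<T> \<eta>)"
  proof (rule mult_right_mono)
    have "L2_norm \<Omega> (\<lambda>x. ?s u x - ?s w x) \<le> L2_norm \<Omega> (\<lambda>x. \<gamma>\<^sub>2 *\<^sub>R (grad \<Omega> u x - grad \<Omega> w x))"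
      by (intro L2_norm_mono L2_diff L2_scaleR L grad_L2 u w)
        (use sigma_map_lipschitz[OF nl \<gamma>] \<gamma>2 in simp)
    then show "L2_norm \<Omega> (\<lambda>x. ?s u x - ?s w x) \<le> \<gamma>\<^sub>2 * L2_norm \<Omega> (grad \<Omega> (\<lambda>x. u x - w x))"
      using \<gamma>2 by (simp only: L2_norm_scaleR L2_norm_grad_diff[OF u w] abs_of_nonneg)
  qed (rule L2_norm_nonneg)
  finally show ?thesis .
qed

text \<open>Integrated strong monotonicity, with the test gradient written as \<open>grad_NC\<close>
  so that the integrals are those of \<open>b_form\<close>.\<close>

lemma sigma_map_integral_monotone:
  assumes nl: "nonlinearity \<gamma>\<^sub>1 \<gamma>\<^sub>2 \<phi>" and \<gamma>: "0 < \<gamma>\<^sub>1" and u: "u \<in> H1 \<Omega>" and w: "w \<in> H1 \<Omega>"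
  shows "\<gamma>\<^sub>1 * (L2_norm \<Omega> (grad \<Omega> (\<lambda>x. u x - w x)))\<^sup>2 \<le>
    (LINT x:\<Omega>|lebesgue. sigma_map \<phi> (grad \<Omega> u x) \<bullet> grad_NC \<T> (\<lambda>x. u x - w x) x) -
    (LINT x:\<Omega>|lebesgue. sigma_map \<phi> (grad \<Omega> w x) \<bullet> grad_NC \<T> (\<lambda>x. u x - w x) x)"
proof -
  let ?s = "\<lambda>u x. sigma_map \<phi> (grad \<Omega> u x)" and ?d = "\<lambda>x. u x - w x"
  have L: "?s u \<in> L2 \<Omega>" "?s w \<in> L2 \<Omega>" "grad_NC \<T> ?d \<in> L2 \<Omega>" "(\<lambda>x. grad \<Omega> u x - grad \<Omega> w x) \<in> L2 \<Omega>"
    by (intro L2_sigma_map[OF nl \<gamma>] L2_diff grad_L2 u w grad_NC_L2 H1_broken_H1 H1_diff)+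
  have "\<gamma>\<^sub>1 * (L2_norm \<Omega> (grad \<Omega> ?d))\<^sup>2 = (LINT x:\<Omega>|lebesgue. \<gamma>\<^sub>1 * (norm (grad \<Omega> u x - grad \<Omega> w x))\<^sup>2)"
    by (simp add: L2_norm_grad_diff[OF u w] L2_norm_power2)
  also have "\<dots> \<le> (LINT x:\<Omega>|lebesgue. (?s u x - ?s w x) \<bullet> (grad \<Omega> u x - grad \<Omega> w x))"
    by (intro set_integral_mono set_integrable_mult_right set_integrable_norm_L2 set_integrable_inner_L2
        L2_diff L sigma_map_monotone[OF nl \<gamma>])
  also have "\<dots> = (LINT x:\<Omega>|lebesgue. ?s u x \<bullet> grad_NC \<T> ?d x - ?s w x \<bullet> grad_NC \<T> ?d x)"
  proof (rule set_integral_cong_AE_lebesgue)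
    show "AE x in lebesgue. x \<in> \<Omega> \<longrightarrow> (?s u x - ?s w x) \<bullet> (grad \<Omega> u x - grad \<Omega> w x) =
        ?s u x \<bullet> grad_NC \<T> ?d x - ?s w x \<bullet> grad_NC \<T> ?d x"
      using grad_NC_H1_AE[OF H1_diff[OF u w]] grad_diff_AE[OF u w]
      by eventually_elim (auto simp: inner_diff_left)
  qed
  also have "\<dots> = (LINT x:\<Omega>|lebesgue. ?s u x \<bullet> grad_NC \<T> ?d x) - (LINT x:\<Omega>|lebesgue. ?s w x \<bullet> grad_NC \<T> ?d x)"
    by (intro set_integral_diff(2) set_integrable_inner_L2 L)
  finally show ?thesis .
qed

text \<open>The competitor is fixed here; the infima are taken at the end. In the constant, 1 comes
  from the triangle inequality, \<open>\<gamma>\<^sub>2 + 1\<close> from the bound for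
  \<open>v\<^sub>h\<close>, and the quotient from monotonicity; \<open>K + 1\<close> converts the
  broken norm of a conforming function into the norm of its gradient.\<close>

lemma quasi_best_approximation:
  assumes nl: "nonlinearity \<gamma>\<^sub>1 \<gamma>\<^sub>2 \<phi>" and \<gamma>: "0 < \<gamma>\<^sub>1"
    and K: "K > 0" "\<And>v. v \<in> H1_0 \<Omega> \<Longrightarrow> L2_norm \<Omega> v \<le> K * L2_norm \<Omega> (grad \<Omega> v)"
    and u: "u \<in> H1_0 \<Omega>" and t: "t \<in> H_minus_half_skeleton \<Omega> \<T>"
    and sol: "\<And>v. v \<in> broken_H1 \<T> \<Longrightarrow> b_form \<phi> \<Omega> \<T> u t v = load \<Omega> f v"
    and argmin: "is_arg_min (\<lambda>(w, s). Yh_dual_norm \<Omega> \<T> (residual \<phi> \<Omega> \<T> f w s))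
      (\<lambda>(w, s). w \<in> S1_0 \<Omega> \<T> \<and> s \<in> P0_sides \<Omega> \<T> \<nu>) (u\<^sub>h, t\<^sub>h)"
    and vh: "v\<^sub>h \<in> P1 \<T>"
    and riesz: "\<And>\<eta>. \<eta> \<in> P1 \<T> \<Longrightarrow> a_form \<Omega> \<T> v\<^sub>h \<eta> = residual \<phi> \<Omega> \<T> f u\<^sub>h t\<^sub>h \<eta>"
    and uC: "u\<^sub>C \<in> S1_0 \<Omega> \<T>" and t0: "t\<^sub>0 \<in> P0_sides \<Omega> \<T> \<nu>"
  shows "L2_norm \<Omega> (grad \<Omega> (\<lambda>x. u x - u\<^sub>h x)) + Y_norm \<Omega> \<T> v\<^sub>h
    \<le> (2 + \<gamma>\<^sub>2 + ((K + 1) * (\<gamma>\<^sub>2 + 1) + \<gamma>\<^sub>2) / \<gamma>\<^sub>1) *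
      (L2_norm \<Omega> (grad \<Omega> (\<lambda>x. u x - u\<^sub>C x)) + skeleton_norm \<Omega> \<T> (\<lambda>T v. t T v - t\<^sub>0 T v))"
proof -
  define e where "e = L2_norm \<Omega> (grad \<Omega> (\<lambda>x. u x - u\<^sub>C x))"
  define \<tau> where "\<tau> = (\<lambda>T v. t T v - t\<^sub>0 T v)"
  define s where "s = skeleton_norm \<Omega> \<T> \<tau>"
  define y where "y = Y_norm \<Omega> \<T> v\<^sub>h"
  let ?B = "\<lambda>u \<eta>. LINT x:\<Omega>|lebesgue. sigma_map \<phi> (grad \<Omega> u x) \<bullet> grad_NC \<T> \<eta> x"
  have uh: "u\<^sub>h \<in> S1_0 \<Omega> \<T>" and th: "t\<^sub>h \<in> P0_sides \<Omega> \<T> \<nu>"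
    and min: "Yh_dual_norm \<Omega> \<T> (residual \<phi> \<Omega> \<T> f u\<^sub>h t\<^sub>h) \<le> Yh_dual_norm \<Omega> \<T> (residual \<phi> \<Omega> \<T> f u\<^sub>C t\<^sub>0)"
    using argmin uC t0 by (auto simp: is_arg_min_def not_less)
  have H: "u \<in> H1 \<Omega>" "u\<^sub>h \<in> H1 \<Omega>" "u\<^sub>C \<in> H1 \<Omega>"
    using u uh uC by (auto simp: S1_0_def H1_0_H1)
  have t': "t\<^sub>h \<in> H_minus_half_skeleton \<Omega> \<T>" "t\<^sub>0 \<in> H_minus_half_skeleton \<Omega> \<T>"
    using th t0 by (auto simp: P0_sides_def)
  have \<gamma>2: "\<gamma>\<^sub>2 \<ge> 0"
    using nl \<gamma> unfolding nonlinearity_def by (meson less_imp_le order_refl order_trans)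
  obtain q where q: "q \<in> H_div \<Omega>" "has_normal_traces \<T> q \<tau>"
  proof -
    obtain q r where "q \<in> H_div \<Omega>" "has_normal_traces \<T> q t" "r \<in> H_div \<Omega>" "has_normal_traces \<T> r t\<^sub>0"
      using t t'(2) by (auto simp: H_minus_half_skeleton_def)
    then show ?thesis
      using that[of "\<lambda>x. q x - r x"] has_normal_traces_diff H_div_diff by (simp add: \<tau>_def)
  qed
  have s0: "s \<ge> 0" and e0: "e \<ge> 0" and y0: "y \<ge> 0"
    using skeleton_norm_nonneg[OF q] by (simp_all add: s_def e_def y_def L2_norm_nonneg Y_norm_nonneg)
  \<comment> \<open>The equation for \<open>(u, t)\<close> eliminates the load, leaving differences
    of fluxes and of skeleton pairings.\<close>
  have res: "residual \<phi> \<Omega> \<T> f w r \<eta> = ?B u \<eta> - ?B w \<eta> - (skeleton_pairing \<T> t \<eta> - skeleton_pairing \<T> r \<eta>)"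
    if "\<eta> \<in> P1 \<T>" for w r \<eta>
    using sol[OF P1_broken_H1[OF that]] by (simp add: residual_def b_form_def)
  have res_le: "residual \<phi> \<Omega> \<T> f u\<^sub>C t\<^sub>0 \<eta> \<le> (\<gamma>\<^sub>2 * e + s) * Y_norm \<Omega> \<T> \<eta>" if \<eta>: "\<eta> \<in> P1 \<T>" for \<eta>
  proof -
    have "skeleton_pairing \<T> t \<eta> - skeleton_pairing \<T> t\<^sub>0 \<eta> = skeleton_pairing \<T> \<tau> \<eta>"
      by (simp add: skeleton_pairing_def \<tau>_def sum_subtractf)
    then have "residual \<phi> \<Omega> \<T> f u\<^sub>C t\<^sub>0 \<eta> \<le> \<gamma>\<^sub>2 * e * L2_norm \<Omega> (grad_NC \<T> \<eta>) + s * Y_norm \<Omega> \<T> \<eta>"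
      using sigma_map_integral_diff_le[OF nl \<gamma> H(1,3) P1_broken_H1[OF \<eta>]] skeleton_pairing_le[OF q P1_broken_H1[OF \<eta>]] res[OF \<eta>]
      by (simp add: e_def s_def)
    also have "\<gamma>\<^sub>2 * e * L2_norm \<Omega> (grad_NC \<T> \<eta>) \<le> \<gamma>\<^sub>2 * e * Y_norm \<Omega> \<T> \<eta>"
      using L2_norm_grad_NC_le[OF P1_broken_H1[OF \<eta>]] \<gamma>2 e0 by (intro mult_left_mono) auto
    finally show ?thesis
      by (simp add: distrib_right)
  qed
  have y_le: "y \<le> \<gamma>\<^sub>2 * e + s"
  proof (cases "y = 0")
    case True
    then show ?thesis
      using \<gamma>2 e0 s0 by simp
  next
    case False
    then have y: "y > 0"
      using y0 by simp
    \<comment> \<open>The normalized Riesz representative realizes the value \<open>y\<close> of the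
      discrete dual norm; only this lower bound for the supremum is used.\<close>
    let ?\<eta> = "\<lambda>x. (1 / y) * v\<^sub>h x"
    have \<eta>: "?\<eta> \<in> {v \<in> P1 \<T>. Y_norm \<Omega> \<T> v \<le> 1}"
      using P1_scale[OF vh, of "1 / y"] Y_norm_scale[OF P1_broken_H1[OF vh], of "1 / y"] y
      by (simp add: y_def)
    have "y = a_form \<Omega> \<T> v\<^sub>h ?\<eta>"
      using y unfolding a_form_scale_right[OF P1_broken_H1[OF vh] P1_broken_H1[OF vh]]
      by (simp add: a_form_self y_def power2_eq_square)
    also have "\<dots> = residual \<phi> \<Omega> \<T> f u\<^sub>h t\<^sub>h ?\<eta>"
      using \<eta> by (intro riesz) auto
    also have "\<dots> \<le> Yh_dual_norm \<Omega> \<T> (residual \<phi> \<Omega> \<T> f u\<^sub>h t\<^sub>h)"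
      unfolding Yh_dual_norm_def
    proof (rule cSUP_upper[OF \<eta>])
      \<comment> \<open>A real supremum bounds its members only if the set is bounded above; the
        Riesz identity and Cauchy-Schwarz supply the bound \<open>y\<close>.\<close>
      show "bdd_above (residual \<phi> \<Omega> \<T> f u\<^sub>h t\<^sub>h ` {v \<in> P1 \<T>. Y_norm \<Omega> \<T> v \<le> 1})"
      proof (rule bdd_aboveI2)
        fix v
        assume v: "v \<in> {v \<in> P1 \<T>. Y_norm \<Omega> \<T> v \<le> 1}"
        then have "\<bar>a_form \<Omega> \<T> v\<^sub>h v\<bar> \<le> y * Y_norm \<Omega> \<T> v"
          unfolding y_def by (intro a_form_Cauchy_Schwarz P1_broken_H1 vh) auto
        also have "\<dots> \<le> y"
          using v y0 by (intro mult_left_le) auto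
        finally show "residual \<phi> \<Omega> \<T> f u\<^sub>h t\<^sub>h v \<le> y"
          using riesz[of v] v by simp
      qed
    qed
    also have "\<dots> \<le> Yh_dual_norm \<Omega> \<T> (residual \<phi> \<Omega> \<T> f u\<^sub>C t\<^sub>0)"
      by (rule min)
    also have "\<dots> \<le> \<gamma>\<^sub>2 * e + s"
      unfolding Yh_dual_norm_def
    proof (rule cSUP_least)
      show "{v \<in> P1 \<T>. Y_norm \<Omega> \<T> v \<le> 1} \<noteq> {}"
        using \<eta> by blast
      fix v
      assume v: "v \<in> {v \<in> P1 \<T>. Y_norm \<Omega> \<T> v \<le> 1}"
      then have "residual \<phi> \<Omega> \<T> f u\<^sub>C t\<^sub>0 v \<le> (\<gamma>\<^sub>2 * e + s) * Y_norm \<Omega> \<T> v"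
        by (intro res_le) auto
      also have "\<dots> \<le> \<gamma>\<^sub>2 * e + s"
        using v \<gamma>2 e0 s0 by (intro mult_left_le) auto
      finally show "residual \<phi> \<Omega> \<T> f u\<^sub>C t\<^sub>0 v \<le> \<gamma>\<^sub>2 * e + s" .
    qed
    finally show ?thesis .
  qed
  define w where "w x = u\<^sub>h x - u\<^sub>C x" for x
  define g where "g = L2_norm \<Omega> (grad \<Omega> w)"
  have w: "w \<in> H1_0 \<Omega>" "w \<in> P1 \<T>"
    using H1_0_diff[of u\<^sub>h u\<^sub>C] P1_lincomb[of u\<^sub>h u\<^sub>C "-1"] uh uC by (simp_all add: w_def[abs_def] S1_0_def)
  have g0: "g \<ge> 0"
    by (simp add: g_def L2_norm_nonneg)
  have gNC: "L2_norm \<Omega> (grad_NC \<T> w) = g"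
    unfolding g_def by (rule L2_norm_grad_NC_H1[OF H1_0_H1[OF w(1)]])
  have Yw: "Y_norm \<Omega> \<T> w \<le> (K + 1) * g"
    using Y_norm_H1_le[OF H1_0_H1[OF w(1)]] K(2)[OF w(1)] by (simp add: g_def distrib_right)
  have "\<gamma>\<^sub>1 * g\<^sup>2 \<le> ?B u\<^sub>h w - ?B u\<^sub>C w"
    using sigma_map_integral_monotone[OF nl \<gamma> H(2,3)] by (simp add: g_def w_def[abs_def])
  \<comment> \<open>Both skeleton pairings vanish on \<open>w\<close>, so the Riesz identity reads
    \<open>a_form \<Omega> \<T> v\<^sub>h w = ?B u w - ?B u\<^sub>h w\<close>; the flux of
    \<open>u\<close> is inserted between the two given ones.\<close>
  also have "\<dots> = - a_form \<Omega> \<T> v\<^sub>h w + (?B u w - ?B u\<^sub>C w)"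
    using riesz[OF w(2)] res[OF w(2)] skeleton_pairing_H1_0[OF t w(1)] skeleton_pairing_H1_0[OF t'(1) w(1)]
    by simp
  also have "\<dots> \<le> y * Y_norm \<Omega> \<T> w + \<gamma>\<^sub>2 * e * g"
    using a_form_Cauchy_Schwarz[OF P1_broken_H1[OF vh] P1_broken_H1[OF w(2)]]
      sigma_map_integral_diff_le[OF nl \<gamma> H(1,3) P1_broken_H1[OF w(2)]] gNC by (simp add: y_def e_def)
  also have "\<dots> \<le> (\<gamma>\<^sub>2 * e + s) * ((K + 1) * g) + \<gamma>\<^sub>2 * e * g"
    using y_le Yw \<gamma>2 e0 s0 by (intro add_right_mono mult_mono) (auto simp: Y_norm_nonneg)
  finally have "g * (\<gamma>\<^sub>1 * g) \<le> g * ((K + 1) * (\<gamma>\<^sub>2 * e + s) + \<gamma>\<^sub>2 * e)"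
    by (simp add: power2_eq_square algebra_simps)
  \<comment> \<open>Cancelling the factor \<open>g\<close> requires \<open>g > 0\<close>; for
    \<open>g = 0\<close> the claim is this nonnegativity.\<close>
  moreover have r0: "0 \<le> (K + 1) * (\<gamma>\<^sub>2 * e + s) + \<gamma>\<^sub>2 * e"
    using \<gamma>2 e0 s0 K(1) by simp
  ultimately have "\<gamma>\<^sub>1 * g \<le> (K + 1) * (\<gamma>\<^sub>2 * e + s) + \<gamma>\<^sub>2 * e"
    using g0 by (cases "g = 0") (auto simp: mult_le_cancel_left)
  \<comment> \<open>The coefficient of \<open>e\<close> is
    \<open>(K + 1) * \<gamma>\<^sub>2 + \<gamma>\<^sub>2\<close> and that of \<open>s\<close> is
    \<open>K + 1\<close>; the new factor dominates both.\<close>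
  also have "\<dots> \<le> ((K + 1) * (\<gamma>\<^sub>2 + 1) + \<gamma>\<^sub>2) * (e + s)"
    using \<gamma>2 e0 s0 K(1) by (simp add: algebra_simps)
  finally have g_le: "g \<le> ((K + 1) * (\<gamma>\<^sub>2 + 1) + \<gamma>\<^sub>2) / \<gamma>\<^sub>1 * (e + s)"
    using \<gamma> by (simp add: field_simps)
  have "L2_norm \<Omega> (grad \<Omega> (\<lambda>x. u x - u\<^sub>h x)) \<le> e + g"
  proof -
    have "(\<lambda>x. grad \<Omega> u x - grad \<Omega> u\<^sub>h x) =
        (\<lambda>x. (grad \<Omega> u x - grad \<Omega> u\<^sub>C x) - (grad \<Omega> u\<^sub>h x - grad \<Omega> u\<^sub>C x))"
      by simp
    then show ?thesis
      unfolding e_def g_def w_def[abs_def] L2_norm_grad_diff[OF H(1,2)] L2_norm_grad_diff[OF H(1,3)]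
        L2_norm_grad_diff[OF H(2,3)]
      using L2_norm_triangle_minus[OF L2_diff L2_diff, OF grad_L2 grad_L2 grad_L2 grad_L2, OF H(1,3) H(2,3)]
      by simp
  qed
  moreover have "y \<le> (\<gamma>\<^sub>2 + 1) * (e + s)"
    using y_le mult_nonneg_nonneg[OF \<gamma>2 s0] e0 by (simp add: algebra_simps)
  ultimately have "L2_norm \<Omega> (grad \<Omega> (\<lambda>x. u x - u\<^sub>h x)) + y
      \<le> (e + s) + ((K + 1) * (\<gamma>\<^sub>2 + 1) + \<gamma>\<^sub>2) / \<gamma>\<^sub>1 * (e + s) + (\<gamma>\<^sub>2 + 1) * (e + s)"
    using g_le s0 by linarith
  also have "\<dots> = (2 + \<gamma>\<^sub>2 + ((K + 1) * (\<gamma>\<^sub>2 + 1) + \<gamma>\<^sub>2) / \<gamma>\<^sub>1) * (e + s)"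
    by (simp add: distrib_right)
  finally show ?thesis
    by (simp add: y_def e_def s_def \<tau>_def)
qed

end

section \<open>From regular triangulations to the abstract mesh\<close>

text \<open>The Lipschitz condition excludes slits: just above a boundary point lies the exterior.\<close>

lemma interior_closure_lipschitz:
  assumes "open \<Omega>" "lipschitz_boundary \<Omega>"
  shows "interior (closure \<Omega>) = \<Omega>"
proof
  show "\<Omega> \<subseteq> interior (closure \<Omega>)"
    using assms(1) closure_subset by (rule interior_maximal[rotated])
  show "interior (closure \<Omega>) \<subseteq> \<Omega>"
  proof
    fix x
    assume x: "x \<in> interior (closure \<Omega>)"
    show "x \<in> \<Omega>"
    proof (rule ccontr)
      assume nx: "x \<notin> \<Omega>"
      then have "x \<in> frontier \<Omega>"
        using x interior_subset[of "closure \<Omega>"] interior_open[OF assms(1)] by (auto simp: frontier_def)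
      then obtain e r h L and g :: "'a \<Rightarrow> real" where e: "norm e = 1" "r > 0" "h > 0"
        and L: "L-lipschitz_on UNIV g"
        and graph: "\<And>z. norm (z - (z \<bullet> e) *\<^sub>R e) < r \<Longrightarrow> \<bar>z \<bullet> e\<bar> < h \<Longrightarrow>
          (x + z \<in> \<Omega> \<longleftrightarrow> z \<bullet> e < g (z - (z \<bullet> e) *\<^sub>R e))"
        using assms(2) unfolding lipschitz_boundary_def by meson
      have ee: "e \<bullet> e = 1"
        using e(1) by (simp add: norm_eq_1)
      \<comment> \<open>The boundary point itself is not in \<open>\<Omega>\<close>, which the chart
        at \<open>z = 0\<close> expresses as a sign of \<open>g 0\<close>.\<close>
      have g0: "g 0 \<le> 0"
        using graph[of 0] e nx by simp
      have cont: "continuous_on UNIV g"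
        using L by (rule lipschitz_on_continuous_on)
      let ?p = "\<lambda>z. z - (z \<bullet> e) *\<^sub>R e"
      \<comment> \<open>The part of the chart strictly above the graph. Its translate is open and
        misses \<open>\<Omega>\<close>, hence also misses the closure.\<close>
      define U where "U = {z. norm (?p z) < r} \<inter> {z. \<bar>z \<bullet> e\<bar> < h} \<inter> {z. g (?p z) < z \<bullet> e}"
      have "open U"
        unfolding U_def
        by (intro open_Int open_Collect_less continuous_intros continuous_on_compose2[OF cont]) auto
      then have V: "open ((+) x ` U)"
        by (rule open_translation)
      have "(+) x ` U \<inter> \<Omega> = {}"
        using graph by (force simp: U_def)
      then have disj: "(+) x ` U \<inter> closure \<Omega> = {}"
        using V by (simp add: open_Int_closure_eq_empty)
      obtain d where d: "d > 0" "ball x d \<subseteq> closure \<Omega>"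
        using x by (auto simp: mem_interior)
      \<comment> \<open>Small enough for the chart and for the ball around \<open>x\<close>. On the
        axis the projection is zero, and \<open>g 0 \<le> 0 < c\<close> puts the point above the
        graph.\<close>
      define c where "c = min d h / 2"
      have c: "0 < c" "c < d" "c < h"
        using d(1) e(3) by (auto simp: c_def)
      have "c *\<^sub>R e \<in> U"
        using c e(2) g0 ee by (simp add: U_def)
      moreover have "x + c *\<^sub>R e \<in> ball x d"
        using c e(1) by (simp add: dist_norm)
      ultimately show False
        using disj d(2) by blast
    qed
  qed
qed

text \<open>Elements lie in the closure of \<open>\<Omega>\<close>, so their interiors lie in
  \<open>\<Omega>\<close> because there are no slits. A point of \<open>\<Omega>\<close> in no
  interior is on the frontier of an element, and frontiers of convex sets are null sets.\<close>

lemma mesh_regular_triangulation: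
  assumes \<Omega>: "polyhedral_lipschitz_domain \<Omega>" and \<T>: "regular_triangulation \<Omega> \<T>"
  shows "mesh \<Omega> \<T>"
proof
  show "open \<Omega>" "bounded \<Omega>"
    using \<Omega> by (auto simp: polyhedral_lipschitz_domain_def)
  have tri: "triangulation \<T>" and un: "\<Union>\<T> = closure \<Omega>"
    using \<T> by (auto simp: regular_triangulation_def)
  show fin: "finite \<T>"
    using tri by (simp add: triangulation_def)
  show "T = T'" if T: "T \<in> \<T>" "T' \<in> \<T>" "x \<in> interior T" "x \<in> interior T'" for T T' x
  proof -
    have f: "T \<inter> T' face_of T" "T' \<inter> T face_of T'"
      using tri T by (auto simp: triangulation_def)
    have x: "x \<in> T \<inter> T'"
      using T interior_subset by blast
    \<comment> \<open>A face that contains an interior point of an element is the whole element, so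
      each element contains the other.\<close>
    have "T \<inter> T' = T" "T' \<inter> T = T'"
      using face_of_disjoint_interior[OF f(1)] face_of_disjoint_interior[OF f(2)] x T(3,4) by blast+
    then show ?thesis
      by blast
  qed
  show "interior T \<subseteq> \<Omega>" if "T \<in> \<T>" for T
  proof -
    have "interior T \<subseteq> interior (closure \<Omega>)"
      using un that by (intro interior_mono) auto
    then show ?thesis
      using interior_closure_lipschitz \<Omega> by (auto simp: polyhedral_lipschitz_domain_def)
  qed
  have "negligible (\<Union>T\<in>\<T>. frontier T)"
  proof (intro negligible_Union)
    show "finite (frontier ` \<T>)"
      using fin by simp
    show "negligible F" if "F \<in> frontier ` \<T>" for F
    proof -
      obtain T where T: "T \<in> \<T>" "F = frontier T"
        using \<open>F \<in> frontier ` \<T>\<close> by blast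
      then obtain n where "n simplex T"
        using tri by (auto simp: triangulation_def)
      then show ?thesis
        unfolding T(2) by (intro negligible_convex_frontier convex_simplex)
    qed
  qed
  moreover have "\<Omega> - (\<Union>T\<in>\<T>. interior T) \<subseteq> (\<Union>T\<in>\<T>. frontier T)"
  proof
    fix x
    assume x: "x \<in> \<Omega> - (\<Union>T\<in>\<T>. interior T)"
    then obtain T where T: "T \<in> \<T>" "x \<in> T"
      using un closure_subset by blast
    then have "x \<in> closure T" "x \<notin> interior T"
      using x closure_subset by auto
    with T(1) show "x \<in> (\<Union>T\<in>\<T>. frontier T)"
      by (auto simp: frontier_def)
  qed
  ultimately show "negligible (\<Omega> - (\<Union>T\<in>\<T>. interior T))"
    by (rule negligible_subset)
qed

section \<open>The uniform constant and the passage to the infima\<close>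

theorem theorem4p6:
  fixes \<Omega> :: "(real ^ 'n) set" and \<T>\<^sub>0 :: "(real ^ 'n) set set" and \<rho> \<gamma>\<^sub>1 \<gamma>\<^sub>2 :: real
  assumes "polyhedral_lipschitz_domain \<Omega>"
    and "regular_triangulation \<Omega> \<T>\<^sub>0"
    and "\<rho> > 0"
    and "0 < \<gamma>\<^sub>1" and "\<gamma>\<^sub>1 \<le> \<gamma>\<^sub>2"
  shows "\<exists>C>0. \<forall>\<phi> \<T> \<nu> f u t u\<^sub>h t\<^sub>h v\<^sub>h.
    nonlinearity \<gamma>\<^sub>1 \<gamma>\<^sub>2 \<phi> \<longrightarrow>
    C1_map (sigma_map \<phi> :: real ^ 'n \<Rightarrow> real ^ 'n) \<longrightarrow>
    \<T> \<in> admissible_triangulations \<Omega> \<T>\<^sub>0 \<rho> \<longrightarrow>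
    side_normals \<T> \<nu> \<longrightarrow>
    f \<in> L2 \<Omega> \<longrightarrow>
    u \<in> H1_0 \<Omega> \<longrightarrow> t \<in> H_minus_half_skeleton \<Omega> \<T> \<longrightarrow>
    (\<forall>v\<in>broken_H1 \<T>. b_form \<phi> \<Omega> \<T> u t v = load \<Omega> f v) \<longrightarrow>
    is_arg_min (\<lambda>(w, s). Yh_dual_norm \<Omega> \<T> (residual \<phi> \<Omega> \<T> f w s))
      (\<lambda>(w, s). w \<in> S1_0 \<Omega> \<T> \<and> s \<in> P0_sides \<Omega> \<T> \<nu>) (u\<^sub>h, t\<^sub>h) \<longrightarrow>
    v\<^sub>h \<in> P1 \<T> \<longrightarrow>
    (\<forall>\<eta>\<in>P1 \<T>. a_form \<Omega> \<T> v\<^sub>h \<eta> = residual \<phi> \<Omega> \<T> f u\<^sub>h t\<^sub>h \<eta>) \<longrightarrow>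
    L2_norm \<Omega> (grad \<Omega> (\<lambda>x. u x - u\<^sub>h x)) + Y_norm \<Omega> \<T> v\<^sub>h
      \<le> C * ((INF u\<^sub>C\<in>S1_0 \<Omega> \<T>. L2_norm \<Omega> (grad \<Omega> (\<lambda>x. u x - u\<^sub>C x))) +
             (INF t\<^sub>0\<in>P0_sides \<Omega> \<T> \<nu>. skeleton_norm \<Omega> \<T> (\<lambda>T v. t T v - t\<^sub>0 T v)))"
proof -
  interpret bounded_open_set \<Omega>
    using assms(1) by unfold_locales (auto simp: polyhedral_lipschitz_domain_def)
  \<comment> \<open>The Friedrichs constant belongs to \<open>\<Omega>\<close>, so \<open>C\<close>
    is fixed before the mesh, the nonlinearity and the load are chosen.\<close>
  obtain K where K: "K > 0" "\<And>v. v \<in> H1_0 \<Omega> \<Longrightarrow> L2_norm \<Omega> v \<le> K * L2_norm \<Omega> (grad \<Omega> v)"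
    using Friedrichs by blast
  define C where "C = 2 + \<gamma>\<^sub>2 + ((K + 1) * (\<gamma>\<^sub>2 + 1) + \<gamma>\<^sub>2) / \<gamma>\<^sub>1"
  have C: "C > 0"
    using K(1) assms(4,5) unfolding C_def by (intro add_pos_nonneg divide_nonneg_pos) auto
  show ?thesis
  proof (intro exI[of _ C] conjI C allI impI)
    fix \<phi> \<T> \<nu> f u t u\<^sub>h t\<^sub>h v\<^sub>h
    assume nl: "nonlinearity \<gamma>\<^sub>1 \<gamma>\<^sub>2 \<phi>"
      and adm: "\<T> \<in> admissible_triangulations \<Omega> \<T>\<^sub>0 \<rho>"
      and u: "u \<in> H1_0 \<Omega>" and t: "t \<in> H_minus_half_skeleton \<Omega> \<T>"
      and sol: "\<forall>v\<in>broken_H1 \<T>. b_form \<phi> \<Omega> \<T> u t v = load \<Omega> f v"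
      and argmin: "is_arg_min (\<lambda>(w, s). Yh_dual_norm \<Omega> \<T> (residual \<phi> \<Omega> \<T> f w s))
        (\<lambda>(w, s). w \<in> S1_0 \<Omega> \<T> \<and> s \<in> P0_sides \<Omega> \<T> \<nu>) (u\<^sub>h, t\<^sub>h)"
      and vh: "v\<^sub>h \<in> P1 \<T>"
      and riesz: "\<forall>\<eta>\<in>P1 \<T>. a_form \<Omega> \<T> v\<^sub>h \<eta> = residual \<phi> \<Omega> \<T> f u\<^sub>h t\<^sub>h \<eta>"
    interpret mesh \<Omega> \<T>
      using adm by (intro mesh_regular_triangulation assms(1)) (simp add: admissible_triangulations_def)
    define l where "l = L2_norm \<Omega> (grad \<Omega> (\<lambda>x. u x - u\<^sub>h x)) + Y_norm \<Omega> \<T> v\<^sub>h"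
    \<comment> \<open>The two competitors are independent. With \<open>C\<close> moved to the left,
      the infimum over \<open>u\<^sub>C\<close> is taken for fixed \<open>t\<^sub>0\<close>, and
      then the one over \<open>t\<^sub>0\<close>.\<close>
    have best: "l / C \<le> L2_norm \<Omega> (grad \<Omega> (\<lambda>x. u x - u\<^sub>C x)) + skeleton_norm \<Omega> \<T> (\<lambda>T v. t T v - t\<^sub>0 T v)"
      if "u\<^sub>C \<in> S1_0 \<Omega> \<T>" "t\<^sub>0 \<in> P0_sides \<Omega> \<T> \<nu>" for u\<^sub>C t\<^sub>0
      using quasi_best_approximation[OF nl assms(4) K u t _ argmin vh _ that] sol riesz C
      by (simp add: l_def C_def divide_le_eq mult.commute)
    \<comment> \<open>The minimizer itself witnesses that both infima run over nonempty
      sets.\<close>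
    have ne: "S1_0 \<Omega> \<T> \<noteq> {}" "P0_sides \<Omega> \<T> \<nu> \<noteq> {}"
      using argmin by (auto simp: is_arg_min_def)
    have "l / C - skeleton_norm \<Omega> \<T> (\<lambda>T v. t T v - t\<^sub>0 T v) \<le>
        (INF u\<^sub>C\<in>S1_0 \<Omega> \<T>. L2_norm \<Omega> (grad \<Omega> (\<lambda>x. u x - u\<^sub>C x)))" if "t\<^sub>0 \<in> P0_sides \<Omega> \<T> \<nu>" for t\<^sub>0
      using best[OF _ that] by (intro cINF_greatest ne) (simp add: diff_le_eq)
    then have "l / C - (INF u\<^sub>C\<in>S1_0 \<Omega> \<T>. L2_norm \<Omega> (grad \<Omega> (\<lambda>x. u x - u\<^sub>C x))) \<le>
        (INF t\<^sub>0\<in>P0_sides \<Omega> \<T> \<nu>. skeleton_norm \<Omega> \<T> (\<lambda>T v. t T v - t\<^sub>0 T v))"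
      by (intro cINF_greatest ne) (simp add: diff_le_eq add.commute)
    then have "l / C \<le> (INF u\<^sub>C\<in>S1_0 \<Omega> \<T>. L2_norm \<Omega> (grad \<Omega> (\<lambda>x. u x - u\<^sub>C x))) +
        (INF t\<^sub>0\<in>P0_sides \<Omega> \<T> \<nu>. skeleton_norm \<Omega> \<T> (\<lambda>T v. t T v - t\<^sub>0 T v))"
      by (simp add: diff_le_eq add.commute)
    then have "l \<le> C * ((INF u\<^sub>C\<in>S1_0 \<Omega> \<T>. L2_norm \<Omega> (grad \<Omega> (\<lambda>x. u x - u\<^sub>C x))) +
        (INF t\<^sub>0\<in>P0_sides \<Omega> \<T> \<nu>. skeleton_norm \<Omega> \<T> (\<lambda>T v. t T v - t\<^sub>0 T v)))"
      using C by (simp add: divide_le_eq mult.commute)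
    then show "L2_norm \<Omega> (grad \<Omega> (\<lambda>x. u x - u\<^sub>h x)) + Y_norm \<Omega> \<T> v\<^sub>h
      \<le> C * ((INF u\<^sub>C\<in>S1_0 \<Omega> \<T>. L2_norm \<Omega> (grad \<Omega> (\<lambda>x. u x - u\<^sub>C x))) +
             (INF t\<^sub>0\<in>P0_sides \<Omega> \<T> \<nu>. skeleton_norm \<Omega> \<T> (\<lambda>T v. t T v - t\<^sub>0 T v)))"
      by (simp add: l_def)
  qed
qed

end
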